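(* Let $\mu_{1},\mu_{2}\in\mathcal{P}_{\mathbb{R}_{+}}$ be two nondegenerate measures such that $\mu_{2}$ is $\boxtimes$-infinitely divisible, and let \[ \Phi(z)=\gamma z\exp\left[\int_{[0,+\infty]}\frac{1+tz}{z-t}\,d\sigma(t)\right],\quad z\in\mathbb{C}\setminus\mathbb{R}_{+}, \] be an analytic continuation of $\eta_{\mu_{2}}^{\langle-1\rangle}$, where $\gamma>0$ and $\sigma$ is a finite Borel measure on $[0,+\infty]$. Let $\rho_1\in\mathcal{P}_{\mathbb{R}_{+}}$ be the measure satisfying $\eta_{\mu_1\boxtimes\mu_2}=\eta_{\mu_1}\circ\eta_{\rho_1}$, and let $q_{\mu_1\boxtimes\mu_2}$ be the density of $\mu_1\boxtimes\mu_2$ on $(0,+\infty)$ relative to the Haar measure $dx/x$. Suppose that $\sigma((0,+\infty))>0$. If $I\subset(0,+\infty)$ is an open interval with an endpoint $x_{0}>0$ such that $1/\eta_{\rho_{1}}(1/x_{0})$ is not an atom of $\mu_{1}$, and $q_{\mu_{1}\boxtimes\mu_{2}}(x_{0})=0<q_{\mu_{1}\boxtimes\mu_{2}}(x)$ for every $x\in I$, then $q_{\mu_{1}\boxtimes\mu_{2}}(x)/|x-x_{0}|^{1/3}$ is bounded for $x\in I$ close to $x_{0}$.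
   Context: $\mathcal{P}_{\mathbb{R}_{+}}$ is the set of Borel probability measures on $\mathbb{R}_{+}=[0,+\infty)$; nondegenerate means not a point mass; $\mathbb{H}$ is the open upper half-plane. For $\mu\in\mathcal{P}_{\mathbb{R}_{+}}\setminus\{\delta_0\}$ put $\psi_{\mu}(z)=\int_{\mathbb{R}_{+}}\frac{tz}{1-tz}\,d\mu(t)$ and $\eta_{\mu}(z)=\frac{\psi_{\mu}(z)}{1+\psi_{\mu}(z)}$ for $z\in\mathbb{C}\setminus\mathbb{R}_{+}$; $\eta_\mu$ has an inverse $\eta_{\mu}^{\langle-1\rangle}$ defined near some interval $(\alpha,0)$, $\alpha<0$. The free multiplicative convolution $\mu=\mu_1\boxtimes\mu_2$ is determined by $z\eta_{\mu}^{\langle-1\rangle}(z)=\eta_{\mu_{1}}^{\langle-1\rangle}(z)\eta_{\mu_{2}}^{\langle-1\rangle}(z)$ near some interval $(\alpha,0)$. A measure $\mu\neq\delta_0$ is $\boxtimes$-infinitely divisible (an $n$-fold $\boxtimes$-power for every $n$) precisely when $\eta_\mu^{\langle-1\rangle}$ has an analytic continuation to $\mathbb{C}\setminus\mathbb{R}_+$ of the form $\gamma z\exp\left[\int_{[0,+\infty]}\frac{1+tz}{z-t}\,d\sigma(t)\right]$ with $\gamma>0$ and $\sigma$ a finite Borel measure on the one-point compactification $[0,+\infty]$ (the fraction is interpreted as $-z$ when $t=+\infty$). The measure $\rho_1$ exists, is unique and is $\boxtimes$-infinitely divisible; $\eta_{\rho_1}^{\langle-1\rangle}$ has the analytic continuation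 $\Psi(z)=z\Phi(\eta_{\mu_1}(z))/\eta_{\mu_1}(z)$ to $\mathbb{C}\setminus\mathbb{R}_{+}$. The map $\eta_{\rho_1}|\mathbb{H}$ extends to a homeomorphism of $\overline{\mathbb{H}}$ onto $\overline{\eta_{\rho_1}(\mathbb{H})}$ (with $\eta_{\rho_1}(x)$, $x>0$, denoting the boundary values, which lie in $\mathbb{H}\cup(0,+\infty)$), and $\eta_{\mu_1}$ extends continuously to $\overline{\eta_{\rho_1}(\mathbb{H})}$ if $\infty$ is allowed as a value. The density is understood as $q_{\mu_1\boxtimes\mu_2}(1/x)=\frac1\pi\Im\frac{1}{1-\eta_{\mu_1}(\eta_{\rho_1}(x))}$ if $\eta_{\rho_1}(x)\in\mathbb{H}$, and $q_{\mu_1\boxtimes\mu_2}(1/x)=0$ if $\eta_{\rho_1}(x)\in(0,+\infty)$, for $x\in(0,+\infty)$. *)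

theory Defs
  imports "HOL-Probability.Probability" "HOL-Complex_Analysis.Complex_Analysis"
begin

definition prob_Rplus :: "real measure \<Rightarrow> bool" where
  "prob_Rplus \<mu> \<longleftrightarrow> prob_space \<mu> \<and> sets \<mu> = sets borel \<and> emeasure \<mu> {..<0} = 0"

definition nondegenerate :: "real measure \<Rightarrow> bool" where
  "nondegenerate \<mu> \<longleftrightarrow> (\<forall>a. \<mu> \<noteq> return borel a)"

definition upper_half_plane :: "complex set" where
  "upper_half_plane = {z. Im z > 0}"

definition psi :: "real measure \<Rightarrow> complex \<Rightarrow> complex" where
  "psi \<mu> z = (LINT t:{0..}|\<mu>. of_real t * z / (1 - of_real t * z))"

definition eta :: "real measure \<Rightarrow> complex \<Rightarrow> complex" where
  "eta \<mu> z = psi \<mu> z / (1 + psi \<mu> z)"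

text \<open>
  \<open>f\<close> represents the inverse of \<open>eta \<mu>\<close> on the open neighbourhood \<open>U\<close> of the
  interval \<open>(\<alpha>, 0)\<close> of the negative half-line. The last clause records that the inverse in
  question is the one of the restriction of \<open>eta \<mu>\<close> to the negative half-line.
  For \<open>\<mu> = \<delta>\<^sub>0\<close> there is no such \<open>f\<close>, because \<open>eta \<mu>\<close> vanishes.
\<close>
definition eta_inverse_near ::
  "real measure \<Rightarrow> real \<Rightarrow> complex set \<Rightarrow> (complex \<Rightarrow> complex) \<Rightarrow> bool" where
  "eta_inverse_near \<mu> \<alpha> U f \<longleftrightarrow>
     \<alpha> < 0 \<and> open U \<and> complex_of_real ` {\<alpha><..<0} \<subseteq> U \<and> U \<subseteq> - \<real>\<^sub>\<ge>\<^sub>0 \<and>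
     f holomorphic_on U \<and> f ` U \<subseteq> - \<real>\<^sub>\<ge>\<^sub>0 \<and> (\<forall>z\<in>U. eta \<mu> (f z) = z) \<and>
     (\<forall>x\<in>{\<alpha><..<0}. f (of_real x) \<in> complex_of_real ` {..<0})"

text \<open>
  \<open>free_mult_conv \<mu>\<^sub>1 \<mu>\<^sub>2 \<mu>\<close> says that \<open>\<mu>\<close> is the free multiplicative convolution of \<open>\<mu>\<^sub>1\<close>
  and \<open>\<mu>\<^sub>2\<close>. It is used only for measures other than \<open>\<delta>\<^sub>0\<close>.
\<close>
definition free_mult_conv :: "real measure \<Rightarrow> real measure \<Rightarrow> real measure \<Rightarrow> bool" where
  "free_mult_conv \<mu>\<^sub>1 \<mu>\<^sub>2 \<mu> \<longleftrightarrow>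
     prob_Rplus \<mu>\<^sub>1 \<and> prob_Rplus \<mu>\<^sub>2 \<and> prob_Rplus \<mu> \<and>
     (\<exists>\<alpha> U f f\<^sub>1 f\<^sub>2. eta_inverse_near \<mu> \<alpha> U f \<and>
        eta_inverse_near \<mu>\<^sub>1 \<alpha> U f\<^sub>1 \<and> eta_inverse_near \<mu>\<^sub>2 \<alpha> U f\<^sub>2 \<and>
        (\<forall>z\<in>U. z * f z = f\<^sub>1 z * f\<^sub>2 z))"

text \<open>
  \<open>free_mult_power \<nu> n \<mu>\<close>: the measure \<open>\<mu>\<close> is the \<open>n\<close>-fold power of \<open>\<nu>\<close>. The point mass
  at 1 is the unit of the convolution.
\<close>
primrec free_mult_power :: "real measure \<Rightarrow> nat \<Rightarrow> real measure \<Rightarrow> bool" where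
  "free_mult_power \<nu> 0 \<mu> \<longleftrightarrow> \<mu> = return borel 1"
| "free_mult_power \<nu> (Suc n) \<mu> \<longleftrightarrow> (\<exists>\<kappa>. free_mult_power \<nu> n \<kappa> \<and> free_mult_conv \<kappa> \<nu> \<mu>)"

definition free_mult_infdiv :: "real measure \<Rightarrow> bool" where
  "free_mult_infdiv \<mu> \<longleftrightarrow> (\<forall>n\<ge>1. \<exists>\<nu>. prob_Rplus \<nu> \<and> free_mult_power \<nu> n \<mu>)"

text \<open>
  The one-point compactification of the half-line is the type \<^typ>\<open>ennreal\<close>;
  the value at \<open>t = \<infinity>\<close> is the limit of the fraction as \<open>t \<rightarrow> \<infinity>\<close>.
\<close>
definition levy_kernel :: "complex \<Rightarrow> ennreal \<Rightarrow> complex" where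
  "levy_kernel z t =
     (if t = \<infinity> then - z
      else (1 + of_real (enn2real t) * z) / (z - of_real (enn2real t)))"

definition Phi :: "real \<Rightarrow> ennreal measure \<Rightarrow> complex \<Rightarrow> complex" where
  "Phi \<gamma> \<sigma> z = of_real \<gamma> * z * exp (LINT t|\<sigma>. levy_kernel z t)"

definition continues_eta_inverse :: "real measure \<Rightarrow> (complex \<Rightarrow> complex) \<Rightarrow> bool" where
  "continues_eta_inverse \<mu> F \<longleftrightarrow>
     F holomorphic_on - \<real>\<^sub>\<ge>\<^sub>0 \<and>
     (\<exists>\<alpha> U f. eta_inverse_near \<mu> \<alpha> U f \<and> (\<forall>z\<in>U. F z = f z))"

text \<open>Boundary value at a point of the real line, approached from the upper half-plane.\<close>
definition eta_boundary :: "real measure \<Rightarrow> real \<Rightarrow> complex" where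
  "eta_boundary \<rho> x = Lim (at (complex_of_real x) within upper_half_plane) (eta \<rho>)"

text \<open>
  The density of \<open>\<mu>\<^sub>1 \<boxtimes> \<mu>\<^sub>2\<close> relative to \<open>dx/x\<close>, where \<open>\<rho>\<^sub>1\<close> is the measure with
  \<open>\<eta>\<^bsub>\<mu>\<^sub>1 \<boxtimes> \<mu>\<^sub>2\<^esub> = \<eta>\<^bsub>\<mu>\<^sub>1\<^esub> \<circ> \<eta>\<^bsub>\<rho>\<^sub>1\<^esub>\<close>. The boundary values of \<open>\<eta>\<^bsub>\<rho>\<^sub>1\<^esub>\<close> on
  the positive half-line lie in the upper half-plane or in \<open>(0, \<infinity>)\<close>; the second case of the
  conditional is the latter one.
\<close>
definition haar_density :: "real measure \<Rightarrow> real measure \<Rightarrow> real \<Rightarrow> real" where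
  "haar_density \<mu>\<^sub>1 \<rho>\<^sub>1 x =
     (let w = eta_boundary \<rho>\<^sub>1 (1 / x)
      in if w \<in> upper_half_plane then Im (1 / (1 - eta \<mu>\<^sub>1 w)) / pi else 0)"

end

theory Submission
  imports Defs "HOL-Real_Asymp.Real_Asymp"
begin

text \<open>
  Let \<open>\<omega> = \<eta>\<^bsub>\<rho>\<^sub>1\<^esub>\<close>. Analytic continuation of the equation that defines the convolution gives
  \<open>\<gamma> \<omega>(z) exp (-N (\<omega>(z))) = z\<close> with \<open>N = -u \<circ> \<eta>\<^bsub>\<mu>\<^sub>1\<^esub>\<close>, where \<open>u\<close> is the exponent of \<open>\<Phi>\<close>.
  The function \<open>N\<close> is a Pick function that is real on the negative half-line, so it is a mixture of the
  kernels \<open>(S + C w) / (C - S w)\<close> with \<open>C\<^sup>2 + S\<^sup>2 = 1\<close> and \<open>C S \<ge> 0\<close>. In the coordinate \<open>\<zeta> = ln w\<close> put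
  \<open>h\<^sub>\<zeta> = 1 / (C e\<^bsup>-\<zeta>/2\<^esup> - S e\<^bsup>\<zeta>/2\<^esup>)\<close>; then \<open>N(\<xi>) - N(\<zeta>) = 2 sinh ((\<xi> - \<zeta>)/2) \<integral> h\<^sub>\<xi> h\<^sub>\<zeta>\<close> and
  \<open>Im N(\<zeta>) = sin (Im \<zeta>) \<integral> |h\<^sub>\<zeta>|\<^sup>2\<close>. The range of \<open>\<omega>\<close> lies in \<open>Im N(\<zeta>) \<le> Im \<zeta>\<close>, and the sign condition
  \<open>C S \<ge> 0\<close> makes the defect in the Cauchy--Schwarz inequality for \<open>\<integral> h\<^sub>\<xi> h\<^sub>\<zeta>\<close> exceed the quadratic
  Taylor terms of \<open>\<theta> / sin \<theta>\<close> and \<open>(b/2) / sinh (b/2)\<close>. Hence \<open>L(\<zeta>) = \<zeta> - N(\<zeta>)\<close> satisfies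
  \<open>|L(\<xi>) - L(\<zeta>)| \<ge> |\<xi> - \<zeta>|\<^sup>3 / 100\<close> for close points of that range. This yields the
  boundary values of \<open>\<omega>\<close>, and \<open>Im \<omega>(1/x) = O(|x - x\<^sub>0|\<^bsup>1/3\<^esup>)\<close> at a real boundary value. The density is
  \<open>Im \<omega>(1/x) / \<pi>\<close> times an integral against \<open>\<mu>\<^sub>1\<close>, which stays bounded because \<open>\<mu>\<^sub>1\<close> has no atom at
  \<open>1/\<omega>(1/x\<^sub>0)\<close>.
\<close>

section \<open>Elementary estimates\<close>

text \<open>At a real boundary value both \<open>L'\<close> and \<open>L''\<close> can vanish, so a
  uniform lower bound for differences of \<open>L\<close> cannot be better than cubic; this is the
  source of the exponent 1/3. A segment joining two points of the range may leave the range, so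
  \<open>L'\<close> is not integrated along it: the exact difference identity compares the two
  points directly. The leading terms fit together: with \<beta> = \<xi> - cnj \<zeta>, the
  Cauchy--Schwarz defect contributes |\<beta>|^2/8, and the Taylor terms of both quotients, with
  coefficients 1/24 and 1/6, reduce it to exactly |\<beta>|^2/12. The decimal constants below are
  roundings of this budget. Smallness of \<beta> forces both points close to the real axis; boundary
  values inside the strip are reached through isolated zeros instead. Existence of the limits must
  itself be derived, since \<open>eta_boundary\<close> is a \<open>Lim\<close>. A second obstacle is
  that 1 + \<psi> may tend to 0, where \<eta> becomes infinite. The integral against the first
  measure is therefore bounded by absorption, from the identity Im N = Im \<zeta> on the boundary
  and the positive mass of \<sigma>.\<close>

lemma cmod_minus_squared: "(cmod (x - y))\<^sup>2 = (cmod x)\<^sup>2 + (cmod y)\<^sup>2 - 2 * Re (x * cnj y)"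
  unfolding cmod_power2 by (simp add: power2_eq_square algebra_simps)

text \<open>Even powers cancel between the cubic Taylor polynomials at z/2 and -z/2, leaving the
  start of the series of 2 sinh (z/2). A remainder of order 4 suffices, since only relative errors
  beyond the quadratic one have to be negligible.\<close>

lemma norm_two_sinh_half:
  fixes z :: complex
  assumes "cmod z \<le> 1"
  shows "cmod (exp (z / 2) - exp (- z / 2) - z - z ^ 3 / 24) \<le> cmod z ^ 4"
proof -
  have e: "cmod (exp w - (\<Sum>k\<le>3. w ^ k / fact k)) \<le> cmod w ^ 4" if "cmod w \<le> 1 / 2" for w
  proof -
    have "exp \<bar>Re w\<bar> \<le> exp 1"
      using abs_Re_le_cmod[of w] that by simp
    hence "exp \<bar>Re w\<bar> \<le> 3"
      using e_less_272 by linarith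
    hence "exp \<bar>Re w\<bar> * cmod w ^ 4 / 6 \<le> 3 * cmod w ^ 4 / 6"
      by (intro divide_right_mono mult_right_mono) auto
    also have "\<dots> \<le> cmod w ^ 4" by simp
    finally show ?thesis
      using Taylor_exp[of w 3] by (simp add: fact_numeral)
  qed
  have 1: "cmod (exp (z/2) - (\<Sum>k\<le>3. (z/2) ^ k / fact k)) \<le> cmod z ^ 4 / 16"
    using e[of "z/2"] assms by (simp add: norm_divide power_divide)
  have 2: "cmod (exp (-z/2) - (\<Sum>k\<le>3. (-z/2) ^ k / fact k)) \<le> cmod z ^ 4 / 16"
    using e[of "-z/2"] assms by (simp add: norm_divide power_divide)
  have "exp (z / 2) - exp (- z / 2) - z - z ^ 3 / 24 =
     (exp (z/2) - (\<Sum>k\<le>3. (z/2) ^ k / fact k)) - (exp (-z/2) - (\<Sum>k\<le>3. (-z/2) ^ k / fact k))"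
    by (simp add: eval_nat_numeral field_simps)
  also have "cmod \<dots> \<le> cmod z ^ 4 / 16 + cmod z ^ 4 / 16"
    by (rule order_trans[OF norm_triangle_ineq4 add_mono[OF 1 2]])
  also have "\<dots> \<le> cmod z ^ 4" by simp
  finally show ?thesis .
qed

text \<open>\<open>s\<close> is 2 sinh (z/2), the prefactor in \<open>V_diff\<close>. The third part
  is the expansion (z/2) / sinh (z/2) = 1 - z^2/24 + ...; the radius 1/1000 lets all later terms be
  charged to |z|^2/200.\<close>

lemma sinh_quotient_bounds:
  fixes z :: complex
  assumes z: "cmod z \<le> 1 / 1000"
  defines "s \<equiv> exp (z / 2) - exp (- z / 2)"
  shows "cmod s \<ge> 999 / 1000 * cmod z"
    and "cmod s \<le> 1001 / 1000 * cmod z"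
    and "z \<noteq> 0 \<Longrightarrow> Re (z / s) \<ge> 1 - Re (z\<^sup>2) / 24 - (cmod z)\<^sup>2 / 200"
proof -
  let ?r = "cmod z"
  have T: "cmod (s - z - z ^ 3 / 24) \<le> ?r ^ 4"
    using norm_two_sinh_half[of z] z unfolding s_def by simp
  have r2: "?r^2 \<le> ?r / 1000"
    using mult_right_mono[OF z, of ?r] by (simp add: power2_eq_square)
  have r3: "?r ^ 3 \<le> ?r / 1000000"
    using mult_mono[OF r2 z] by (simp add: power3_eq_cube power2_eq_square)
  have r43: "?r ^ 4 \<le> ?r ^ 3 / 1000"
    using mult_right_mono[OF z, of "?r ^ 3"] by (simp add: eval_nat_numeral)
  have D: "cmod (s - z) \<le> ?r ^ 3"
  proof -
    have "s - z = (s - z - z ^ 3 / 24) + z ^ 3 / 24" by simp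
    also have "cmod \<dots> \<le> ?r ^ 4 + ?r ^ 3 / 24"
      using norm_triangle_ineq[of "s - z - z ^ 3 / 24" "z^3/24"] T
      by (simp add: norm_power norm_divide)
    also have "\<dots> \<le> ?r ^ 3" using r43 zero_le_power[OF norm_ge_zero[of z], of 3] by linarith
    finally show ?thesis .
  qed
  have n0: "0 \<le> ?r" by simp
  show lo: "cmod s \<ge> 999 / 1000 * ?r"
    using norm_triangle_ineq2[of z s] D r3 n0 norm_minus_commute[of z s] by linarith
  show "cmod s \<le> 1001 / 1000 * ?r"
    using norm_triangle_ineq2[of s z] D r3 n0 by linarith
  assume nz: "z \<noteq> 0"
  hence rp: "?r > 0" by simp
  have s0: "s \<noteq> 0" using lo rp by auto
  \<comment> \<open>The numerator is split into the cubic Taylor remainder and (s - z) z^2/24. Both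
    are at most |z|^4, so division by s, which is of size |z|, leaves an error of third
    order.\<close>
  have "z / s - (1 - z\<^sup>2 / 24) = (- (s - z - z ^ 3 / 24) + (s - z) * z\<^sup>2 / 24) / s"
    using s0 by (simp add: field_simps power3_eq_cube power2_eq_square)
  also have "cmod \<dots> = cmod (- (s - z - z ^ 3 / 24) + (s - z) * z\<^sup>2 / 24) / cmod s"
    by (simp add: norm_divide)
  also have "\<dots> \<le> (?r ^ 4 + ?r ^ 4) / (999 / 1000 * ?r)"
  proof (rule frac_le)
    have "cmod ((s - z) * z\<^sup>2 / 24) \<le> ?r ^ 4"
    proof -
      have "cmod (s - z) * ?r\<^sup>2 \<le> ?r ^ 3 * ?r"
        using mult_mono[OF D, of "?r\<^sup>2" ?r] r2 rp by simp
      also have "?r ^ 3 * ?r = ?r ^ 4" by (simp add: eval_nat_numeral)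
      finally have "cmod ((s - z) * z\<^sup>2) \<le> ?r ^ 4" by (simp add: norm_mult norm_power)
      moreover have "cmod ((s - z) * z\<^sup>2 / 24) = cmod ((s - z) * z\<^sup>2) / 24"
        unfolding norm_divide by simp
      ultimately show ?thesis
        using norm_ge_zero[of "(s - z) * z\<^sup>2"] by linarith
    qed
    thus "cmod (- (s - z - z ^ 3 / 24) + (s - z) * z\<^sup>2 / 24) \<le> ?r ^ 4 + ?r ^ 4"
      using norm_triangle_ineq[of "- (s - z - z ^ 3 / 24)" "(s - z) * z\<^sup>2 / 24"] T
      by (simp add: norm_minus_commute)
  qed (use lo rp in auto)
  also have "\<dots> \<le> (?r)\<^sup>2 / 200"
  proof -
    have "(?r ^ 4 + ?r ^ 4) / (999 / 1000 * ?r) = ?r ^ 3 * (2000 / 999)"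
      using rp by (simp add: field_simps eval_nat_numeral)
    also have "\<dots> \<le> (?r\<^sup>2 / 1000) * (2000 / 999)"
      using mult_right_mono[OF z, of "?r\<^sup>2"]
      by (intro mult_right_mono) (simp_all add: eval_nat_numeral)
    also have "\<dots> \<le> ?r\<^sup>2 / 200"
      using zero_le_power2[of ?r] by simp
    finally show ?thesis .
  qed
  finally have "cmod (z / s - (1 - z\<^sup>2 / 24)) \<le> (?r)\<^sup>2 / 200" .
  moreover have "\<bar>Re (z / s - (1 - z\<^sup>2 / 24))\<bar> \<le> cmod (z / s - (1 - z\<^sup>2 / 24))"
    by (rule abs_Re_le_cmod)
  ultimately show "Re (z / s) \<ge> 1 - Re (z\<^sup>2) / 24 - (cmod z)\<^sup>2 / 200"
    by simp
qed

section \<open>Kernels of Pick functions in logarithmic coordinates\<close>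

lemma cos_ge_one_minus_half_square: "cos x \<ge> 1 - x\<^sup>2 / 2" for x :: real
proof -
  have "(sin (x / 2))\<^sup>2 \<le> (x / 2)\<^sup>2"
    using abs_sin_x_le_abs_x[of "x / 2"] by (simp only: abs_le_square_iff)
  thus ?thesis
    using cos_double_sin[of "x / 2"] by (simp add: power_divide)
qed

lemma sin_lower_bound:
  fixes x :: real
  assumes "x \<ge> 0"
  shows "sin x \<ge> x - x ^ 3 / 6 - x ^ 4 / 24"
proof -
  have taylor: "\<bar>sin x - (\<Sum>m<4. sin_coeff m * x ^ m)\<bar> \<le> inverse (fact 4) * \<bar>x\<bar> ^ 4"
    by (rule Maclaurin_sin_bound)
  have sin_series: "(\<Sum>m<4. sin_coeff m * x ^ m) = x - x ^ 3 / 6"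
  proof -
    have "{..<4} = {0, 1, 2, 3 :: nat}" by auto
    thus ?thesis by (simp add: sin_coeff_def fact_numeral)
  qed
  have inv: "inverse (fact 4) * \<bar>x\<bar> ^ 4 = x ^ 4 / 24"
    by (simp add: fact_numeral)
  show ?thesis using taylor[unfolded sin_series inv] by linarith
qed

text \<open>The expansion \<theta> / sin \<theta> = 1 + \<theta>^2/6 + ..., with the same allowance
  1/200 for the tail as in \<open>sinh_quotient_bounds\<close>.\<close>

lemma div_sin_upper:
  fixes x :: real
  assumes "0 < x" "x \<le> 1 / 1000"
  shows "x / sin x \<le> 1 + x\<^sup>2 / 6 + x\<^sup>2 / 200"
proof -
  have lo: "sin x \<ge> x - x ^ 3 / 6 - x ^ 4 / 24"
    using assms by (intro sin_lower_bound) simp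
  have x3: "x ^ 3 \<le> x\<^sup>2 / 1000"
    using mult_right_mono[OF assms(2), of "x\<^sup>2"] by (simp add: eval_nat_numeral)
  have x21: "x\<^sup>2 \<le> 1 / 1000000"
    using power_mono[OF assms(2), of 2] assms by (simp add: power_divide)
  define y where "y = x\<^sup>2"
  have y: "0 \<le> y" "y \<le> 1 / 1000000" using x21 by (auto simp: y_def)
  have "sin x \<ge> x * (1 - y / 6 - y / 24000)"
  proof -
    have "x * (1 - y / 6 - y / 24000) \<le> x * (1 - y / 6 - x ^ 3 / 24)"
      using x3 assms by (intro mult_left_mono) (auto simp: y_def)
    also have "\<dots> = x - x ^ 3 / 6 - x ^ 4 / 24"
      by (simp add: y_def algebra_simps eval_nat_numeral)
    finally show ?thesis using lo by linarith
  qed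
  moreover have "x \<le> x * (1 - y / 6 - y / 24000) * (1 + y / 6 + y / 200)"
  proof -
    have "(1 - y / 6 - y / 24000) * (1 + y / 6 + y / 200) - 1 =
       y * (1/200 - 1/24000 - (1/6 + 1/24000) * (1/6 + 1/200) * y)"
      by (simp add: algebra_simps)
    also have "\<dots> \<ge> 0"
      using y by (intro mult_nonneg_nonneg) auto
    finally show ?thesis
      using assms by (simp add: mult.assoc mult_le_cancel_left1)
  qed
  moreover have "x * (1 - y / 6 - y / 24000) * (1 + y / 6 + y / 200) \<le> sin x * (1 + y / 6 + y / 200)"
    using y calculation(1) by (intro mult_right_mono) auto
  ultimately have "x \<le> sin x * (1 + y / 6 + y / 200)" by linarith
  moreover have "sin x > 0"
    using assms pi_gt3 by (intro sin_gt_zero) auto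
  ultimately show ?thesis
    by (simp add: y_def divide_le_eq mult.commute)
qed

text \<open>Up to the factor exp (z/2) this is the denominator c - s w of the Pick kernel at w = exp
  z. Splitting the exponential symmetrically makes differences and products of two such denominators
  factor by addition theorems.\<close>

definition hden :: "real \<Rightarrow> real \<Rightarrow> complex \<Rightarrow> complex" where
  "hden c s z = of_real c * exp (- z / 2) - of_real s * exp (z / 2)"

lemma cnj_hden: "cnj (hden c s z) = hden c s (cnj z)"
  by (simp add: hden_def exp_cnj)

lemma exp_half_cross: "Re (exp (- z / 2) * cnj (exp (z / 2))) = cos (Im z)"
proof -
  have "exp (- z / 2) * cnj (exp (z / 2)) = exp (- z / 2 + cnj z / 2)"
    by (simp only: exp_cnj mult_exp_exp complex_cnj_divide complex_cnj_numeral)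
  also have "- z / 2 + cnj z / 2 = - \<i> * of_real (Im z)"
    by (simp add: complex_eq_iff)
  finally show ?thesis by (simp add: Re_exp)
qed

lemma norm_exp_half_sq: "(cmod (exp (z / 2)))\<^sup>2 = exp (Re z)" "(cmod (exp (- z / 2)))\<^sup>2 = exp (- Re z)"
  by (simp_all add: power2_eq_square flip: exp_add)

lemma cmod_hden_sq:
  "(cmod (hden c s z))\<^sup>2 = c\<^sup>2 * exp (- Re z) + s\<^sup>2 * exp (Re z) - 2 * c * s * cos (Im z)"
proof -
  have "Re (of_real c * exp (- z / 2) * cnj (of_real s * exp (z / 2))) =
      c * s * Re (exp (- z / 2) * cnj (exp (z / 2)))"
    by (simp add: algebra_simps)
  thus ?thesis
    unfolding hden_def cmod_minus_squared norm_mult power_mult_distrib norm_exp_half_sq exp_half_cross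
    by simp
qed

lemma cmod_hden_plus_sq:
  "(cmod (of_real c * exp (- z / 2) + of_real s * exp (z / 2)))\<^sup>2 =
     c\<^sup>2 * exp (- Re z) + s\<^sup>2 * exp (Re z) + 2 * c * s * cos (Im z)"
  using cmod_hden_sq[of c "-s" z] by (simp add: hden_def)

text \<open>By the arithmetic-geometric mean inequality the cross term takes away at most the
  fraction |cos (Im z)| of c^2 exp (-Re z) + s^2 exp (Re z), and the unit condition bounds that sum
  below by exp (-|Re z|). The bound is uniform in the pair (c, s).\<close>

lemma cmod_hden_lower:
  assumes "c\<^sup>2 + s\<^sup>2 = 1"
  shows "(cmod (hden c s z))\<^sup>2 \<ge> (1 - \<bar>cos (Im z)\<bar>) * exp (- \<bar>Re z\<bar>)"
proof -
  let ?a = "Re z" let ?k = "\<bar>cos (Im z)\<bar>"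
  let ?Q = "c\<^sup>2 * exp (- ?a) + s\<^sup>2 * exp ?a"
  have "0 \<le> (\<bar>c\<bar> * exp (- ?a / 2) - \<bar>s\<bar> * exp (?a / 2))\<^sup>2" by simp
  also have "\<dots> = ?Q - 2 * \<bar>c * s\<bar>"
    unfolding power2_diff power_mult_distrib
    by (simp add: power2_eq_square abs_mult mult_exp_exp)
  finally have "2 * \<bar>c * s\<bar> \<le> ?Q" by simp
  hence "2 * \<bar>c * s\<bar> * ?k \<le> ?Q * ?k" by (rule mult_right_mono) simp
  moreover have "2 * c * s * cos (Im z) \<le> 2 * \<bar>c * s\<bar> * ?k"
    using abs_ge_self[of "2 * c * s * cos (Im z)"] by (simp add: abs_mult mult.assoc)
  ultimately have "(cmod (hden c s z))\<^sup>2 \<ge> ?Q * (1 - ?k)"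
    unfolding cmod_hden_sq by (simp add: algebra_simps)
  moreover have "?Q \<ge> exp (- \<bar>?a\<bar>)"
  proof -
    have "?Q \<ge> c\<^sup>2 * exp (- \<bar>?a\<bar>) + s\<^sup>2 * exp (- \<bar>?a\<bar>)"
      by (intro add_mono mult_left_mono) auto
    thus ?thesis using assms by (simp flip: distrib_right)
  qed
  moreover have "0 \<le> 1 - ?k" by simp
  ultimately have "(1 - ?k) * exp (- \<bar>?a\<bar>) \<le> (1 - ?k) * ?Q"
    by (intro mult_left_mono)
  with \<open>(cmod (hden c s z))\<^sup>2 \<ge> ?Q * (1 - ?k)\<close> show ?thesis
    by (simp add: mult.commute)
qed

lemma abs_cos_less_one:
  assumes "sin x \<noteq> 0"
  shows "\<bar>cos x\<bar> < (1 :: real)"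
proof -
  have "(sin x)\<^sup>2 > 0" using assms by simp
  hence "(cos x)\<^sup>2 < 1" using sin_cos_squared_add[of x] by linarith
  thus ?thesis by (simp add: abs_square_less_1)
qed

lemma hden_nonzero:
  assumes "c\<^sup>2 + s\<^sup>2 = 1" "sin (Im z) \<noteq> 0"
  shows "hden c s z \<noteq> 0"
proof
  assume "hden c s z = 0"
  hence "(1 - \<bar>cos (Im z)\<bar>) * exp (- \<bar>Re z\<bar>) \<le> 0"
    using cmod_hden_lower[OF assms(1), of z] by simp
  thus False using abs_cos_less_one[OF assms(2)] by (simp add: mult_le_0_iff)
qed

text \<open>The first factor is 2 sinh (\<beta>/4); the second is \<open>hden\<close> at the
  midpoint with the sign of s reversed. This reversal is what makes the sign of c s matter.\<close>

lemma hden_diff: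
  assumes "\<beta> = x - y" "M = (x + y) / 2"
  shows "hden c s x - hden c s y =
     - (exp (\<beta> / 4) - exp (- \<beta> / 4)) * (of_real c * exp (- M / 2) + of_real s * exp (M / 2))"
proof -
  have e: "exp (x / 2) = exp (M / 2) * exp (\<beta> / 4)" "exp (- x / 2) = exp (- M / 2) * exp (- \<beta> / 4)"
    "exp (y / 2) = exp (M / 2) * exp (- \<beta> / 4)" "exp (- y / 2) = exp (- M / 2) * exp (\<beta> / 4)"
    by (simp_all add: assms mult_exp_exp field_simps)
  show ?thesis unfolding hden_def e by (simp add: algebra_simps)
qed

lemma hden_mult:
  assumes "\<beta> = x - y" "M = (x + y) / 2"
  shows "hden c s x * hden c s y =
     of_real (c\<^sup>2) * exp (- M) + of_real (s\<^sup>2) * exp M - of_real (c * s) * (exp (\<beta> / 2) + exp (- \<beta> / 2))"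
proof -
  have 1: "exp (- M) = exp (- x / 2) * exp (- y / 2)" "exp M = exp (x / 2) * exp (y / 2)"
    "exp (\<beta> / 2) = exp (x / 2) * exp (- y / 2)" "exp (- \<beta> / 2) = exp (- x / 2) * exp (y / 2)"
    unfolding assms mult_exp_exp
    by (rule arg_cong[where f = exp], simp add: field_simps)+
  show ?thesis unfolding hden_def 1 by (simp add: algebra_simps power2_eq_square)
qed

text \<open>For \<beta> and Im M near 0 both sides are close to c^2 exp (-Re M) + s^2 exp (Re M) + 2
  c s or lie below it. With c s negative the left side could vanish, and the Cauchy--Schwarz defect
  with it. The lemma is applied with y replaced by its conjugate, so that the sum of imaginary parts
  is a difference.\<close>

lemma hden_plus_lower:
  assumes cs: "c * s \<ge> 0" and b: "cmod (x - y) \<le> 1 / 1000" and i: "\<bar>Im x + Im y\<bar> \<le> 1 / 1000"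
  defines "M \<equiv> (x + y) / 2"
  shows "(cmod (of_real c * exp (- M / 2) + of_real s * exp (M / 2)))\<^sup>2
     \<ge> 98 / 100 * cmod (hden c s x * hden c s y)"
proof -
  define \<beta> where "\<beta> = x - y"
  let ?Q = "c\<^sup>2 * exp (- Re M) + s\<^sup>2 * exp (Re M)"
  have Q0: "?Q \<ge> 0" by simp
  have eb: "exp \<bar>Re (\<beta> / 2)\<bar> \<le> 101 / 100"
  proof -
    have "\<bar>Re (\<beta> / 2)\<bar> \<le> 1 / 2000"
      using abs_Re_le_cmod[of \<beta>] b by (simp add: \<beta>_def)
    hence "exp \<bar>Re (\<beta> / 2)\<bar> \<le> exp (1 / 2000)" by simp
    also have "exp (1 / 2000 :: real) \<le> 101 / 100"
      using exp_bound[of "1 / 2000 :: real"] by (simp add: power2_eq_square)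
    finally show ?thesis .
  qed
  have 1: "cmod (exp (\<beta> / 2) + exp (- \<beta> / 2)) \<le> 202 / 100"
  proof -
    have "cmod (exp (\<beta> / 2)) \<le> exp \<bar>Re (\<beta> / 2)\<bar>" "cmod (exp (- \<beta> / 2)) \<le> exp \<bar>Re (\<beta> / 2)\<bar>"
      by simp_all
    thus ?thesis
      using norm_triangle_ineq[of "exp (\<beta> / 2)" "exp (- \<beta> / 2)"] eb by linarith
  qed
  have "cmod (hden c s x * hden c s y) \<le>
     cmod (of_real (c\<^sup>2) * exp (- M)) + cmod (of_real (s\<^sup>2) * exp M) +
     cmod (of_real (c * s) * (exp (\<beta> / 2) + exp (- \<beta> / 2)))"
    unfolding hden_mult[OF \<beta>_def M_def[THEN meta_eq_to_obj_eq]]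
    by (rule order_trans[OF norm_triangle_ineq4 add_mono[OF norm_triangle_ineq order_refl]])
  also have "\<dots> \<le> ?Q + c * s * (202 / 100)"
  proof -
    have "cmod (of_real (c * s) * (exp (\<beta> / 2) + exp (- \<beta> / 2))) \<le> c * s * (202 / 100)"
      using cs mult_left_mono[OF 1 cs] by (simp only: norm_mult[of "of_real (c * s)"] norm_of_real abs_of_nonneg)
    thus ?thesis by (simp add: norm_mult norm_power)
  qed
  finally have up: "cmod (hden c s x * hden c s y) \<le> ?Q + c * s * (202 / 100)" .
  have "(Im M)\<^sup>2 \<le> (1 / 2000)\<^sup>2"
    using i by (subst abs_le_square_iff[symmetric]) (simp add: M_def)
  hence cm: "cos (Im M) \<ge> 99 / 100"
    using cos_ge_one_minus_half_square[of "Im M"] by (simp add: power2_eq_square)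
  have "(cmod (of_real c * exp (- M / 2) + of_real s * exp (M / 2)))\<^sup>2 = ?Q + 2 * (c * s) * cos (Im M)"
    unfolding cmod_hden_plus_sq by simp
  moreover have "2 * (c * s) * cos (Im M) \<ge> 2 * (c * s) * (99 / 100)"
    using cm cs by (intro mult_left_mono) auto
  ultimately have lo: "(cmod (of_real c * exp (- M / 2) + of_real s * exp (M / 2)))\<^sup>2 \<ge> ?Q + (c * s) * (198 / 100)"
    by simp
  \<comment> \<open>The factor 0.98 is fixed by the cross terms: 0.98 times 2.02 is 1.9796, just
    below 1.98.\<close>
  have "98 / 100 * cmod (hden c s x * hden c s y) \<le> 98 / 100 * (?Q + c * s * (202 / 100))"
    by (rule mult_left_mono[OF up]) simp
  also have "\<dots> \<le> ?Q + (c * s) * (198 / 100)"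
  proof -
    have aux: "98 / 100 * (q + p * (202 / 100)) \<le> q + p * (198 / 100)" if "q \<ge> 0" "p \<ge> 0" for p q :: real
      using that by simp
    show ?thesis by (rule aux[OF Q0 cs])
  qed
  finally show ?thesis using lo by (rule order_trans)
qed

text \<open>Points of the extended real line are encoded as C/S with (C, S) on the unit circle, so a
  pole at infinity (S = 0) needs no separate case and no growth condition on the measure. The sign
  condition says that almost all poles lie in [0, \<infinity>], that is, off the negative
  half-line.\<close>

locale herglotz_kernel = finite_measure \<nu> for \<nu> :: "real measure" +
  fixes C S :: "real \<Rightarrow> real"
  assumes C_measurable [measurable]: "C \<in> borel_measurable \<nu>"
    and S_measurable [measurable]: "S \<in> borel_measurable \<nu>"
    and C_S_unit: "(C t)\<^sup>2 + (S t)\<^sup>2 = 1"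
    and C_S_nonneg: "AE t in \<nu>. C t * S t \<ge> 0"
begin

definition kern :: "complex \<Rightarrow> real \<Rightarrow> complex" where
  "kern w t = (of_real (S t) + of_real (C t) * w) / (of_real (C t) - of_real (S t) * w)"

definition V :: "complex \<Rightarrow> complex" where
  "V w = (LINT t|\<nu>. kern w t)"

definition h :: "complex \<Rightarrow> real \<Rightarrow> complex" where
  "h z t = 1 / hden (C t) (S t) z"

lemma hden_measurable [measurable]: "(\<lambda>t. hden (C t) (S t) z) \<in> borel_measurable \<nu>"
  unfolding hden_def by measurable

lemma h_measurable [measurable]: "h z \<in> borel_measurable \<nu>"
  unfolding h_def by measurable

lemma kern_measurable [measurable]: "kern w \<in> borel_measurable \<nu>"
  unfolding kern_def by measurable

lemma C_S_le_1: "\<bar>C t\<bar> \<le> 1" "\<bar>S t\<bar> \<le> 1"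
proof -
  have "(C t)\<^sup>2 \<le> 1" "(S t)\<^sup>2 \<le> 1"
    using C_S_unit[of t] zero_le_power2[of "C t"] zero_le_power2[of "S t"] by linarith+
  thus "\<bar>C t\<bar> \<le> 1" "\<bar>S t\<bar> \<le> 1"
    by (simp_all add: abs_square_le_1)
qed

lemma hden_bounded_below:
  assumes "sin (Im z) \<noteq> 0"
  obtains k where "k > 0" "\<And>t. cmod (hden (C t) (S t) z) \<ge> k"
proof
  let ?k = "sqrt ((1 - \<bar>cos (Im z)\<bar>) * exp (- \<bar>Re z\<bar>))"
  show "?k > 0" using abs_cos_less_one[OF assms] by simp
  show "cmod (hden (C t) (S t) z) \<ge> ?k" for t
    using cmod_hden_lower[OF C_S_unit, of z t] by (intro real_le_lsqrt) simp_all
qed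

lemma h_bounded:
  assumes "sin (Im z) \<noteq> 0"
  obtains B where "\<And>t. cmod (h z t) \<le> B" "B > 0"
proof -
  obtain k where k: "k > 0" "\<And>t. cmod (hden (C t) (S t) z) \<ge> k"
    using hden_bounded_below[OF assms] by blast
  show ?thesis
  proof (rule that)
    show "cmod (h z t) \<le> 1 / k" for t
      unfolding h_def norm_divide norm_one by (rule frac_le) (use k in auto)
  qed (use k in simp)
qed

lemma kern_exp: "kern (exp z) t = (of_real (S t) * exp (- z / 2) + of_real (C t) * exp (z / 2)) * h z t"
proof -
  have e: "exp z = exp (z / 2) * exp (z / 2)" by (simp add: mult_exp_exp)
  have i: "exp (- z / 2) * exp (z / 2) = 1" by (simp add: mult_exp_exp)
  have "of_real (S t) + of_real (C t) * exp z =
      exp (z / 2) * (of_real (S t) * exp (- z / 2) + of_real (C t) * exp (z / 2))"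
    "of_real (C t) - of_real (S t) * exp z = exp (z / 2) * hden (C t) (S t) z"
    unfolding e hden_def using i by (simp_all add: algebra_simps)
  thus ?thesis unfolding kern_def h_def by simp
qed

lemma integrable_h_power:
  assumes "sin (Im z) \<noteq> 0"
  shows "integrable \<nu> (\<lambda>t. (cmod (h z t))\<^sup>2)"
proof -
  obtain B where B: "\<And>t. cmod (h z t) \<le> B" "B > 0" using h_bounded[OF assms(1)] by blast
  show ?thesis
    by (rule integrable_const_bound[of _ "B\<^sup>2"]) (auto intro!: AE_I2 power_mono B)
qed

lemma integrable_h_mult:
  assumes "sin (Im x) \<noteq> 0" "sin (Im y) \<noteq> 0"
  shows "integrable \<nu> (\<lambda>t. h x t * h y t)"
proof -
  obtain A where A: "\<And>t. cmod (h x t) \<le> A" "A > 0" using h_bounded[OF assms(1)] by blast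
  obtain B where B: "\<And>t. cmod (h y t) \<le> B" "B > 0" using h_bounded[OF assms(2)] by blast
  show ?thesis
  proof (rule integrable_const_bound[of _ "A * B"])
    show "AE t in \<nu>. cmod (h x t * h y t) \<le> A * B"
      unfolding norm_mult using A B by (intro AE_I2 mult_mono) (auto simp: less_imp_le)
  qed simp
qed

lemma integrable_kern:
  assumes "sin (Im z) \<noteq> 0"
  shows "integrable \<nu> (kern (exp z))"
proof -
  obtain B where B: "\<And>t. cmod (h z t) \<le> B" "B > 0" using h_bounded[OF assms(1)] by blast
  show ?thesis
  proof (rule integrable_const_bound[of _ "(cmod (exp (- z / 2)) + cmod (exp (z / 2))) * B"])
    show "AE t in \<nu>. cmod (kern (exp z) t) \<le> (cmod (exp (- z / 2)) + cmod (exp (z / 2))) * B"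
    proof (rule AE_I2)
      fix t
      have 1: "cmod (of_real (S t) * exp (- z / 2)) \<le> cmod (exp (- z / 2))"
        "cmod (of_real (C t) * exp (z / 2)) \<le> cmod (exp (z / 2))"
        using C_S_le_1[of t] unfolding norm_mult norm_of_real
        by (auto intro!: mult_left_le_one_le)
      have "cmod (of_real (S t) * exp (- z / 2) + of_real (C t) * exp (z / 2)) \<le>
          cmod (exp (- z / 2)) + cmod (exp (z / 2))"
        by (rule order_trans[OF norm_triangle_ineq add_mono[OF 1]])
      thus "cmod (kern (exp z) t) \<le> (cmod (exp (- z / 2)) + cmod (exp (z / 2))) * B"
        unfolding kern_exp norm_mult by (intro mult_mono B) auto
    qed
  qed simp
qed

text \<open>The kernel is a Moebius map whose coefficient matrix has determinant C^2 + S^2 = 1, so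
  cross-multiplying collapses the numerator to 2 sinh ((x - y)/2), free of the parameter t.\<close>

lemma kern_diff:
  assumes "sin (Im x) \<noteq> 0" "sin (Im y) \<noteq> 0"
  shows "kern (exp x) t - kern (exp y) t = (exp ((x - y) / 2) - exp (- (x - y) / 2)) * (h x t * h y t)"
proof -
  have nz: "hden (C t) (S t) x \<noteq> 0" "hden (C t) (S t) y \<noteq> 0"
    using hden_nonzero[OF C_S_unit] assms by auto
  have e: "exp ((x - y) / 2) = exp (x / 2) * exp (- y / 2)"
    "exp (- (x - y) / 2) = exp (- x / 2) * exp (y / 2)"
    unfolding mult_exp_exp
    by (rule arg_cong[where f = exp], simp add: field_simps)+
  have cs: "of_real (C t) * of_real (C t) + of_real (S t) * of_real (S t) = (1 :: complex)"
    using C_S_unit[of t] by (simp add: power2_eq_square flip: of_real_mult of_real_add)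
  have "(of_real (S t) * exp (- x / 2) + of_real (C t) * exp (x / 2)) * hden (C t) (S t) y -
        (of_real (S t) * exp (- y / 2) + of_real (C t) * exp (y / 2)) * hden (C t) (S t) x =
        (of_real (C t) * of_real (C t) + of_real (S t) * of_real (S t)) *
        (exp (x / 2) * exp (- y / 2) - exp (- x / 2) * exp (y / 2))"
    unfolding hden_def by (simp add: algebra_simps)
  thus ?thesis
    unfolding kern_exp h_def e cs using nz by (simp add: field_simps)
qed

lemma V_diff:
  assumes "sin (Im x) \<noteq> 0" "sin (Im y) \<noteq> 0"
  shows "V (exp x) - V (exp y) =
    (exp ((x - y) / 2) - exp (- (x - y) / 2)) * (LINT t|\<nu>. h x t * h y t)"
proof -
  have "V (exp x) - V (exp y) = (LINT t|\<nu>. kern (exp x) t - kern (exp y) t)"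
    unfolding V_def by (rule Bochner_Integration.integral_diff[symmetric]) (intro integrable_kern assms)+
  also have "\<dots> = (LINT t|\<nu>. (exp ((x - y) / 2) - exp (- (x - y) / 2)) * (h x t * h y t))"
    by (simp only: kern_diff[OF assms])
  finally show ?thesis by simp
qed

lemma kern_cnj: "kern (cnj w) t = cnj (kern w t)"
  by (simp add: kern_def)

lemma h_cnj: "h (cnj z) t = cnj (h z t)"
  by (simp add: h_def cnj_hden)

lemma V_cnj: "V (cnj w) = cnj (V w)"
  by (simp add: V_def kern_cnj)

text \<open>The difference identity at z and its conjugate: the kernel has real coefficients, the
  integrand becomes the square of a modulus, and the prefactor becomes 2 i sin (Im z).\<close>

lemma Im_V:
  assumes "sin (Im z) \<noteq> 0"
  shows "Im (V (exp z)) = sin (Im z) * (LINT t|\<nu>. (cmod (h z t))\<^sup>2)"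
proof -
  have "V (exp z) - cnj (V (exp z)) = V (exp z) - V (exp (cnj z))"
    by (simp only: V_cnj[symmetric] exp_cnj)
  also have "\<dots> = (exp ((z - cnj z) / 2) - exp (- (z - cnj z) / 2)) * (LINT t|\<nu>. h z t * h (cnj z) t)"
    by (rule V_diff) (use assms in auto)
  also have "(\<lambda>t. h z t * h (cnj z) t) = (\<lambda>t. of_real ((cmod (h z t))\<^sup>2))"
    by (simp only: h_cnj complex_norm_square)
  also have "(LINT t|\<nu>. complex_of_real ((cmod (h z t))\<^sup>2)) = of_real (LINT t|\<nu>. (cmod (h z t))\<^sup>2)"
    by (rule integral_complex_of_real)
  also have "(z - cnj z) / 2 = \<i> * of_real (Im z)"
    by (simp add: complex_eq_iff)
  also have "- (z - cnj z) / 2 = - (\<i> * of_real (Im z))"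
    by (simp add: complex_eq_iff)
  finally have "V (exp z) - cnj (V (exp z)) = (exp (\<i> * of_real (Im z)) - exp (- (\<i> * of_real (Im z)))) *
      of_real (LINT t|\<nu>. (cmod (h z t))\<^sup>2)" .
  hence "Im (V (exp z) - cnj (V (exp z))) = Im ((exp (\<i> * of_real (Im z)) - exp (- (\<i> * of_real (Im z)))) *
      of_real (LINT t|\<nu>. (cmod (h z t))\<^sup>2))" by simp
  thus ?thesis by (simp add: Re_exp Im_exp algebra_simps)
qed

text \<open>The last hypothesis holds on the range of the logarithm of the subordination function
  (see \<open>Im_V_le\<close>); here it is turned into an L^2 bound that tends to 1 at the real
  axis.\<close>

lemma integral_h_sq_le:
  assumes "0 < Im z" "Im z < pi" "Im (V (exp z)) \<le> Im z"
  shows "(LINT t|\<nu>. (cmod (h z t))\<^sup>2) \<le> Im z / sin (Im z)"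
proof -
  have "sin (Im z) > 0" using assms by (intro sin_gt_zero) auto
  thus ?thesis using assms(3) Im_V[of z] by (simp add: le_divide_eq mult.commute)
qed

text \<open>Since the conjugate of h at y is h at the conjugate of y, expanding |h_x - cnj h_y|^2
  yields exactly the defect A x + A y - 2 Re J. Pointwise this square is computed from
  \<open>hden_diff\<close> and bounded below through \<open>hden_plus_lower\<close>.\<close>

lemma integral_h_mult_gap:
  assumes x: "0 < Im x" "Im x < pi" and y: "0 < Im y" "Im y < pi"
    and b: "cmod (x - cnj y) \<le> 1 / 1000"
  defines "J \<equiv> (LINT t|\<nu>. h x t * h y t)" and "B \<equiv> (LINT t|\<nu>. cmod (h x t * h y t))"
    and "A \<equiv> (\<lambda>z. LINT t|\<nu>. (cmod (h z t))\<^sup>2)"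
  shows "2 * Re J \<le> A x + A y - 24 / 100 * (cmod (x - cnj y))\<^sup>2 * B" and "Re J \<le> B"
proof -
  have sx: "sin (Im x) \<noteq> 0" and sy: "sin (Im y) \<noteq> 0"
    using sin_gt_zero[OF x] sin_gt_zero[OF y] by auto
  note int = integrable_h_power[OF sx] integrable_h_power[OF sy] integrable_h_mult[OF sx sy]
  note intB = integrable_norm[OF int(3)]
  define \<beta> where "\<beta> = x - cnj y"
  define M where "M = (x + cnj y) / 2"
  define e where "e = exp (\<beta> / 4) - exp (- \<beta> / 4)"
  \<comment> \<open>\<open>e\<close> is 2 sinh (\<beta>/4), about \<beta>/2; the constant is
    (0.999/2)^2 = 0.2495 rounded down.\<close>
  have e: "(cmod e)\<^sup>2 \<ge> 249 / 1000 * (cmod \<beta>)\<^sup>2"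
  proof -
    have "cmod e \<ge> 999 / 1000 * cmod (\<beta> / 2)"
      using sinh_quotient_bounds(1)[of "\<beta> / 2"] b[folded \<beta>_def] unfolding e_def by simp
    hence "(999 / 1000 * cmod (\<beta> / 2))\<^sup>2 \<le> (cmod e)\<^sup>2"
      by (intro power_mono) auto
    moreover have "(999 / 1000 * cmod (\<beta> / 2))\<^sup>2 = (998001 / 4000000) * (cmod \<beta>)\<^sup>2"
      by (simp add: power_mult_distrib power_divide norm_divide power2_eq_square)
    ultimately show ?thesis
      using zero_le_power2[of "cmod \<beta>"] by linarith
  qed
  have pt: "24 / 100 * (cmod \<beta>)\<^sup>2 * cmod (h x t * h y t) \<le> (cmod (h x t - cnj (h y t)))\<^sup>2"
    if cs: "C t * S t \<ge> 0" for t
  proof -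
    have nx: "hden (C t) (S t) x \<noteq> 0" and ny: "hden (C t) (S t) (cnj y) \<noteq> 0"
      using hden_nonzero[OF C_S_unit] sx sy by auto
    let ?P = "of_real (C t) * exp (- M / 2) + of_real (S t) * exp (M / 2)"
    let ?d = "hden (C t) (S t) x * hden (C t) (S t) (cnj y)"
    have "h x t - cnj (h y t) = - (hden (C t) (S t) x - hden (C t) (S t) (cnj y)) / ?d"
      unfolding h_cnj[symmetric] using nx ny by (simp add: h_def field_simps)
    also have "\<dots> = e * ?P / ?d"
      unfolding hden_diff[OF \<beta>_def M_def] e_def[symmetric] by simp
    finally have eq: "(cmod (h x t - cnj (h y t)))\<^sup>2 = (cmod e)\<^sup>2 * (cmod ?P)\<^sup>2 / (cmod ?d)\<^sup>2"
      by (simp add: norm_mult norm_divide power_mult_distrib power_divide)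
    have "cmod (h x t * h y t) = cmod (h x t * h (cnj y) t)"
      by (simp add: h_cnj norm_mult)
    also have "\<dots> = 1 / cmod ?d"
      by (simp add: h_def norm_mult norm_divide)
    finally have hh: "cmod (h x t * h y t) = 1 / cmod ?d" .
    have dpos: "cmod ?d > 0" using nx ny by simp
    have "\<bar>Im x + Im (cnj y)\<bar> \<le> 1 / 1000"
    proof -
      have "Im x + Im y \<le> cmod \<beta>"
        using abs_Im_le_cmod[of \<beta>] x y by (simp add: \<beta>_def)
      moreover have "Im (cnj y) = - Im y" by simp
      ultimately show ?thesis using b[folded \<beta>_def] x y by linarith
    qed
    hence P: "(cmod ?P)\<^sup>2 \<ge> 98 / 100 * cmod ?d"
      using hden_plus_lower[OF cs b] unfolding M_def by blast
    have "24 / 100 * (cmod \<beta>)\<^sup>2 * cmod (h x t * h y t) =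
        24 / 100 * (cmod \<beta>)\<^sup>2 * cmod ?d / (cmod ?d)\<^sup>2"
      unfolding hh using dpos by (simp add: power2_eq_square)
    \<comment> \<open>The product 0.249 times 0.98 is 0.24402, which leaves room for 0.24.\<close>
    also have "\<dots> \<le> (249 / 1000 * (cmod \<beta>)\<^sup>2) * (98 / 100 * cmod ?d) / (cmod ?d)\<^sup>2"
      using dpos by (intro divide_right_mono) (auto intro!: mult_right_mono simp: mult_ac)
    also have "\<dots> \<le> (cmod e)\<^sup>2 * (cmod ?P)\<^sup>2 / (cmod ?d)\<^sup>2"
      by (intro divide_right_mono mult_mono e P) auto
    finally show ?thesis unfolding eq .
  qed
  have sq: "(cmod (h x t - cnj (h y t)))\<^sup>2 = (cmod (h x t))\<^sup>2 + (cmod (h y t))\<^sup>2 - 2 * Re (h x t * h y t)" for t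
    using cmod_minus_squared[of "h x t" "cnj (h y t)"] by simp
  have intR: "integrable \<nu> (\<lambda>t. Re (h x t * h y t))"
    by (rule integrable_Re) (rule int(3))
  have ReJ: "Re J = (LINT t|\<nu>. Re (h x t * h y t))"
    unfolding J_def by (rule integral_Re[symmetric]) (rule int(3))
  have "24 / 100 * (cmod \<beta>)\<^sup>2 * B \<le> (LINT t|\<nu>. (cmod (h x t))\<^sup>2 + (cmod (h y t))\<^sup>2 - 2 * Re (h x t * h y t))"
    unfolding B_def integral_mult_right_zero[symmetric] sq[symmetric]
  proof (rule integral_mono_AE)
    show "integrable \<nu> (\<lambda>t. (cmod (h x t - cnj (h y t)))\<^sup>2)"
      unfolding sq
      by (intro Bochner_Integration.integrable_diff Bochner_Integration.integrable_add integrable_mult_right int intR)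
    show "AE t in \<nu>. 24 / 100 * (cmod \<beta>)\<^sup>2 * cmod (h x t * h y t) \<le> (cmod (h x t - cnj (h y t)))\<^sup>2"
      using C_S_nonneg by eventually_elim (rule pt)
  qed (use intB in simp)
  also have "\<dots> = A x + A y - 2 * Re J"
    unfolding A_def ReJ
    by (simp only: Bochner_Integration.integral_diff[OF Bochner_Integration.integrable_add[OF int(1,2)] integrable_mult_right[OF intR]]
        Bochner_Integration.integral_add[OF int(1,2)] integral_mult_right_zero)
  finally show "2 * Re J \<le> A x + A y - 24 / 100 * (cmod (x - cnj y))\<^sup>2 * B"
    unfolding \<beta>_def by linarith
  show "Re J \<le> B"
    unfolding ReJ B_def by (intro integral_mono intR intB complex_Re_le_cmod)
qed

text \<open>By \<open>V_diff\<close> the difference equals s (z/s - J) with |s| close to |z|, so it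
  is enough that the real part of z/s - J is at least |\<beta>|^2/50. Positive imaginary parts give
  |z| \<le> |\<beta>|, which turns this into the cube of |z|.\<close>

lemma two_point_estimate:
  assumes x: "0 < Im x" "Im x < pi" "Im (V (exp x)) \<le> Im x"
    and y: "0 < Im y" "Im y < pi" "Im (V (exp y)) \<le> Im y"
    and b: "cmod (x - cnj y) \<le> 1 / 1000"
  shows "cmod ((x - V (exp x)) - (y - V (exp y))) \<ge> cmod (x - y) ^ 3 / 100"
proof (cases "x = y")
  case False
  define z where "z = x - y"
  define s where "s = exp (z / 2) - exp (- z / 2)"
  define \<beta> where "\<beta> = x - cnj y"
  define J where "J = (LINT t|\<nu>. h x t * h y t)"
  define B where "B = (LINT t|\<nu>. cmod (h x t * h y t))"
  let ?A = "\<lambda>z. LINT t|\<nu>. (cmod (h z t))\<^sup>2"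
  have sx: "sin (Im x) \<noteq> 0" and sy: "sin (Im y) \<noteq> 0"
    using sin_gt_zero[OF x(1,2)] sin_gt_zero[OF y(1,2)] by auto
  have bsq: "(cmod \<beta>)\<^sup>2 = (Re z)\<^sup>2 + (Im x + Im y)\<^sup>2"
    by (simp add: cmod_power2 \<beta>_def z_def)
  have zsq: "(cmod z)\<^sup>2 = (Re z)\<^sup>2 + (Im x - Im y)\<^sup>2"
    by (simp add: cmod_power2 z_def)
  have z2: "Re (z\<^sup>2) = (Re z)\<^sup>2 - (Im x - Im y)\<^sup>2"
    by (simp add: z_def Re_power2)
  have b2: "(cmod \<beta>)\<^sup>2 \<le> 1 / 1000000"
    using power_mono[OF b, of 2] by (simp add: \<beta>_def power_divide)
  have xy: "Im x * Im y > 0" using x y by simp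
  have sums: "(Im x)\<^sup>2 + (Im y)\<^sup>2 \<le> (Im x + Im y)\<^sup>2"
    "(Im x - Im y)\<^sup>2 \<le> (Im x + Im y)\<^sup>2"
    using xy by (simp_all add: power2_sum power2_diff)
  have zb: "(cmod z)\<^sup>2 \<le> (cmod \<beta>)\<^sup>2" using sums zsq bsq by linarith
  hence zb': "cmod z \<le> cmod \<beta>" by (simp add: power2_le_iff_abs_le)
  have z_small: "cmod z \<le> 1 / 1000" using zb' b by (simp add: \<beta>_def)
  have znz: "z \<noteq> 0" using False by (simp add: z_def)
  have imb: "Im x + Im y \<le> 1 / 1000"
    using abs_Im_le_cmod[of \<beta>] b by (simp add: \<beta>_def)
  have A: "?A x \<le> 1 + (Im x)\<^sup>2 / 6 + (Im x)\<^sup>2 / 200" "?A y \<le> 1 + (Im y)\<^sup>2 / 6 + (Im y)\<^sup>2 / 200"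
    using integral_h_sq_le[OF x] integral_h_sq_le[OF y] div_sin_upper[of "Im x"] div_sin_upper[of "Im y"] imb x y
    by linarith+
  note gap = integral_h_mult_gap[OF x(1,2) y(1,2) b, folded J_def B_def \<beta>_def]
  have q: "Re (z / s) \<ge> 1 - Re (z\<^sup>2) / 24 - (cmod z)\<^sup>2 / 200"
    unfolding s_def by (rule sinh_quotient_bounds(3)[OF z_small znz])
  have main: "Re (z / s) - Re J \<ge> (cmod \<beta>)\<^sup>2 / 50"
  \<comment> \<open>The defect is proportional to B. When B is not close to 1 it may be weak, but
    then Re J \<le> B is already far below z/s, which is nearly 1.\<close>
  proof (cases "B \<ge> 9 / 10")
    case True
    have "(cmod \<beta>)\<^sup>2 * B \<ge> (cmod \<beta>)\<^sup>2 * (9 / 10)"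
      by (rule mult_left_mono[OF True]) simp
    \<comment> \<open>0.108 is half of 0.24 times 0.9.\<close>
    hence J: "Re J \<le> (?A x + ?A y) / 2 - 108 / 1000 * (cmod \<beta>)\<^sup>2"
    proof -
      have "2 * Re J \<le> ?A x + ?A y - 24 / 100 * ((cmod \<beta>)\<^sup>2 * B)"
        using gap(1) by (simp add: mult.assoc)
      moreover have "r \<le> a / 2 - 108 / 1000 * q" if "2 * r \<le> a - 24 / 100 * p" "q * (9 / 10) \<le> p"
        for a p q r :: real
        using that by linarith
      ultimately show ?thesis
        using \<open>(cmod \<beta>)\<^sup>2 * B \<ge> (cmod \<beta>)\<^sup>2 * (9 / 10)\<close> by meson
    qed
    let ?R = "(Re z)\<^sup>2" let ?X = "(Im x)\<^sup>2" let ?Y = "(Im y)\<^sup>2" let ?p = "Im x * Im y"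
    have e: "(cmod \<beta>)\<^sup>2 = ?R + ?X + ?Y + 2 * ?p" "(cmod z)\<^sup>2 = ?R + ?X + ?Y - 2 * ?p"
       "Re (z\<^sup>2) = ?R - ?X - ?Y + 2 * ?p"
      using bsq zsq z2 by (simp_all add: power2_sum power2_diff)
    have "Re (z / s) - Re J \<ge> (1 - (?R - ?X - ?Y + 2 * ?p) / 24 - (?R + ?X + ?Y - 2 * ?p) / 200)
        - (1 + (?X + ?Y) / 12 + (?X + ?Y) / 400) + 108 / 1000 * (?R + ?X + ?Y + 2 * ?p)"
      using q J A unfolding e by (simp add: field_simps)
    moreover have "0 \<le> ?R" "0 \<le> ?X" "0 \<le> ?Y" by simp_all
    \<comment> \<open>Comparison of coefficients: r gets 0.108 - 1/24 - 1/200, u and v get 0.108 +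
      1/24 - 1/200 - 1/12 - 1/400, and p gets 0.216 - 1/12 + 1/100. They exceed 1/50, 1/50 and
      1/25.\<close>
    moreover have "Q \<ge> (r + u + v + 2 * p) / 50"
      if "Q \<ge> (1 - (r - u - v + 2 * p) / 24 - (r + u + v - 2 * p) / 200)
        - (1 + (u + v) / 12 + (u + v) / 400) + 108 / 1000 * (r + u + v + 2 * p)"
        "0 \<le> r" "0 \<le> u" "0 \<le> v" "0 < p" for Q r u v p :: real
      using that by (simp add: field_simps)
    ultimately show ?thesis using xy unfolding e by blast
  next
    case False
    have "Re (z\<^sup>2) \<le> (cmod z)\<^sup>2"
      using complex_Re_le_cmod[of "z\<^sup>2"] by (simp add: norm_power)
    hence "Re (z\<^sup>2) \<le> 1 / 1000000" "(cmod z)\<^sup>2 \<le> 1 / 1000000"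
      using zb b2 by linarith+
    thus ?thesis using False gap(2) q b2 by linarith
  qed
  have slo: "cmod s \<ge> 999 / 1000 * cmod z"
    unfolding s_def by (rule sinh_quotient_bounds(1)[OF z_small])
  hence snz: "s \<noteq> 0" using znz by auto
  have "(x - V (exp x)) - (y - V (exp y)) = z - (V (exp x) - V (exp y))"
    by (simp add: z_def)
  also have "\<dots> = z - s * J"
    unfolding V_diff[OF sx sy] s_def z_def J_def ..
  also have "\<dots> = s * (z / s - J)"
    using snz by (simp add: field_simps)
  finally have eq: "cmod ((x - V (exp x)) - (y - V (exp y))) = cmod s * cmod (z / s - J)"
    by (simp add: norm_mult)
  have "cmod z ^ 3 / 100 \<le> (999 / 1000 * cmod z) * ((cmod z)\<^sup>2 / 50)"
    by (simp add: power3_eq_cube power2_eq_square)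
  also have "\<dots> \<le> cmod s * cmod (z / s - J)"
  proof (rule mult_mono[OF slo])
    show "(cmod z)\<^sup>2 / 50 \<le> cmod (z / s - J)"
    proof -
      have "Re (z / s) - Re J \<le> cmod (z / s - J)"
        using complex_Re_le_cmod[of "z / s - J"] by simp
      thus ?thesis using main zb by linarith
    qed
  qed auto
  finally show ?thesis unfolding eq z_def .
qed (simp add: power3_eq_cube)

end

lemma div_sin_le_4:
  fixes x :: real
  assumes "0 < x" "x \<le> pi / 2"
  shows "x / sin x \<le> 4"
proof -
  have small: "sin y \<ge> y / 2" if "0 < y" "y \<le> 1" for y :: real
  proof -
    have "y ^ 3 \<le> y" "y ^ 4 \<le> y"
      using power_decreasing[of 1 3 y] power_decreasing[of 1 4 y] that by simp_all
    thus ?thesis using sin_lower_bound[of y] that by linarith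
  qed
  show ?thesis
  proof (cases "x \<le> 1")
    case True
    thus ?thesis using small[of x] assms by (simp add: divide_le_eq)
  next
    case False
    hence "sin 1 \<le> sin x" using assms pi_gt3 by (intro sin_monotone_2pi_le) auto
    hence "sin x \<ge> 1 / 2" using small[of 1] by simp
    moreover have "x \<le> 2" using assms pi_less_4 by simp
    ultimately show ?thesis by (simp add: divide_le_eq)
  qed
qed

section \<open>A priori bounds for the real part of \<open>V\<close>\<close>

context herglotz_kernel
begin

lemma cmod_sq_denom:
  "(cmod (of_real (C t) - of_real (S t) * w))\<^sup>2 = (C t)\<^sup>2 - 2 * (C t * S t) * Re w + (S t)\<^sup>2 * (cmod w)\<^sup>2"
  unfolding cmod_power2 by (simp add: power2_eq_square algebra_simps)

lemma Re_kern:
  "Re (kern w t) = (C t * S t * (1 - (cmod w)\<^sup>2) + ((C t)\<^sup>2 - (S t)\<^sup>2) * Re w) /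
     (cmod (of_real (C t) - of_real (S t) * w))\<^sup>2"
proof -
  have "Re (kern w t) = Re ((of_real (S t) + of_real (C t) * w) * cnj (of_real (C t) - of_real (S t) * w)) /
     (cmod (of_real (C t) - of_real (S t) * w))\<^sup>2"
    unfolding kern_def
    by (simp only: complex_div_cnj[of _ "of_real (C t) - of_real (S t) * w"] Re_divide_of_real)
  also have "Re ((of_real (S t) + of_real (C t) * w) * cnj (of_real (C t) - of_real (S t) * w)) =
      C t * S t * (1 - (cmod w)\<^sup>2) + ((C t)\<^sup>2 - (S t)\<^sup>2) * Re w"
    unfolding cmod_power2 by (simp add: power2_eq_square algebra_simps)
  finally show ?thesis .
qed

text \<open>In the left half-plane, with the pole in [0, \<infinity>], all three terms of the
  squared denominator are nonnegative. On each side of the unit circle only one term of the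
  numerator has the harmful sign, and it is dominated by one of those three.\<close>

lemma Re_kern_left_half_plane:
  assumes cs: "C t * S t \<ge> 0" and w: "Re w \<le> 0"
  shows "cmod w \<le> 1 \<Longrightarrow> - Re (kern w t) \<le> 1" and "cmod w \<ge> 1 \<Longrightarrow> - Re (kern w t) \<ge> - 1"
proof -
  let ?D = "(cmod (of_real (C t) - of_real (S t) * w))\<^sup>2"
  have csw: "(C t * S t) * Re w \<le> 0" using cs w by (simp add: mult_nonneg_nonpos)
  have Rew: "- Re w \<le> cmod w" using abs_Re_le_cmod[of w] by simp
  have D: "(C t)\<^sup>2 \<le> ?D" "(S t)\<^sup>2 * (cmod w)\<^sup>2 \<le> ?D"
    unfolding cmod_sq_denom using csw zero_le_power2[of "C t"] mult_nonneg_nonneg[OF zero_le_power2[of "S t"] zero_le_power2[of "cmod w"]]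
    by linarith+
  have D0: "?D \<ge> 0" by simp
  { assume le: "cmod w \<le> 1"
    have "(cmod w)\<^sup>2 \<le> 1" using le by (simp add: abs_square_le_1)
    hence "C t * S t * (1 - (cmod w)\<^sup>2) \<ge> 0" using cs by simp
    moreover have "(S t)\<^sup>2 * Re w \<le> 0" using w by (simp add: mult_nonneg_nonpos)
    moreover have "(C t)\<^sup>2 * (- Re w) \<le> (C t)\<^sup>2 * 1" using Rew le by (intro mult_left_mono) auto
    ultimately have "- (C t * S t * (1 - (cmod w)\<^sup>2) + ((C t)\<^sup>2 - (S t)\<^sup>2) * Re w) \<le> ?D"
      using D(1) by (simp add: left_diff_distrib)
    thus "- Re (kern w t) \<le> 1"
      unfolding Re_kern minus_divide_left by (intro divide_le_eq_1[THEN iffD2]) (use D0 in force)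
  next
    assume ge: "cmod w \<ge> 1"
    have c1: "1 \<le> (cmod w)\<^sup>2" using ge by (simp add: abs_square_le_1 one_le_power)
    hence "C t * S t * (1 - (cmod w)\<^sup>2) \<le> 0" using cs by (intro mult_nonneg_nonpos) auto
    moreover have "(C t)\<^sup>2 * Re w \<le> 0" using w by (simp add: mult_nonneg_nonpos)
    moreover have "(S t)\<^sup>2 * (- Re w) \<le> (S t)\<^sup>2 * (cmod w)\<^sup>2"
    proof (intro mult_left_mono)
      have "cmod w * 1 \<le> cmod w * cmod w" using ge by (intro mult_left_mono) auto
      thus "- Re w \<le> (cmod w)\<^sup>2" using Rew by (simp add: power2_eq_square)
    qed simp
    ultimately have "C t * S t * (1 - (cmod w)\<^sup>2) + ((C t)\<^sup>2 - (S t)\<^sup>2) * Re w \<le> ?D"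
      using D(2) by (simp add: left_diff_distrib)
    hence "Re (kern w t) \<le> 1"
      unfolding Re_kern by (intro divide_le_eq_1[THEN iffD2]) (use D0 in force)
    thus "- Re (kern w t) \<ge> - 1" by simp }
qed

lemma Re_V_left_half_plane:
  assumes z: "0 < Im z" "Im z < pi" "Re (exp z) \<le> 0"
  shows "Re z \<le> 0 \<Longrightarrow> - Re (V (exp z)) \<le> measure \<nu> (space \<nu>)"
    and "Re z \<ge> 0 \<Longrightarrow> - Re (V (exp z)) \<ge> - measure \<nu> (space \<nu>)"
proof -
  have s: "sin (Im z) \<noteq> 0" using sin_gt_zero[OF z(1,2)] by simp
  note int = integrable_kern[OF s]
  have V: "- Re (V (exp z)) = (LINT t|\<nu>. - Re (kern (exp z) t))"
    unfolding V_def using int by (simp add: integral_Re)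
  { assume "Re z \<le> 0"
    hence "cmod (exp z) \<le> 1" by simp
    hence "(LINT t|\<nu>. - Re (kern (exp z) t)) \<le> (LINT t|\<nu>. 1)"
      using C_S_nonneg int Re_kern_left_half_plane(1)[OF _ z(3)]
      by (intro integral_mono_AE) (auto elim!: eventually_mono)
    thus "- Re (V (exp z)) \<le> measure \<nu> (space \<nu>)" unfolding V by simp
  next
    assume "Re z \<ge> 0"
    hence "cmod (exp z) \<ge> 1" by simp
    hence "(LINT t|\<nu>. - 1) \<le> (LINT t|\<nu>. - Re (kern (exp z) t))"
      using C_S_nonneg int Re_kern_left_half_plane(2)[OF _ z(3)]
      by (intro integral_mono_AE) (auto elim!: eventually_mono)
    thus "- Re (V (exp z)) \<ge> - measure \<nu> (space \<nu>)" unfolding V by simp }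
qed

text \<open>Close to the positive half-line the kernel is unbounded, but the constraint on Im V
  keeps the integral of |h|^2 below \<theta> / sin \<theta> \<le> 4. Raising the point to height
  \<pi>/2 removes the term -2 C S cos, so it can only increase the denominators; the prefactor of
  the vertical difference is at most 2, whence 8 = 2 times 4.\<close>

lemma V_compare_imaginary_axis:
  assumes z: "0 < Im z" "Im z \<le> pi / 2" and le: "Im (V (exp z)) \<le> Im z"
  shows "\<bar>Re (V (exp z)) - Re (V (exp (Complex (Re z) (pi / 2))))\<bar> \<le> 8"
proof -
  define y where "y = Complex (Re z) (pi / 2)"
  have zp: "Im z < pi" using z pi_gt_zero by linarith
  have s: "sin (Im z) > 0" using z zp by (intro sin_gt_zero)
  have sy: "sin (Im y) \<noteq> 0" by (simp add: y_def)
  have cos: "cos (Im z) \<ge> 0" using z by (intro cos_ge_zero) auto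
  have hle: "cmod (h z t * h y t) \<le> (cmod (h z t))\<^sup>2" if cs: "C t * S t \<ge> 0" for t
  proof -
    have "(cmod (hden (C t) (S t) z))\<^sup>2 \<le> (cmod (hden (C t) (S t) y))\<^sup>2"
      unfolding cmod_hden_sq using mult_nonneg_nonneg[OF cs cos] by (simp add: y_def mult.assoc)
    hence "cmod (hden (C t) (S t) z) \<le> cmod (hden (C t) (S t) y)"
      by (rule power2_le_imp_le) simp
    moreover have "cmod (hden (C t) (S t) z) > 0"
      using hden_nonzero[OF C_S_unit, of z t] s by simp
    ultimately have "cmod (h y t) \<le> cmod (h z t)"
      unfolding h_def norm_divide by (intro frac_le) auto
    thus ?thesis unfolding norm_mult power2_eq_square by (intro mult_left_mono) auto
  qed
  have "cmod (LINT t|\<nu>. h z t * h y t) \<le> (LINT t|\<nu>. cmod (h z t * h y t))"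
    by (rule integral_norm_bound)
  also have "\<dots> \<le> (LINT t|\<nu>. (cmod (h z t))\<^sup>2)"
  proof (rule integral_mono_AE)
    show "integrable \<nu> (\<lambda>t. cmod (h z t * h y t))"
      using integrable_h_mult[of z y] s sy by simp
    show "integrable \<nu> (\<lambda>t. (cmod (h z t))\<^sup>2)" using integrable_h_power[of z] s by simp
    show "AE t in \<nu>. cmod (h z t * h y t) \<le> (cmod (h z t))\<^sup>2"
      using C_S_nonneg by eventually_elim (rule hle)
  qed
  also have "\<dots> \<le> 4"
    using integral_h_sq_le[OF z(1) zp le] div_sin_le_4[OF z] by linarith
  finally have J: "cmod (LINT t|\<nu>. h z t * h y t) \<le> 4" .
  have "cmod (exp ((z - y) / 2) - exp (- (z - y) / 2)) \<le> cmod (exp ((z - y) / 2)) + cmod (exp (- (z - y) / 2))"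
    by (rule norm_triangle_ineq4)
  also have "\<dots> = 2" by (simp add: y_def)
  finally have e: "cmod (exp ((z - y) / 2) - exp (- (z - y) / 2)) \<le> 2" .
  have "cmod (V (exp z) - V (exp y)) \<le> 2 * 4"
    unfolding V_diff[OF less_imp_neq[OF s, symmetric] sy] norm_mult by (rule mult_mono[OF e J]) auto
  thus ?thesis
    using abs_Re_le_cmod[of "V (exp z) - V (exp y)"] by (simp add: y_def)
qed

text \<open>Only one-sided bounds are available, each on the side where it is wanted: in
  \<open>Re_v_bound\<close> they prevent Re z - Re V from staying bounded while Re z escapes to
  either infinity.\<close>

lemma Re_V_bounds:
  assumes z: "0 < Im z" "Im z < pi" and le: "Im (V (exp z)) \<le> Im z"
  shows "Re z \<le> 0 \<Longrightarrow> - Re (V (exp z)) \<le> measure \<nu> (space \<nu>) + 8"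
    and "Re z \<ge> 0 \<Longrightarrow> - Re (V (exp z)) \<ge> - (measure \<nu> (space \<nu>) + 8)"
proof -
  show "- Re (V (exp z)) \<le> measure \<nu> (space \<nu>) + 8" if "Re z \<le> 0"
  proof (cases "Im z \<le> pi / 2")
    case True
    show ?thesis
      using V_compare_imaginary_axis[OF z(1) True le] that
        Re_V_left_half_plane(1)[of "Complex (Re z) (pi / 2)"] by (simp add: Re_exp)
  next
    case False
    hence "cos (Im z) \<le> 0" using z cos_monotone_0_pi_le[of "pi / 2" "Im z"] by simp
    thus ?thesis using Re_V_left_half_plane(1)[OF z] that by (simp add: Re_exp mult_le_0_iff)
  qed
  show "- Re (V (exp z)) \<ge> - (measure \<nu> (space \<nu>) + 8)" if "Re z \<ge> 0"
  proof (cases "Im z \<le> pi / 2")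
    case True
    show ?thesis
      using V_compare_imaginary_axis[OF z(1) True le] that
        Re_V_left_half_plane(2)[of "Complex (Re z) (pi / 2)"] by (simp add: Re_exp)
  next
    case False
    hence "cos (Im z) \<le> 0" using z cos_monotone_0_pi_le[of "pi / 2" "Im z"] by simp
    thus ?thesis using Re_V_left_half_plane(2)[OF z] that by (simp add: Re_exp mult_le_0_iff)
  qed
qed

end

section \<open>The Herglotz representation\<close>

lemma circle_Cauchy_has_integral:
  assumes "continuous_on (cball 0 1) g" "g holomorphic_on ball 0 1" "cmod w < 1"
  shows "((\<lambda>t. g (cis (2 * pi * t)) * (cis (2 * pi * t) / (cis (2 * pi * t) - w))) has_integral g w) {0..1}"
proof -
  define K where "K = 2 * of_real pi * \<i>"
  have K: "K \<noteq> 0" by (simp add: K_def)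
  have c: "circlepath 0 1 t = cis (2 * pi * t)" for t
    by (simp add: circlepath cis_conv_exp mult_ac)
  have "((\<lambda>u. g u / (u - w)) has_contour_integral (2 * of_real pi * \<i> * g w)) (circlepath 0 1)"
    by (rule Cauchy_integral_circlepath) (use assms in auto)
  hence H: "((\<lambda>t. g (circlepath 0 1 t) / (circlepath 0 1 t - w) * vector_derivative (circlepath 0 1) (at t within {0..1}))
      has_integral (2 * of_real pi * \<i> * g w)) {0..1}"
    by (simp add: has_contour_integral_def)
  have vd: "vector_derivative (circlepath 0 1) (at t within {0..1}) = K * cis (2 * pi * t)"
    if "t \<in> {0..1}" for t
    using that vector_derivative_circlepath01[of t 0 1] by (simp add: cis_conv_exp mult_ac K_def)
  have "((\<lambda>t. g (cis (2 * pi * t)) / (cis (2 * pi * t) - w) * (K * cis (2 * pi * t)))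
      has_integral (K * g w)) {0..1}"
    by (rule has_integral_eq[OF _ H[folded K_def]]) (simp only: c vd)
  from has_integral_mult_right[OF this, of "1 / K"]
  have "((\<lambda>t. 1 / K * (g (cis (2 * pi * t)) / (cis (2 * pi * t) - w) * (K * cis (2 * pi * t))))
      has_integral (1 / K * (K * g w))) {0..1}" .
  moreover have "1 / K * (a / b * (K * c)) = a * (c / b)" "1 / K * (K * a) = a" for a b c
    using K by simp_all
  ultimately show ?thesis by simp
qed

lemma circle_mean_value:
  assumes "continuous_on (cball 0 1) g" "g holomorphic_on ball 0 1"
  shows "((\<lambda>t. g (cis (2 * pi * t))) has_integral g 0) {0..1}"
  using circle_Cauchy_has_integral[OF assms, of 0] by simp

text \<open>Twice Cauchy's formula minus the mean value gives the kernel integrated against g, with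
  value 2 g w - g 0. The same integral against the conjugate of g is the conjugate of a mean value,
  equal to cnj (g 0). Half the sum retains the real part of g only.\<close>

lemma schwarz_formula:
  assumes cont: "continuous_on (cball 0 1) g" and hol: "g holomorphic_on ball 0 1" and w: "cmod w < 1"
  shows "((\<lambda>t. of_real (Re (g (cis (2 * pi * t)))) * ((cis (2 * pi * t) + w) / (cis (2 * pi * t) - w)))
      has_integral (g w - \<i> * of_real (Im (g 0)))) {0..1}"
proof -
  let ?e = "\<lambda>t. cis (2 * pi * t)"
  have ne: "?e t \<noteq> w" for t
    using w norm_cis[of "2 * pi * t"] by auto
  have "((\<lambda>t. 2 * (g (?e t) * (?e t / (?e t - w))) - g (?e t)) has_integral (2 * g w - g 0)) {0..1}"
    by (intro has_integral_diff has_integral_mult_right circle_Cauchy_has_integral circle_mean_value assms)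
  hence 1: "((\<lambda>t. g (?e t) * ((?e t + w) / (?e t - w))) has_integral (2 * g w - g 0)) {0..1}"
    by (rule has_integral_eq[rotated]) (use ne in \<open>simp add: field_simps\<close>)
  have nz: "1 - cnj w * u \<noteq> 0" if "cmod u \<le> 1" for u
  proof
    assume "1 - cnj w * u = 0"
    hence "cmod (cnj w * u) = 1" by simp
    hence "cmod w * cmod u = 1" by (simp add: norm_mult)
    moreover have "cmod w * cmod u \<le> cmod w * 1" by (rule mult_left_mono[OF that]) simp
    ultimately show False using w by simp
  qed
  \<comment> \<open>On the unit circle the conjugate of u is 1/u, so the conjugate of the second
    factor is the Schwarz kernel; inside the disc that factor is holomorphic and equals 1 at the
    origin.\<close>
  let ?G = "\<lambda>u. g u * ((1 + cnj w * u) / (1 - cnj w * u))"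
  have "((\<lambda>t. ?G (?e t)) has_integral ?G 0) {0..1}"
  proof (rule circle_mean_value)
    show "continuous_on (cball 0 1) ?G"
      using nz by (intro continuous_intros cont) auto
    show "?G holomorphic_on ball 0 1"
      using nz by (intro holomorphic_intros hol) auto
  qed
  hence "((\<lambda>t. cnj (?G (?e t))) has_integral cnj (?G 0)) {0..1}"
    by (rule has_integral_linear[OF _ bounded_linear_cnj, unfolded o_def])
  moreover have "cnj (?G (?e t)) = cnj (g (?e t)) * ((?e t + w) / (?e t - w))" for t
  proof -
    define v where "v = cnj (?e t)"
    have ev: "?e t * v = 1"
      unfolding v_def by (simp add: cis_cnj cis_mult)
    have "(1 + w * v) / (1 - w * v) = (?e t * (1 + w * v)) / (?e t * (1 - w * v))"
      by (rule mult_divide_mult_cancel_left[symmetric]) simp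
    also have "?e t * (1 + w * v) = ?e t + w"
      using ev by (simp add: algebra_simps)
    also have "?e t * (1 - w * v) = ?e t - w"
      using ev by (simp add: algebra_simps)
    finally have q: "(1 + w * v) / (1 - w * v) = (?e t + w) / (?e t - w)" .
    have "cnj (?G (?e t)) = cnj (g (?e t)) * ((1 + w * v) / (1 - w * v))"
      by (simp only: v_def complex_cnj_mult complex_cnj_divide complex_cnj_add complex_cnj_diff
          complex_cnj_one complex_cnj_cnj)
    thus ?thesis by (simp only: q)
  qed
  moreover have "cnj (?G 0) = cnj (g 0)" by simp
  ultimately have 2: "((\<lambda>t. cnj (g (?e t)) * ((?e t + w) / (?e t - w))) has_integral cnj (g 0)) {0..1}"
    by simp
  have sum: "((\<lambda>t. (g (?e t) * ((?e t + w) / (?e t - w)) + cnj (g (?e t)) * ((?e t + w) / (?e t - w))) / 2)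
      has_integral ((2 * g w - g 0) + cnj (g 0)) / 2) {0..1}"
    by (intro has_integral_divide has_integral_add 1 2)
  have val: "((2 * g w - g 0) + cnj (g 0)) / 2 = g w - \<i> * of_real (Im (g 0))"
    by (simp add: complex_eq_iff)
  have half: "(a * v + cnj a * v) / 2 = of_real (Re a) * v" for a v
  proof -
    have "a * v + cnj a * v = (a + cnj a) * v" by (simp add: distrib_right)
    thus ?thesis by (simp add: complex_add_cnj)
  qed
  from sum show ?thesis by (simp only: val half)
qed

lemma lborel_integral_interval:
  fixes f :: "real \<Rightarrow> 'a :: euclidean_space"
  assumes "continuous_on {a..b} f"
  shows "(LINT t|lborel. indicator {a..b} t *\<^sub>R f t) = integral {a..b} f"
    and "integrable lborel (\<lambda>t. indicator {a..b} t *\<^sub>R f t)"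
  using set_borel_integral_eq_integral(2)[OF borel_integrable_atLeastAtMost'[OF assms]]
    borel_integrable_atLeastAtMost'[OF assms]
  by (simp_all add: set_lebesgue_integral_def set_integrable_def)

text \<open>The real part of f on a circle of radius below 1, divided by Re (f 0), is a probability
  density by the mean value property. These laws live on one compact interval, so Helly selection
  gives a weak limit along a subsequence of radii.\<close>

lemma boundary_measure:
  assumes hol: "f holomorphic_on ball 0 1" and pos: "\<And>z. cmod z < 1 \<Longrightarrow> Re (f z) > 0"
  obtains M r where "real_distribution M" "\<And>n. 1 / 2 \<le> r n \<and> r n < 1" "r \<longlonglongrightarrow> 1"
    "\<And>g B. (\<And>t. isCont g t) \<Longrightarrow> (\<And>t. cmod (g t) \<le> B) \<Longrightarrow>
       (\<lambda>n. integral {0..1} (\<lambda>t. of_real (Re (f (of_real (r n) * cis (2 * pi * t)))) * g t))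
         \<longlonglongrightarrow> of_real (Re (f 0)) * (LINT t|M. g t)"
proof -
  define R where "R n = 1 - 1 / (real n + 2)" for n
  have R: "1 / 2 \<le> R n \<and> R n < 1" for n by (simp add: R_def field_simps)
  have Rlim: "R \<longlonglongrightarrow> 1" unfolding R_def by real_asymp
  define F where "F n u = f (of_real (R n) * u)" for n u
  have Rcb: "cmod (of_real (R n) * u) < 1" if "cmod u \<le> 1" for n u
  proof -
    have "\<bar>R n\<bar> * cmod u \<le> \<bar>R n\<bar> * 1" using that by (intro mult_left_mono) auto
    also have "\<dots> < 1" using R[of n] by simp
    finally show ?thesis by (simp add: norm_mult)
  qed
  have Fhol: "F n holomorphic_on cball 0 1" for n
  proof -
    have "f \<circ> (\<lambda>u. of_real (R n) * u) holomorphic_on cball 0 1"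
      by (rule holomorphic_on_compose_gen[OF _ hol]) (use Rcb in \<open>auto intro!: holomorphic_intros\<close>)
    thus ?thesis by (simp add: F_def[abs_def] o_def)
  qed
  have Fcont: "continuous_on (cball 0 1) (F n)" for n
    by (rule holomorphic_on_imp_continuous_on[OF Fhol])
  have Fb: "F n holomorphic_on ball 0 1" for n
    by (rule holomorphic_on_subset[OF Fhol]) auto
  have Fpos: "Re (F n u) > 0" if "cmod u \<le> 1" for n u
    unfolding F_def by (intro pos Rcb that)
  have F0: "F n 0 = f 0" for n by (simp add: F_def)
  define k where "k = Re (f 0)"
  have k: "k > 0" unfolding k_def by (rule pos) simp
  define p where "p n t = Re (F n (cis (2 * pi * t))) / k" for n t
  have pcont: "continuous_on A (p n)" for n A
    unfolding p_def using k
    by (intro continuous_intros continuous_on_compose2[OF Fcont]) auto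
  have pnn: "p n t \<ge> 0" for n t
    unfolding p_def using Fpos[of "cis (2 * pi * t)" n] k by simp
  have pint: "(p n has_integral 1) {0..1}" for n
  proof -
    have "((\<lambda>t. Re (F n (cis (2 * pi * t)))) has_integral Re (F n 0)) {0..1}"
      by (rule has_integral_linear[OF circle_mean_value[OF Fcont Fb] bounded_linear_Re, unfolded o_def])
    from has_integral_divide[OF this, of k] show ?thesis
      using k by (simp add: p_def[abs_def] F0 k_def)
  qed
  define \<mu> where "\<mu> n = density lborel (\<lambda>t. ennreal (indicator {0..1} t * p n t))" for n
  have pmeas [measurable]: "p n \<in> borel_measurable borel" for n
    by (rule borel_measurable_continuous_onI[OF pcont])
  have \<mu>_int: "(LINT t|\<mu> n. g t) = integral {0..1} (\<lambda>t. of_real (p n t) * g t)"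
    if g: "\<And>t. isCont g t" for g :: "real \<Rightarrow> complex" and n
  proof -
    have gc: "continuous_on A g" for A
      using g by (simp add: continuous_at_imp_continuous_on)
    have [measurable]: "g \<in> borel_measurable borel"
      by (rule borel_measurable_continuous_onI[OF gc])
    have "(LINT t|\<mu> n. g t) = (LINT t|lborel. (indicator {0..1} t * p n t) *\<^sub>R g t)"
      unfolding \<mu>_def by (rule integral_density) (use pnn in \<open>auto split: split_indicator\<close>)
    also have "\<dots> = (LINT t|lborel. indicator {0..1} t *\<^sub>R (of_real (p n t) * g t))"
      by (simp add: scaleR_conv_of_real mult_ac)
    also have "\<dots> = integral {0..1} (\<lambda>t. of_real (p n t) * g t)"
      by (intro lborel_integral_interval continuous_intros pcont gc)
    finally show ?thesis .
  qed
  have rd: "real_distribution (\<mu> n)" for n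
  proof -
    have "emeasure (\<mu> n) (space (\<mu> n)) = (\<integral>\<^sup>+t. ennreal (indicator {0..1} t * p n t) \<partial>lborel)"
      unfolding \<mu>_def by (subst emeasure_density) auto
    also have "\<dots> = ennreal (LINT t|lborel. indicator {0..1} t * p n t)"
      using lborel_integral_interval(2)[OF pcont[of "{0..1}" n]] pnn
      by (intro nn_integral_eq_integral) (auto split: split_indicator)
    also have "(LINT t|lborel. indicator {0..1} t * p n t) = 1"
      using lborel_integral_interval(1)[OF pcont[of "{0..1}" n]] integral_unique[OF pint] by simp
    finally have "prob_space (\<mu> n)" by (intro prob_spaceI) simp
    thus ?thesis
      by (intro real_distribution.intro real_distribution_axioms.intro) (simp_all add: \<mu>_def)
  qed
  have "tight \<mu>"
    unfolding tight_def
  proof (intro conjI allI impI rd)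
    fix \<epsilon> :: real assume "\<epsilon> > 0"
    have "measure (\<mu> n) {-1<..2} = 1" for n
    proof -
      interpret real_distribution "\<mu> n" by (rule rd)
      have "emeasure (\<mu> n) (- {-1<..2}) = (\<integral>\<^sup>+t. ennreal (indicator {0..1} t * p n t) * indicator (- {-1<..2}) t \<partial>lborel)"
        unfolding \<mu>_def by (rule emeasure_density) auto
      also have "\<dots> = (\<integral>\<^sup>+t. 0 \<partial>(lborel :: real measure))"
        by (intro nn_integral_cong) (auto split: split_indicator)
      finally have "measure (\<mu> n) (- {-1<..2}) = 0" by (simp add: measure_def)
      thus ?thesis using prob_compl[of "{-1<..2}"] by (simp add: Compl_eq_Diff_UNIV)
    qed
    thus "\<exists>a b. a < b \<and> (\<forall>n. 1 - \<epsilon> < measure (\<mu> n) {a<..b})"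
      using \<open>\<epsilon> > 0\<close> by (intro exI[of _ "-1"] exI[of _ 2]) auto
  qed
  from tight_imp_convergent_subsubsequence[OF this, of id]
  obtain s M where s: "strict_mono s" and M: "real_distribution M" and wc: "weak_conv_m (\<mu> \<circ> s) M"
    by (auto simp: strict_mono_def)
  show ?thesis
  proof (rule that[OF M, of "R \<circ> s"])
    show "1 / 2 \<le> (R \<circ> s) n \<and> (R \<circ> s) n < 1" for n using R by simp
    show "(R \<circ> s) \<longlonglongrightarrow> 1"
      by (rule LIMSEQ_subseq_LIMSEQ[OF Rlim s])
    fix g :: "real \<Rightarrow> complex" and B
    assume g: "\<And>t. isCont g t" "\<And>t. cmod (g t) \<le> B"
    have "(\<lambda>n. LINT t|(\<mu> \<circ> s) n. g t) \<longlonglongrightarrow> (LINT t|M. g t)"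
      by (rule weak_conv_imp_integral_bdd_continuous_conv[OF _ M wc g]) (use rd in simp)
    from tendsto_mult_left[OF this, of "of_real k"]
    have "(\<lambda>n. of_real k * integral {0..1} (\<lambda>t. of_real (p (s n) t) * g t)) \<longlonglongrightarrow> of_real k * (LINT t|M. g t)"
      by (simp add: \<mu>_int[OF g(1)])
    also have "(\<lambda>n. of_real k * integral {0..1} (\<lambda>t. of_real (p (s n) t) * g t)) =
      (\<lambda>n. integral {0..1} (\<lambda>t. of_real (Re (f (of_real ((R \<circ> s) n) * cis (2 * pi * t)))) * g t))"
    proof
      fix n
      have "of_real k * (of_real (p (s n) t) * g t) =
          of_real (Re (f (of_real ((R \<circ> s) n) * cis (2 * pi * t)))) * g t" for t
        using k by (simp add: p_def F_def)
      thus "of_real k * integral {0..1} (\<lambda>t. of_real (p (s n) t) * g t) =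
          integral {0..1} (\<lambda>t. of_real (Re (f (of_real ((R \<circ> s) n) * cis (2 * pi * t)))) * g t)"
        by (simp only: integral_mult_right[symmetric])
    qed
    finally show "(\<lambda>n. integral {0..1} (\<lambda>t. of_real (Re (f (of_real ((R \<circ> s) n) * cis (2 * pi * t)))) * g t))
         \<longlonglongrightarrow> of_real (Re (f 0)) * (LINT t|M. g t)"
      unfolding k_def .
  qed
qed

section \<open>The Cayley transform between disc and half-plane\<close>

lemma Im_cayley:
  assumes "u \<noteq> 1"
  shows "Im (\<i> * (1 + u) / (1 - u)) = (1 - (cmod u)\<^sup>2) / (cmod (1 - u))\<^sup>2"
proof -
  have "\<i> * (1 + u) / (1 - u) = \<i> * (1 + u) * cnj (1 - u) / of_real ((cmod (1 - u))\<^sup>2)"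
    by (simp add: complex_div_cnj[of _ "1 - u"])
  also have "Im \<dots> = Im (\<i> * (1 + u) * cnj (1 - u)) / (cmod (1 - u))\<^sup>2"
    by (rule Im_divide_of_real)
  also have "Im (\<i> * (1 + u) * cnj (1 - u)) = 1 - (cmod u)\<^sup>2"
    unfolding cmod_power2 by (simp add: algebra_simps power2_eq_square)
  finally show ?thesis .
qed

lemma cis_double_eqs:
  "cis (2 * a) + 1 = 2 * of_real (cos a) * cis a"
  "cis (2 * a) - 1 = 2 * \<i> * of_real (sin a) * cis a"
proof -
  have 1: "cis (2 * a) = cis a * cis a" "cis (- a) * cis a = 1"
    by (simp_all add: cis_mult)
  have 2: "cis a + cis (- a) = 2 * of_real (cos a)" "cis a - cis (- a) = 2 * \<i> * of_real (sin a)"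
    by (simp_all add: complex_eq_iff)
  show "cis (2 * a) + 1 = 2 * of_real (cos a) * cis a"
    "cis (2 * a) - 1 = 2 * \<i> * of_real (sin a) * cis a"
    unfolding 2[symmetric] 1(1) using 1(2) by (simp_all add: distrib_right left_diff_distrib)
qed

lemma cayley_cis:
  assumes "sin a \<noteq> 0"
  shows "\<i> * (1 + cis (2 * a)) / (1 - cis (2 * a)) = of_real (- cos a / sin a)"
proof -
  have 1: "1 + cis (2 * a) = 2 * of_real (cos a) * cis a"
    using cis_double_eqs(1)[of a] by (simp add: add.commute)
  have 2: "1 - cis (2 * a) = - (2 * \<i> * of_real (sin a) * cis a)"
    using cis_double_eqs(2)[of a] by (metis minus_diff_eq)
  show ?thesis unfolding 1 2 using assms by simp
qed

text \<open>The Schwarz kernel of the disc carried to the half-plane. The circle point with angle 2a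
  corresponds to the boundary point -cot a, which is the pole C/S for C = -cos a and S = sin
  a.\<close>

lemma cayley_kernel:
  assumes "Im w > 0"
  defines "u \<equiv> (w - \<i>) / (w + \<i>)"
  shows "\<i> * ((cis (2 * a) + u) / (cis (2 * a) - u)) =
    (of_real (sin a) + of_real (- cos a) * w) / (of_real (- cos a) - of_real (sin a) * w)"
proof -
  let ?c = "complex_of_real (cos a)" and ?s = "complex_of_real (sin a)"
  have wi: "w + \<i> \<noteq> 0" using assms by (auto simp: complex_eq_iff)
  have ux: "(w + \<i>) * u = w - \<i>" using wi by (simp add: u_def)
  have d: "?c + ?s * w \<noteq> 0"
  proof
    assume "?c + ?s * w = 0"
    hence "Im (?c + ?s * w) = 0" "Re (?c + ?s * w) = 0" by simp_all
    hence "sin a = 0" "cos a = 0" using assms by auto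
    thus False using sin_cos_squared_add[of a] by simp
  qed
  have n: "cis (2 * a) * (w + \<i>) + (w - \<i>) = 2 * cis a * (w * ?c - ?s)"
  proof -
    have "cis (2 * a) * (w + \<i>) + (w - \<i>) = w * (cis (2 * a) + 1) + \<i> * (cis (2 * a) - 1)"
      by (simp add: algebra_simps)
    also have "\<dots> = 2 * cis a * (w * ?c - ?s)"
      unfolding cis_double_eqs by (simp add: algebra_simps)
    finally show ?thesis .
  qed
  have m: "cis (2 * a) * (w + \<i>) - (w - \<i>) = 2 * \<i> * cis a * (?c + ?s * w)"
  proof -
    have "cis (2 * a) * (w + \<i>) - (w - \<i>) = w * (cis (2 * a) - 1) + \<i> * (cis (2 * a) + 1)"
      by (simp add: algebra_simps)
    also have "\<dots> = 2 * \<i> * cis a * (?c + ?s * w)"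
      unfolding cis_double_eqs by (simp add: algebra_simps)
    finally show ?thesis .
  qed
  have "(cis (2 * a) + u) / (cis (2 * a) - u) = ((w + \<i>) * (cis (2 * a) + u)) / ((w + \<i>) * (cis (2 * a) - u))"
    using wi by (intro mult_divide_mult_cancel_left[symmetric])
  also have "(w + \<i>) * (cis (2 * a) + u) = cis (2 * a) * (w + \<i>) + (w - \<i>)"
    using ux by (simp add: distrib_left mult.commute)
  also have "(w + \<i>) * (cis (2 * a) - u) = cis (2 * a) * (w + \<i>) - (w - \<i>)"
    using ux by (simp add: right_diff_distrib mult.commute)
  finally have "\<i> * ((cis (2 * a) + u) / (cis (2 * a) - u)) =
      \<i> * (2 * cis a * (w * ?c - ?s)) / (2 * \<i> * cis a * (?c + ?s * w))"
    unfolding n m by simp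
  also have "\<dots> = (w * ?c - ?s) / (?c + ?s * w)"
    using d by (simp add: divide_simps)
  also have "\<dots> = (- (w * ?c - ?s)) / (- (?c + ?s * w))" by (simp only: minus_divide_divide)
  also have "- (w * ?c - ?s) = ?s + of_real (- cos a) * w" by simp
  also have "- (?c + ?s * w) = of_real (- cos a) - ?s * w" by simp
  finally show ?thesis .
qed

text \<open>Multiplication by -i and the Cayley transform turn N into a function of positive real
  part on the disc. Holomorphy and real values on the negative half-line show that the boundary
  measure has no mass on the arc mapped there, and this is the sign condition on C S.\<close>

lemma herglotz_half_plane:
  assumes hol: "N holomorphic_on - \<real>\<^sub>\<ge>\<^sub>0"
    and pos: "\<And>w. Im w > 0 \<Longrightarrow> Im (N w) > 0"
    and real: "\<And>x. x < 0 \<Longrightarrow> Im (N (of_real x)) = 0"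
  obtains \<nu> C S where "herglotz_kernel \<nu> C S"
    "\<And>w. Im w > 0 \<Longrightarrow> N w = of_real (Re (N \<i>)) + herglotz_kernel.V \<nu> C S w"
proof -
  define cay :: "complex \<Rightarrow> complex" where "cay u = \<i> * (1 + u) / (1 - u)" for u
  define f where "f u = - \<i> * N (cay u)" for u
  have cay_pos: "Im (cay u) > 0" if "cmod u < 1" for u
  proof -
    have "u \<noteq> 1" using that by auto
    moreover have "(cmod u)\<^sup>2 < 1" using that by (simp add: abs_square_less_1)
    ultimately show ?thesis unfolding cay_def by (subst Im_cayley) auto
  qed
  have fhol: "f holomorphic_on {u. u \<noteq> 1 \<and> cay u \<notin> \<real>\<^sub>\<ge>\<^sub>0}"
  proof -
    have "N \<circ> cay holomorphic_on {u. u \<noteq> 1 \<and> cay u \<notin> \<real>\<^sub>\<ge>\<^sub>0}"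
    proof (rule holomorphic_on_compose_gen[OF _ hol])
      have "(\<lambda>u. \<i> * (1 + u) / (1 - u)) holomorphic_on A" if "1 \<notin> A" for A
        using that by (intro holomorphic_intros) auto
      thus "cay holomorphic_on {u. u \<noteq> 1 \<and> cay u \<notin> \<real>\<^sub>\<ge>\<^sub>0}"
        by (simp add: cay_def[abs_def])
    qed auto
    thus ?thesis unfolding f_def[abs_def] o_def by (intro holomorphic_intros)
  qed
  have fhol1: "f holomorphic_on ball 0 1"
    by (rule holomorphic_on_subset[OF fhol])
       (use cay_pos in \<open>force simp: complex_nonneg_Reals_iff\<close>)
  have fpos: "Re (f u) > 0" if "cmod u < 1" for u
    using pos[OF cay_pos[OF that]] by (simp add: f_def)
  obtain M r where M: "real_distribution M" and r: "\<And>n. 1 / 2 \<le> r n \<and> r n < 1" "r \<longlonglongrightarrow> 1"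
    and lim: "\<And>g B. (\<And>t. isCont g t) \<Longrightarrow> (\<And>t. cmod (g t) \<le> B) \<Longrightarrow>
       (\<lambda>n. integral {0..1} (\<lambda>t. of_real (Re (f (of_real (r n) * cis (2 * pi * t)))) * g t))
         \<longlonglongrightarrow> of_real (Re (f 0)) * (LINT t|M. g t)"
    by (rule boundary_measure[OF fhol1 fpos]) auto
  interpret M: real_distribution M by (rule M)
  define k where "k = Re (f 0)"
  have k: "k > 0" unfolding k_def by (rule fpos) simp
  have rep: "f u = \<i> * of_real (Im (f 0)) +
      of_real k * (LINT t|M. (cis (2 * pi * t) + u) / (cis (2 * pi * t) - u))" if u: "cmod u < 1" for u
  proof -
    let ?g = "\<lambda>t. (cis (2 * pi * t) + u) / (cis (2 * pi * t) - u)"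
    have ne: "cis (2 * pi * t) - u \<noteq> 0" for t
      using u norm_cis[of "2 * pi * t"] by auto
    have b: "cmod (?g t) \<le> 2 / (1 - cmod u)" for t
      unfolding norm_divide
    proof (rule frac_le)
      show "cmod (cis (2 * pi * t) + u) \<le> 2"
        using norm_triangle_ineq[of "cis (2 * pi * t)" u] u by simp
      show "1 - cmod u \<le> cmod (cis (2 * pi * t) - u)"
        using norm_triangle_ineq2[of "cis (2 * pi * t)" u] by simp
    qed (use u in auto)
    have c: "isCont ?g t" for t
    proof -
      have "continuous_on UNIV ?g" using ne by (intro continuous_intros) auto
      thus ?thesis by (simp add: continuous_on_eq_continuous_at)
    qed
    have "integral {0..1} (\<lambda>t. of_real (Re (f (of_real (r n) * cis (2 * pi * t)))) * ?g t) =
        f (of_real (r n) * u) - \<i> * of_real (Im (f 0))" for n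
    proof -
      have h: "(\<lambda>x. f (of_real (r n) * x)) holomorphic_on cball 0 1"
      proof -
        have "cmod (of_real (r n) * x) < 1" if "cmod x \<le> 1" for x
        proof -
          have "\<bar>r n\<bar> * cmod x \<le> \<bar>r n\<bar> * 1" using that by (intro mult_left_mono) auto
          also have "\<dots> < 1" using r(1)[of n] by simp
          finally show ?thesis by (simp add: norm_mult)
        qed
        hence "f \<circ> (\<lambda>x. of_real (r n) * x) holomorphic_on cball 0 1"
          by (intro holomorphic_on_compose_gen[OF _ fhol1]) (auto intro!: holomorphic_intros)
        thus ?thesis by (simp add: o_def)
      qed
      have "((\<lambda>t. of_real (Re (f (of_real (r n) * cis (2 * pi * t)))) * ?g t) has_integral
          f (of_real (r n) * u) - \<i> * of_real (Im (f (of_real (r n) * 0)))) {0..1}"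
        by (rule schwarz_formula[OF holomorphic_on_imp_continuous_on[OF h] holomorphic_on_subset[OF h] u]) auto
      thus ?thesis by (simp add: integral_unique)
    qed
    with lim[OF c b] have "(\<lambda>n. f (of_real (r n) * u) - \<i> * of_real (Im (f 0))) \<longlonglongrightarrow> of_real k * (LINT t|M. ?g t)"
      by (simp add: k_def)
    moreover have "(\<lambda>n. f (of_real (r n) * u) - \<i> * of_real (Im (f 0))) \<longlonglongrightarrow> f (1 * u) - \<i> * of_real (Im (f 0))"
    proof (intro tendsto_intros)
      have "isCont f (1 * u)"
        using holomorphic_on_imp_continuous_on[OF fhol1] u by (simp add: continuous_on_eq_continuous_at)
      moreover have "(\<lambda>n. of_real (r n) * u) \<longlonglongrightarrow> of_real 1 * u"
        by (intro tendsto_intros r(2))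
      ultimately show "(\<lambda>n. f (of_real (r n) * u)) \<longlonglongrightarrow> f (1 * u)"
        by (auto intro: isCont_tendsto_compose)
    qed
    ultimately have "of_real k * (LINT t|M. ?g t) = f u - \<i> * of_real (Im (f 0))"
      using LIMSEQ_unique by fastforce
    thus ?thesis by simp
  qed
  \<comment> \<open>The arc corresponding to the negative half-line is sin (2 pi t) > 0. The test
    function cuts it off at height \<epsilon>: on the compact remainder f is continuous up to the
    circle with real part 0, so the approximating integrals tend to 0.\<close>
  have null: "AE t in M. sin (2 * pi * t) \<le> \<epsilon>" if e: "\<epsilon> > 0" for \<epsilon> :: real
  proof -
    define g where "g t = max 0 (sin (2 * pi * t) - \<epsilon>)" for t
    have gc: "continuous_on A g" for A unfolding g_def by (intro continuous_intros)
    have gb: "0 \<le> g t \<and> g t \<le> 1" for t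
      using sin_le_one[of "2 * pi * t"] e unfolding g_def by linarith
    define K where "K = {t \<in> {0..1}. \<epsilon> \<le> sin (2 * pi * t)}"
    have Kc: "compact K"
    proof -
      have "closed {t :: real. \<epsilon> \<le> sin (2 * pi * t)}"
        by (intro closed_Collect_le continuous_intros)
      hence "compact ({0..1} \<inter> {t :: real. \<epsilon> \<le> sin (2 * pi * t)})"
        by (intro compact_Int_closed) auto
      moreover have "K = {0..1} \<inter> {t :: real. \<epsilon> \<le> sin (2 * pi * t)}"
        by (auto simp: K_def)
      ultimately show ?thesis by simp
    qed
    \<comment> \<open>A compact sector that joins the arc to the inner circle. It stays in the
      domain of holomorphy, so f is bounded on it, and this bound dominates the integrands for all
      radii at once.\<close>
    define T where "T = (\<lambda>(s, t). of_real s * cis (2 * pi * t)) ` ({1/2..1} \<times> K)"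
    have boundary: "cis (2 * pi * t) \<noteq> 1" "cay (cis (2 * pi * t)) = of_real (- cos (pi * t) / sin (pi * t))"
       "- cos (pi * t) / sin (pi * t) < 0" if "t \<in> K" for t
    proof -
      have "2 * sin (pi * t) * cos (pi * t) = sin (2 * pi * t)"
        using sin_double[of "pi * t"] by (simp add: mult_ac)
      hence p: "sin (pi * t) * cos (pi * t) > 0" using that e by (simp add: K_def)
      hence s: "sin (pi * t) \<noteq> 0" by auto
      show "cay (cis (2 * pi * t)) = of_real (- cos (pi * t) / sin (pi * t))"
        using cayley_cis[OF s] unfolding cay_def by (simp add: mult.assoc)
      show "- cos (pi * t) / sin (pi * t) < 0"
        using p by (auto simp: zero_less_mult_iff divide_less_0_iff zero_less_divide_iff)
      show "cis (2 * pi * t) \<noteq> 1"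
        using that e by (auto simp: K_def complex_eq_iff)
    qed
    have Tsub: "T \<subseteq> {u. u \<noteq> 1 \<and> cay u \<notin> \<real>\<^sub>\<ge>\<^sub>0}"
    proof
      fix u assume "u \<in> T"
      then obtain s t where st: "1 / 2 \<le> s" "s \<le> 1" "t \<in> K" "u = of_real s * cis (2 * pi * t)"
        by (auto simp: T_def)
      show "u \<in> {u. u \<noteq> 1 \<and> cay u \<notin> \<real>\<^sub>\<ge>\<^sub>0}"
      proof (cases "s = 1")
        case True
        hence u: "u = cis (2 * pi * t)" using st by simp
        have "complex_of_real x \<notin> \<real>\<^sub>\<ge>\<^sub>0" if "x < 0" for x
          using that by (simp add: complex_nonneg_Reals_iff)
        from this[OF boundary(3)[OF st(3)]] show ?thesis
          unfolding mem_Collect_eq u boundary(2)[OF st(3)] using boundary(1)[OF st(3)] by blast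
      next
        case False
        hence "cmod u < 1" using st by (simp add: norm_mult)
        thus ?thesis using cay_pos[of u] by (auto simp: complex_nonneg_Reals_iff)
      qed
    qed
    have "compact T" unfolding T_def
      by (intro compact_continuous_image compact_Times Kc)
         (auto simp: case_prod_beta intro!: continuous_intros)
    hence "compact (f ` T)"
      by (intro compact_continuous_image continuous_on_subset[OF holomorphic_on_imp_continuous_on[OF fhol] Tsub])
    from compact_imp_bounded[OF this] obtain B where B: "\<And>u. u \<in> T \<Longrightarrow> cmod (f u) \<le> B"
      unfolding bounded_iff by blast
    let ?F = "\<lambda>n t. complex_of_real (Re (f (of_real (r n) * cis (2 * pi * t)))) * of_real (g t)"
    have fT: "isCont f u" if "u \<in> T \<or> cmod u < 1" for u
    proof -
      have "open {u. u \<noteq> 1 \<and> cay u \<notin> \<real>\<^sub>\<ge>\<^sub>0}"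
      proof -
        have "continuous_on (- {1}) cay"
          unfolding cay_def[abs_def] by (intro continuous_intros) auto
        moreover have "open (- \<real>\<^sub>\<ge>\<^sub>0 :: complex set)"
          using closed_nonneg_Reals_complex by (simp add: open_Compl)
        ultimately have "open (- {1} \<inter> cay -` (- \<real>\<^sub>\<ge>\<^sub>0))"
          by (intro continuous_open_preimage) auto
        moreover have "- {1} \<inter> cay -` (- \<real>\<^sub>\<ge>\<^sub>0) = {u. u \<noteq> 1 \<and> cay u \<notin> \<real>\<^sub>\<ge>\<^sub>0}"
          by auto
        ultimately show ?thesis by simp
      qed
      moreover have "u \<in> {u. u \<noteq> 1 \<and> cay u \<notin> \<real>\<^sub>\<ge>\<^sub>0}"
        using that Tsub cay_pos[of u] by (auto simp: complex_nonneg_Reals_iff)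
      ultimately show ?thesis
        using holomorphic_on_imp_continuous_on[OF fhol] by (simp add: continuous_on_eq_continuous_at)
    qed
    have "(\<lambda>n. integral {0..1} (?F n)) \<longlonglongrightarrow> integral {0..1} (\<lambda>t :: real. 0)"
    proof (rule dominated_convergence(2))
      show "?F n integrable_on {0..1}" for n
      proof (intro integrable_continuous_real continuous_intros gc)
        have "cmod (of_real (r n) * cis (2 * pi * t)) < 1" for t
          using r(1)[of n] by (simp add: norm_mult)
        thus "continuous_on {0..1} (\<lambda>t. f (of_real (r n) * cis (2 * pi * t)))"
          by (intro continuous_on_compose2[OF holomorphic_on_imp_continuous_on[OF fhol1]] continuous_intros) auto
      qed
      show "(\<lambda>t :: real. \<bar>B\<bar>) integrable_on {0..1}" by (rule integrable_const_ivl)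
      fix t :: real assume t: "t \<in> {0..1}"
      show "cmod (?F n t) \<le> \<bar>B\<bar>" for n
      proof (cases "t \<in> K")
        case True
        have "of_real (r n) * cis (2 * pi * t) \<in> T"
          unfolding T_def using r(1)[of n] True by (auto intro!: image_eqI[of _ _ "(r n, t)"] simp: less_imp_le)
        hence "\<bar>Re (f (of_real (r n) * cis (2 * pi * t)))\<bar> \<le> B"
          using B abs_Re_le_cmod order_trans by blast
        hence "\<bar>Re (f (of_real (r n) * cis (2 * pi * t)))\<bar> * \<bar>g t\<bar> \<le> \<bar>B\<bar> * 1"
          using gb[of t] by (intro mult_mono) auto
        thus ?thesis by (simp add: norm_mult)
      next
        case False
        hence "g t = 0" using t by (simp add: g_def K_def)
        thus ?thesis by simp
      qed
      show "(\<lambda>n. ?F n t) \<longlonglongrightarrow> 0"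
      proof (cases "t \<in> K")
        case True
        have "of_real 1 * cis (2 * pi * t) \<in> T"
          unfolding T_def using True by (intro image_eqI[of _ _ "(1, t)"]) auto
        hence c: "isCont f (of_real 1 * cis (2 * pi * t))" using fT by blast
        have "(\<lambda>n. of_real (r n) * cis (2 * pi * t)) \<longlonglongrightarrow> of_real 1 * cis (2 * pi * t)"
          by (intro tendsto_intros r(2))
        hence "(\<lambda>n. f (of_real (r n) * cis (2 * pi * t))) \<longlonglongrightarrow> f (of_real 1 * cis (2 * pi * t))"
          by (rule isCont_tendsto_compose[OF c])
        hence "(\<lambda>n. ?F n t) \<longlonglongrightarrow> of_real (Re (f (of_real 1 * cis (2 * pi * t)))) * of_real (g t)"
          by (intro tendsto_intros)
        moreover have "Re (f (of_real 1 * cis (2 * pi * t))) = 0"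
          using real[OF boundary(3)[OF True]] by (simp add: f_def boundary(2)[OF True])
        ultimately show ?thesis by simp
      next
        case False
        hence "g t = 0" using t by (simp add: g_def K_def)
        thus ?thesis by simp
      qed
    qed
    moreover have "(\<lambda>n. integral {0..1} (?F n)) \<longlonglongrightarrow> of_real k * (LINT t|M. complex_of_real (g t))"
      unfolding k_def
    proof (rule lim)
      show "isCont (\<lambda>t. complex_of_real (g t)) t" for t
        using gc[of UNIV] by (intro continuous_intros) (simp add: continuous_on_eq_continuous_at)
      show "cmod (complex_of_real (g t)) \<le> 1" for t using gb[of t] by simp
    qed
    ultimately have "of_real k * (LINT t|M. complex_of_real (g t)) = 0"
      using LIMSEQ_unique by fastforce
    hence "(LINT t|M. g t) = 0" using k by simp
    moreover have [measurable]: "g \<in> borel_measurable borel"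
      by (rule borel_measurable_continuous_onI[OF gc])
    have "integrable M g"
      by (rule M.integrable_const_bound[of _ 1]) (use gb in auto)
    ultimately have "AE t in M. g t = 0"
      using integral_nonneg_eq_0_iff_AE[of M g] gb by auto
    thus ?thesis by eventually_elim (simp add: g_def max_def split: if_splits)
  qed
  have "AE t in M. \<forall>n. sin (2 * pi * t) \<le> 1 / real (Suc n)"
    unfolding AE_all_countable by (intro allI null) simp
  hence null0: "AE t in M. sin (2 * pi * t) \<le> 0"
  proof eventually_elim
    case (elim t)
    have "(\<lambda>n. 1 / real (Suc n)) \<longlonglongrightarrow> 0" by (rule LIMSEQ_Suc) (rule lim_1_over_n)
    thus ?case by (rule LIMSEQ_le_const) (use elim in auto)
  qed
  define \<nu> where "\<nu> = density M (\<lambda>_. ennreal k)"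
  define C where "C t = - cos (pi * t)" for t
  define S where "S t = sin (pi * t)" for t
  have HK: "herglotz_kernel \<nu> C S"
  proof (intro herglotz_kernel.intro herglotz_kernel_axioms.intro)
    have "emeasure \<nu> (space \<nu>) = ennreal k * emeasure M (space M)"
      by (simp add: \<nu>_def emeasure_density_const)
    thus "finite_measure \<nu>"
      by (intro finite_measureI) (simp add: M.emeasure_space_1 del: M.space_eq_univ)
    have "C \<in> borel_measurable borel" "S \<in> borel_measurable borel"
      unfolding C_def[abs_def] S_def[abs_def] by measurable
    moreover have "sets \<nu> = sets borel" by (simp add: \<nu>_def)
    ultimately show "C \<in> borel_measurable \<nu>" "S \<in> borel_measurable \<nu>"
      by (simp_all cong: measurable_cong_sets)
    show "(C t)\<^sup>2 + (S t)\<^sup>2 = 1" for t by (simp add: C_def S_def)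
    have "AE t in M. 0 \<le> C t * S t"
      using null0
    proof eventually_elim
      case (elim t)
      have "2 * (cos (pi * t) * sin (pi * t)) = sin (2 * pi * t)"
        using sin_double[of "pi * t"] by (simp add: mult_ac)
      thus ?case using elim by (simp add: C_def S_def)
    qed
    thus "AE t in \<nu>. 0 \<le> C t * S t"
      unfolding \<nu>_def using k by (simp add: AE_density)
  qed
  interpret HK: herglotz_kernel \<nu> C S by (rule HK)
  show ?thesis
  proof (rule that[OF HK])
    fix w :: complex assume w: "Im w > 0"
    define u where "u = (w - \<i>) / (w + \<i>)"
    have wi: "w + \<i> \<noteq> 0" using w by (auto simp: complex_eq_iff)
    have u: "cmod u < 1"
    proof -
      have "(cmod (w - \<i>))\<^sup>2 < (cmod (w + \<i>))\<^sup>2"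
        using w by (simp add: cmod_power2 power2_sum power2_diff)
      hence "cmod (w - \<i>) < cmod (w + \<i>)" by (rule power2_less_imp_less) simp
      thus ?thesis using wi by (simp add: u_def norm_divide)
    qed
    have cu: "cay u = w"
    proof -
      have "1 + u = 2 * w / (w + \<i>)" "1 - u = 2 * \<i> / (w + \<i>)"
        unfolding u_def using wi by (simp_all add: field_simps)
      thus ?thesis unfolding cay_def using wi by simp
    qed
    have ker: "(\<lambda>t. \<i> * ((cis (2 * pi * t) + u) / (cis (2 * pi * t) - u))) = HK.kern w"
    proof (rule ext)
      fix t
      have eq: "2 * (pi * t) = 2 * pi * t" by simp
      show "\<i> * ((cis (2 * pi * t) + u) / (cis (2 * pi * t) - u)) = HK.kern w t"
        using cayley_kernel[OF w, of "pi * t", folded u_def] unfolding eq HK.kern_def C_def S_def .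
    qed
    have V: "HK.V w = of_real k * (LINT t|M. HK.kern w t)"
    proof -
      have "HK.kern w \<in> borel_measurable M"
        using HK.kern_measurable[of w] by (simp add: \<nu>_def)
      hence "HK.V w = (LINT t|M. k *\<^sub>R HK.kern w t)"
        unfolding HK.V_def unfolding \<nu>_def by (rule integral_density) (use k in auto)
      thus ?thesis by (simp add: scaleR_conv_of_real)
    qed
    have "N w = \<i> * f u" by (simp add: f_def cu)
    also have "\<dots> = - of_real (Im (f 0)) +
        of_real k * (\<i> * (LINT t|M. (cis (2 * pi * t) + u) / (cis (2 * pi * t) - u)))"
      unfolding rep[OF u] by (simp add: distrib_left mult.left_commute flip: mult.assoc)
    also have "\<i> * (LINT t|M. (cis (2 * pi * t) + u) / (cis (2 * pi * t) - u)) = (LINT t|M. HK.kern w t)"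
      unfolding ker[symmetric] by (rule integral_mult_right_zero[symmetric])
    also have "- complex_of_real (Im (f 0)) = of_real (Re (N \<i>))"
      by (simp add: f_def cay_def)
    finally show "N w = of_real (Re (N \<i>)) + HK.V w" unfolding V .
  qed
qed

section \<open>Transforms of measures on the half-line\<close>

text \<open>With r = |z| the number \<kappa> is the squared sine of half the argument of z, positive
  off the half-line, and Re z = r (1 - 2 \<kappa>). The inequality \<open>key\<close>, whose defect
  is (1 - \<kappa>) (a - b)^2, covers both denominators: take (a, b) = (1, t r) and (a, b) = (r,
  t).\<close>

lemma resolvent_lower_bound:
  assumes "z \<notin> \<real>\<^sub>\<ge>\<^sub>0"
  obtains k where "k > 0" "\<And>t. t \<ge> 0 \<Longrightarrow> k * (1 + t) \<le> cmod (1 - of_real t * z)"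
    "\<And>t. t \<ge> 0 \<Longrightarrow> k * (1 + t) \<le> cmod (z - of_real t)"
proof -
  define r where "r = cmod z"
  have r: "r > 0" using assms by (auto simp: r_def)
  have rz: "Re z < r"
  proof (rule ccontr)
    assume "\<not> Re z < r"
    hence "Re z = r" using complex_Re_le_cmod[of z] by (simp add: r_def)
    hence "(Im z)\<^sup>2 = 0" using cmod_power2[of z] by (simp add: r_def)
    thus False using assms \<open>Re z = r\<close> r by (auto simp: complex_nonneg_Reals_iff)
  qed
  define \<kappa> where "\<kappa> = (r - Re z) / (2 * r)"
  have \<kappa>: "\<kappa> > 0" "\<kappa> \<le> 1"
    using r rz abs_Re_le_cmod[of z] by (auto simp: \<kappa>_def r_def divide_le_eq)
  have Re: "Re z = r * (1 - 2 * \<kappa>)" using r by (simp add: \<kappa>_def field_simps)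
  have key: "\<kappa> * (a + b)\<^sup>2 \<le> a\<^sup>2 + b\<^sup>2 - 2 * (a * b) * (1 - 2 * \<kappa>)" for a b :: real
  proof -
    have "a\<^sup>2 + b\<^sup>2 - 2 * (a * b) * (1 - 2 * \<kappa>) - \<kappa> * (a + b)\<^sup>2 = (1 - \<kappa>) * (a - b)\<^sup>2"
      by (simp add: power2_eq_square algebra_simps)
    also have "\<dots> \<ge> 0" using \<kappa> by simp
    finally show ?thesis by simp
  qed
  define m where "m = min 1 r"
  have m: "m > 0" "m \<le> 1" "m \<le> r" using r by (auto simp: m_def)
  have rsq: "r\<^sup>2 = (Re z)\<^sup>2 + (Im z)\<^sup>2" by (simp add: r_def cmod_power2)
  show ?thesis
  proof (rule that[of "sqrt \<kappa> * m"])
    show "sqrt \<kappa> * m > 0" using \<kappa> m by simp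
    fix t :: real assume t: "t \<ge> 0"
    have mt: "m * t \<le> r * t" "m * t \<le> 1 * t" using m t by (intro mult_right_mono; simp)+
    have "m * (1 + t) \<le> 1 + t * r" "m * (1 + t) \<le> r + t"
      using m mt by (simp_all add: distrib_left mult.commute)
    moreover have "0 \<le> m * (1 + t)" using m t by simp
    ultimately have 1: "(m * (1 + t))\<^sup>2 \<le> (1 + t * r)\<^sup>2" "(m * (1 + t))\<^sup>2 \<le> (r + t)\<^sup>2"
      using power_mono by blast+
    have "\<kappa> * (m * (1 + t))\<^sup>2 \<le> \<kappa> * (1 + t * r)\<^sup>2"
      using 1 \<kappa> by (intro mult_left_mono) auto
    also have "\<dots> \<le> 1\<^sup>2 + (t * r)\<^sup>2 - 2 * (1 * (t * r)) * (1 - 2 * \<kappa>)" by (rule key)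
    also have "\<dots> = 1 + t\<^sup>2 * r\<^sup>2 - 2 * t * Re z" by (simp add: Re power_mult_distrib)
    also have "\<dots> = (cmod (1 - of_real t * z))\<^sup>2"
      unfolding rsq cmod_power2 by (simp add: power2_eq_square algebra_simps)
    finally have "(sqrt \<kappa> * m * (1 + t))\<^sup>2 \<le> (cmod (1 - of_real t * z))\<^sup>2"
      using \<kappa> by (simp add: power_mult_distrib mult.assoc)
    thus "sqrt \<kappa> * m * (1 + t) \<le> cmod (1 - of_real t * z)"
      by (rule power2_le_imp_le) simp
    have "\<kappa> * (m * (1 + t))\<^sup>2 \<le> \<kappa> * (r + t)\<^sup>2"
      using 1 \<kappa> by (intro mult_left_mono) auto
    also have "\<dots> \<le> r\<^sup>2 + t\<^sup>2 - 2 * (r * t) * (1 - 2 * \<kappa>)" by (rule key)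
    also have "\<dots> = r\<^sup>2 + t\<^sup>2 - 2 * t * Re z" by (simp add: Re)
    also have "\<dots> = (cmod (z - of_real t))\<^sup>2"
      unfolding rsq cmod_power2 by (simp add: power2_eq_square algebra_simps)
    finally have "(sqrt \<kappa> * m * (1 + t))\<^sup>2 \<le> (cmod (z - of_real t))\<^sup>2"
      using \<kappa> by (simp add: power_mult_distrib mult.assoc)
    thus "sqrt \<kappa> * m * (1 + t) \<le> cmod (z - of_real t)"
      by (rule power2_le_imp_le) simp
  qed
qed

lemma resolvent_lower_bound_near:
  assumes "z0 \<notin> \<real>\<^sub>\<ge>\<^sub>0"
  obtains k where "k > 0"
    "\<And>z t. z \<in> ball z0 k \<Longrightarrow> t \<ge> 0 \<Longrightarrow> k * (1 + t) \<le> cmod (1 - of_real t * z)"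
    "\<And>z t. z \<in> ball z0 k \<Longrightarrow> t \<ge> 0 \<Longrightarrow> k * (1 + t) \<le> cmod (z - of_real t)"
proof -
  obtain k where k: "k > 0" "\<And>t. t \<ge> 0 \<Longrightarrow> k * (1 + t) \<le> cmod (1 - of_real t * z0)"
    "\<And>t. t \<ge> 0 \<Longrightarrow> k * (1 + t) \<le> cmod (z0 - of_real t)"
    using resolvent_lower_bound[OF assms] by blast
  show ?thesis
  proof (rule that[of "k / 2"])
    fix z t assume z: "z \<in> ball z0 (k / 2)" and t: "(t :: real) \<ge> 0"
    have d: "cmod (z0 - z) \<le> k / 2" using z by (simp add: dist_norm)
    have "k * (1 + t) \<le> cmod ((1 - of_real t * z) - of_real t * (z0 - z))"
      using k(2)[OF t] by (simp add: algebra_simps)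
    also have "\<dots> \<le> cmod (1 - of_real t * z) + t * cmod (z0 - z)"
      using norm_triangle_ineq4[of "1 - of_real t * z" "of_real t * (z0 - z)"] t by (simp add: norm_mult)
    also have "t * cmod (z0 - z) \<le> (1 + t) * (k / 2)"
      using d t by (intro mult_mono) auto
    finally show "k / 2 * (1 + t) \<le> cmod (1 - of_real t * z)" by (simp add: field_simps)
    have "k * (1 + t) \<le> cmod ((z - of_real t) + (z0 - z))"
      using k(3)[OF t] by simp
    also have "\<dots> \<le> cmod (z - of_real t) + cmod (z0 - z)" by (rule norm_triangle_ineq)
    also have "cmod (z0 - z) \<le> (1 + t) * (k / 2)"
      using mult_mono[of 1 "1 + t" "cmod (z0 - z)" "k / 2"] d t k(1) by simp
    finally show "k / 2 * (1 + t) \<le> cmod (z - of_real t)" by (simp add: field_simps)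
  qed (use k in simp)
qed

text \<open>The kernels in question are Moebius maps in z, so their difference quotient
  \<open>g\<close> is explicit and bounded. Dominated convergence for the quotient then replaces any
  estimate of a derivative along paths.\<close>

lemma has_field_derivative_integral_kernel:
  fixes f g :: "complex \<Rightarrow> 'a \<Rightarrow> complex"
  assumes M: "finite_measure M" and \<epsilon>: "\<epsilon> > 0"
    and int: "\<And>z. z \<in> ball z0 \<epsilon> \<Longrightarrow> integrable M (f z)"
    and diff: "\<And>z. z \<in> ball z0 \<epsilon> \<Longrightarrow> AE t in M. f z t - f z0 t = (z - z0) * g z t"
    and meas: "\<And>z. z \<in> ball z0 \<epsilon> \<Longrightarrow> g z \<in> borel_measurable M"
    and bound: "\<And>z. z \<in> ball z0 \<epsilon> \<Longrightarrow> AE t in M. cmod (g z t) \<le> B"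
    and cont: "AE t in M. isCont (\<lambda>z. g z t) z0"
  shows "((\<lambda>z. LINT t|M. f z t) has_field_derivative (LINT t|M. g z0 t)) (at z0)"
proof -
  interpret finite_measure M by (rule M)
  have gint: "integrable M (g z)" if "z \<in> ball z0 \<epsilon>" for z
    by (rule integrable_const_bound[OF bound meas]) (use that in auto)
  have z0: "z0 \<in> ball z0 \<epsilon>" using \<epsilon> by simp
  have quot: "((LINT t|M. f z t) - (LINT t|M. f z0 t)) / (z - z0) = (LINT t|M. g z t)"
    if z: "z \<in> ball z0 \<epsilon>" "z \<noteq> z0" for z
  proof -
    have "(LINT t|M. f z t) - (LINT t|M. f z0 t) = (LINT t|M. f z t - f z0 t)"
      by (rule Bochner_Integration.integral_diff[symmetric]) (intro int z z0)+
    also have "\<dots> = (LINT t|M. (z - z0) * g z t)"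
      using int[OF z(1)] int[OF z0] meas[OF z(1)] diff[OF z(1)] by (intro integral_cong_AE) auto
    finally show ?thesis using z by simp
  qed
  have "((\<lambda>z. LINT t|M. g z t) \<longlongrightarrow> (LINT t|M. g z0 t)) (at z0)"
    unfolding tendsto_at_iff_sequentially
  proof (intro allI impI)
    fix X assume X: "\<forall>i. X i \<in> UNIV - {z0}" and Xl: "X \<longlonglongrightarrow> z0"
    have "eventually (\<lambda>n. X n \<in> ball z0 \<epsilon>) sequentially"
      using Xl \<epsilon> topological_tendstoD z0 by blast
    then obtain n0 where n0: "\<And>n. n \<ge> n0 \<Longrightarrow> X n \<in> ball z0 \<epsilon>"
      by (auto simp: eventually_sequentially)
    define Y where "Y n = X (n + n0)" for n
    have Y: "Y n \<in> ball z0 \<epsilon>" for n using n0 by (simp add: Y_def)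
    have Yl: "Y \<longlonglongrightarrow> z0" unfolding Y_def using Xl by (rule LIMSEQ_ignore_initial_segment)
    have "(\<lambda>n. LINT t|M. g (Y n) t) \<longlonglongrightarrow> (LINT t|M. g z0 t)"
    proof (rule integral_dominated_convergence)
      show "integrable M (\<lambda>_. B)" by simp
      show "AE t in M. (\<lambda>n. g (Y n) t) \<longlonglongrightarrow> g z0 t"
        using cont by eventually_elim (rule isCont_tendsto_compose[OF _ Yl])
      show "AE t in M. cmod (g (Y n) t) \<le> B" for n by (rule bound[OF Y])
    qed (use meas Y z0 in auto)
    thus "((\<lambda>z. LINT t|M. g z t) \<circ> X) \<longlonglongrightarrow> (LINT t|M. g z0 t)"
      unfolding Y_def o_def by (rule LIMSEQ_offset)
  qed
  moreover have "eventually (\<lambda>z. (LINT t|M. g z t) = ((LINT t|M. f z t) - (LINT t|M. f z0 t)) / (z - z0)) (at z0)"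
    unfolding eventually_at by (rule exI[of _ \<epsilon>]) (use \<epsilon> quot in \<open>auto simp: dist_commute\<close>)
  ultimately show ?thesis
    unfolding has_field_derivative_iff by (rule Lim_transform_eventually)
qed

section \<open>Measures on the half-line with mass on the open half-line\<close>

lemma prob_Rplus_AE_nonneg:
  assumes "prob_Rplus \<mu>"
  shows "AE t in \<mu>. t \<ge> 0"
proof (rule AE_I')
  show "{..<0} \<in> null_sets \<mu>" using assms by (simp add: prob_Rplus_def null_sets_def)
qed auto

lemma no_positive_part:
  assumes "prob_Rplus \<mu>" "emeasure \<mu> {0<..} = 0"
  shows "AE t in \<mu>. t = 0"
proof -
  have "AE t in \<mu>. t \<notin> {0<..}"
    using assms by (intro AE_not_in) (simp add: prob_Rplus_def null_sets_def)
  with prob_Rplus_AE_nonneg[OF assms(1)] show ?thesis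
    by eventually_elim auto
qed

lemma nondegenerate_positive_part:
  assumes "prob_Rplus \<mu>" "nondegenerate \<mu>"
  shows "emeasure \<mu> {0<..} \<noteq> 0"
proof
  assume "emeasure \<mu> {0<..} = 0"
  hence ae: "AE t in \<mu>. t = 0" by (rule no_positive_part[OF assms(1)])
  interpret prob_space \<mu> using assms by (simp add: prob_Rplus_def)
  have s: "sets \<mu> = sets borel" using assms by (simp add: prob_Rplus_def)
  have "\<mu> = return borel 0"
  proof (rule measure_eqI)
    fix A assume A: "A \<in> sets \<mu>"
    have "emeasure \<mu> A = emeasure \<mu> (if 0 \<in> A then space \<mu> else {})"
      using ae A s sets_eq_imp_space_eq[OF s] by (intro emeasure_eq_AE) auto
    thus "emeasure \<mu> A = emeasure (return borel 0) A"
      using A s emeasure_space_1 by (simp add: indicator_def)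
  qed (simp add: s)
  thus False using assms(2) unfolding nondegenerate_def by blast
qed

lemma psi_no_positive_part:
  assumes "prob_Rplus \<mu>" "emeasure \<mu> {0<..} = 0"
  shows "psi \<mu> z = 0"
proof -
  have "psi \<mu> z = (LINT t|\<mu>. 0)"
    unfolding psi_def set_lebesgue_integral_def
  proof (rule integral_cong_AE)
    show "AE t in \<mu>. indicat_real {0..} t *\<^sub>R (of_real t * z / (1 - of_real t * z)) = 0"
      using no_positive_part[OF assms] by eventually_elim simp
    have s: "sets \<mu> = sets borel" using assms by (simp add: prob_Rplus_def)
    show "(\<lambda>t. indicat_real {0..} t *\<^sub>R (of_real t * z / (1 - of_real t * z))) \<in> borel_measurable \<mu>"
      unfolding measurable_cong_sets[OF s refl] by measurable
  qed simp
  thus ?thesis by simp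
qed

locale eta_measure = prob_space \<mu> for \<mu> :: "real measure" +
  assumes sets_eq: "sets \<mu> = sets borel"
    and AE_nonneg: "AE t in \<mu>. t \<ge> 0"
    and positive_part: "emeasure \<mu> {0<..} \<noteq> 0"

lemma eta_measureI:
  assumes "prob_Rplus \<mu>" "emeasure \<mu> {0<..} \<noteq> 0"
  shows "eta_measure \<mu>"
  using assms prob_Rplus_AE_nonneg[OF assms(1)]
  by (intro eta_measure.intro eta_measure_axioms.intro) (auto simp: prob_Rplus_def)

context eta_measure
begin

lemma borel_measurable_mu: "f \<in> borel_measurable borel \<Longrightarrow> f \<in> borel_measurable \<mu>"
  using measurable_cong_sets[OF sets_eq refl] by blast

lemma psi_eq: "psi \<mu> z = (LINT t|\<mu>. of_real t * z / (1 - of_real t * z))"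
  unfolding psi_def set_lebesgue_integral_def
proof (rule integral_cong_AE)
  show "AE t in \<mu>. indicat_real {0..} t *\<^sub>R (of_real t * z / (1 - of_real t * z)) =
      of_real t * z / (1 - of_real t * z)"
    using AE_nonneg by eventually_elim simp
qed (rule borel_measurable_mu, measurable)+

lemma integrable_AE_bound:
  fixes f :: "real \<Rightarrow> 'a :: {banach, second_countable_topology}"
  assumes "f \<in> borel_measurable borel" "\<And>t. t \<ge> 0 \<Longrightarrow> norm (f t) \<le> B"
  shows "integrable \<mu> f"
proof (rule integrable_const_bound[of _ B])
  show "AE t in \<mu>. norm (f t) \<le> B" using AE_nonneg by eventually_elim (rule assms(2))
qed (rule borel_measurable_mu[OF assms(1)])

lemma resolvent_nonzero:
  fixes z :: complex
  assumes "z \<notin> \<real>\<^sub>\<ge>\<^sub>0" "t \<ge> 0"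
  shows "1 - of_real t * z \<noteq> 0"
proof -
  obtain k where k: "k > 0" "\<And>t. t \<ge> 0 \<Longrightarrow> k * (1 + t) \<le> cmod (1 - of_real t * z)"
    "\<And>t. t \<ge> 0 \<Longrightarrow> k * (1 + t) \<le> cmod (z - of_real t)"
    using resolvent_lower_bound[OF assms(1)] by blast
  have "cmod (1 - of_real t * z) > 0"
    by (rule less_le_trans[OF _ k(2)[OF assms(2)]]) (use k assms in simp)
  thus ?thesis by auto
qed

lemma resolvent_bounds:
  fixes z :: complex
  assumes "z \<notin> \<real>\<^sub>\<ge>\<^sub>0"
  shows "\<exists>B>0. \<forall>t\<ge>0. (1 + t) / cmod (1 - of_real t * z) \<le> B"
proof -
  obtain k where k: "k > 0" "\<And>t. t \<ge> 0 \<Longrightarrow> k * (1 + t) \<le> cmod (1 - of_real t * z)"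
    "\<And>t. t \<ge> 0 \<Longrightarrow> k * (1 + t) \<le> cmod (z - of_real t)"
    using resolvent_lower_bound[OF assms] by blast
  have "(1 + t) / cmod (1 - of_real t * z) \<le> 1 / k" if t: "t \<ge> 0" for t
  proof -
    have p: "cmod (1 - of_real t * z) > 0" using resolvent_nonzero[OF assms t] by simp
    have "1 + t \<le> cmod (1 - of_real t * z) / k"
      using k(1) k(2)[OF t] by (simp add: le_divide_eq mult.commute)
    from divide_right_mono[OF this, of "cmod (1 - of_real t * z)"] show ?thesis
      using p by simp
  qed
  thus ?thesis using k(1) by (intro exI[of _ "1 / k"]) simp
qed

lemma resolvent_AE_nonzero:
  fixes z :: complex
  assumes "z \<notin> \<real>\<^sub>\<ge>\<^sub>0"
  shows "AE t in \<mu>. 1 - of_real t * z \<noteq> 0"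
  using AE_nonneg by eventually_elim (rule resolvent_nonzero[OF assms])

lemma integrable_weight_resolvent:
  fixes z w :: complex
  assumes "z \<notin> \<real>\<^sub>\<ge>\<^sub>0" "w \<notin> \<real>\<^sub>\<ge>\<^sub>0"
  shows "integrable \<mu> (\<lambda>t. of_real t / ((1 - of_real t * z) * (1 - of_real t * w)))"
proof -
  obtain A where A: "\<And>t. t \<ge> 0 \<Longrightarrow> (1 + t) / cmod (1 - of_real t * z) \<le> A" "A > 0"
    using resolvent_bounds[OF assms(1)] by auto
  obtain B where B: "\<And>t. t \<ge> 0 \<Longrightarrow> (1 + t) / cmod (1 - of_real t * w) \<le> B" "B > 0"
    using resolvent_bounds[OF assms(2)] by auto
  show ?thesis
  proof (rule integrable_AE_bound[of _ "A * B"])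
    fix t :: real assume t: "t \<ge> 0"
    have "t / (cmod (1 - of_real t * z) * cmod (1 - of_real t * w)) \<le>
        ((1 + t) * (1 + t)) / (cmod (1 - of_real t * z) * cmod (1 - of_real t * w))"
    proof (rule divide_right_mono)
      show "t \<le> (1 + t) * (1 + t)" using t zero_le_square[of t] by (simp add: distrib_left distrib_right)
    qed simp
    also have "\<dots> = ((1 + t) / cmod (1 - of_real t * z)) * ((1 + t) / cmod (1 - of_real t * w))"
      by (simp only: times_divide_times_eq)
    also have "\<dots> \<le> A * B"
      using A(1)[OF t] B(1)[OF t] A(2) t by (intro mult_mono) auto
    finally show "norm (of_real t / ((1 - of_real t * z) * (1 - of_real t * w))) \<le> A * B"
      using t by (simp add: norm_divide norm_mult)
  qed measurable
qed

lemma integrable_resolvent: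
  fixes z :: complex
  assumes "z \<notin> \<real>\<^sub>\<ge>\<^sub>0"
  shows "integrable \<mu> (\<lambda>t. of_real t * z / (1 - of_real t * z))"
proof -
  obtain B where B: "\<And>t. t \<ge> 0 \<Longrightarrow> (1 + t) / cmod (1 - of_real t * z) \<le> B" "B > 0"
    using resolvent_bounds[OF assms] by auto
  show ?thesis
  proof (rule integrable_AE_bound[of _ "B * cmod z"])
    fix t :: real assume t: "t \<ge> 0"
    have "t / cmod (1 - of_real t * z) \<le> B"
      by (rule order_trans[OF divide_right_mono B(1)[OF t]]) simp_all
    hence "t / cmod (1 - of_real t * z) * cmod z \<le> B * cmod z"
      by (rule mult_right_mono) simp
    thus "norm (of_real t * z / (1 - of_real t * z)) \<le> B * cmod z"
      using t by (simp add: norm_divide norm_mult)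
  qed measurable
qed

lemma psi_integrand_diff:
  fixes t z w :: complex
  assumes "1 - t * z \<noteq> 0" "1 - t * w \<noteq> 0"
  shows "t * z / (1 - t * z) - t * w / (1 - t * w) = (z - w) * (t / ((1 - t * z) * (1 - t * w)))"
proof -
  have "t * z * (1 - t * w) - t * w * (1 - t * z) = (z - w) * t" by (simp add: algebra_simps)
  thus ?thesis unfolding diff_frac_eq[OF assms] by simp
qed

lemma psi_diff:
  assumes "z \<notin> \<real>\<^sub>\<ge>\<^sub>0" "w \<notin> \<real>\<^sub>\<ge>\<^sub>0"
  shows "psi \<mu> z - psi \<mu> w =
    (z - w) * (LINT t|\<mu>. of_real t / ((1 - of_real t * z) * (1 - of_real t * w)))"
proof -
  have "psi \<mu> z - psi \<mu> w = (LINT t|\<mu>. of_real t * z / (1 - of_real t * z) - of_real t * w / (1 - of_real t * w))"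
    unfolding psi_eq by (rule Bochner_Integration.integral_diff[symmetric]) (intro integrable_resolvent assms)+
  also have "\<dots> = (LINT t|\<mu>. (z - w) * (of_real t / ((1 - of_real t * z) * (1 - of_real t * w))))"
  proof (rule integral_cong_AE)
    show "AE t in \<mu>. of_real t * z / (1 - of_real t * z) - of_real t * w / (1 - of_real t * w) =
        (z - w) * (of_real t / ((1 - of_real t * z) * (1 - of_real t * w)))"
      using resolvent_AE_nonzero[OF assms(1)] resolvent_AE_nonzero[OF assms(2)]
      by eventually_elim (rule psi_integrand_diff)
  qed (rule borel_measurable_mu, measurable)+
  finally show ?thesis by (simp only: integral_mult_right_zero)
qed

lemma psi_has_field_derivative:
  assumes z0: "z0 \<notin> \<real>\<^sub>\<ge>\<^sub>0"
  shows "(psi \<mu> has_field_derivative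
    (LINT t|\<mu>. of_real t / ((1 - of_real t * z0) * (1 - of_real t * z0)))) (at z0)"
proof -
  obtain k where k: "k > 0"
    "\<And>z t. z \<in> ball z0 k \<Longrightarrow> t \<ge> 0 \<Longrightarrow> k * (1 + t) \<le> cmod (1 - of_real t * z)"
    "\<And>z t. z \<in> ball z0 k \<Longrightarrow> t \<ge> 0 \<Longrightarrow> k * (1 + t) \<le> cmod (z - of_real t)"
    using resolvent_lower_bound_near[OF z0] by blast
  have kp: "k * (1 + t) > 0" if "t \<ge> 0" for t using k(1) that by simp
  have nz: "1 - of_real t * z \<noteq> 0" if "z \<in> ball z0 k" "t \<ge> 0" for z t
    using k(2)[OF that] kp[OF that(2)] by auto
  have out: "z \<notin> \<real>\<^sub>\<ge>\<^sub>0" if z: "z \<in> ball z0 k" for z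
  proof
    assume "z \<in> \<real>\<^sub>\<ge>\<^sub>0"
    then obtain x where x: "z = of_real x" "x \<ge> 0" by (auto elim: nonneg_Reals_cases)
    show False
    proof (cases "x = 0")
      case True
      \<comment> \<open>If the ball contained the origin, this t would give k (1 + t) = k + 1 + t
        |z0|, more than |1 - t z0| can be. For a positive real point x of the ball the choice t =
        1/x makes the resolvent denominator vanish.\<close>
      define t where "t = 1 / (k - cmod z0)"
      have "cmod z0 < k" using True z x by simp
      hence t: "t \<ge> 0" "t * (k - cmod z0) = 1" by (simp_all add: t_def)
      hence "k * (1 + t) > 1 + t * cmod z0" using k(1) by (simp add: algebra_simps)
      moreover have "cmod (1 - of_real t * z0) \<le> 1 + t * cmod z0"
        using norm_triangle_ineq4[of 1 "of_real t * z0"] t by (simp add: norm_mult)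
      ultimately show False using k(2)[of z0 t] k(1) t by simp
    next
      case False
      thus False using nz[OF z, of "1 / x"] x by simp
    qed
  qed
  have "((\<lambda>z. LINT t|\<mu>. of_real t * z / (1 - of_real t * z)) has_field_derivative
    (LINT t|\<mu>. of_real t / ((1 - of_real t * z0) * (1 - of_real t * z0)))) (at z0)"
  proof (rule has_field_derivative_integral_kernel[OF finite_measure_axioms k(1),
        where g = "\<lambda>z t. of_real t / ((1 - of_real t * z) * (1 - of_real t * z0))" and B = "1 / (k * k)"])
    fix z assume z: "z \<in> ball z0 k"
    show "integrable \<mu> (\<lambda>t. of_real t * z / (1 - of_real t * z))"
      by (rule integrable_resolvent[OF out[OF z]])
    show "AE t in \<mu>. of_real t * z / (1 - of_real t * z) - of_real t * z0 / (1 - of_real t * z0) =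
        (z - z0) * (of_real t / ((1 - of_real t * z) * (1 - of_real t * z0)))"
      using AE_nonneg
    proof eventually_elim
      case (elim t)
      have "1 - of_real t * z \<noteq> 0" "1 - of_real t * z0 \<noteq> 0"
        using nz[OF z elim] nz[OF _ elim, of z0] k(1) by auto
      thus ?case by (rule psi_integrand_diff)
    qed
    show "(\<lambda>t. of_real t / ((1 - of_real t * z) * (1 - of_real t * z0))) \<in> borel_measurable \<mu>"
      by (rule borel_measurable_mu) measurable
    show "AE t in \<mu>. cmod (of_real t / ((1 - of_real t * z) * (1 - of_real t * z0))) \<le> 1 / (k * k)"
      using AE_nonneg
    proof eventually_elim
      case (elim t)
      have "cmod (of_real t / ((1 - of_real t * z) * (1 - of_real t * z0))) =
          t / (cmod (1 - of_real t * z) * cmod (1 - of_real t * z0))"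
        using elim by (simp add: norm_divide norm_mult)
      also have "\<dots> \<le> ((1 + t) * (1 + t)) / ((k * (1 + t)) * (k * (1 + t)))"
      proof (rule frac_le)
        show "k * (1 + t) * (k * (1 + t)) \<le> cmod (1 - of_real t * z) * cmod (1 - of_real t * z0)"
          using k(2)[OF z elim] k(2)[OF _ elim, of z0] k(1) elim by (intro mult_mono) auto
        show "0 < k * (1 + t) * (k * (1 + t))" using kp[OF elim] by simp
        show "t \<le> (1 + t) * (1 + t)" using elim zero_le_square[of t] by (simp add: distrib_left distrib_right)
      qed (use elim in simp)
      also have "\<dots> = 1 / (k * k)" using elim k(1) by simp
      finally show ?case .
    qed
  next
    show "AE t in \<mu>. isCont (\<lambda>z. of_real t / ((1 - of_real t * z) * (1 - of_real t * z0))) z0"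
      using AE_nonneg
    proof eventually_elim
      case (elim t)
      show ?case using nz[OF _ elim, of z0] k(1) by (intro continuous_intros) auto
    qed
  qed
  thus ?thesis by (simp add: psi_eq[abs_def])
qed

lemma psi_holomorphic: "psi \<mu> holomorphic_on - \<real>\<^sub>\<ge>\<^sub>0"
proof (rule holomorphic_onI)
  fix z :: complex assume "z \<in> - \<real>\<^sub>\<ge>\<^sub>0"
  thus "psi \<mu> field_differentiable at z within - \<real>\<^sub>\<ge>\<^sub>0"
    using psi_has_field_derivative[of z] field_differentiable_at_within field_differentiable_def by blast
qed

lemma integral_pos_weight:
  assumes int: "integrable \<mu> f" and pos: "\<And>t. t > 0 \<Longrightarrow> f t > (0 :: real)" and zero: "f 0 = 0"
  shows "(LINT t|\<mu>. f t) > 0"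
proof -
  have nn: "AE t in \<mu>. f t \<ge> 0"
    using AE_nonneg by eventually_elim (use pos zero in \<open>force simp: less_le\<close>)
  have "(LINT t|\<mu>. f t) \<noteq> 0"
  proof
    assume "(LINT t|\<mu>. f t) = 0"
    hence "AE t in \<mu>. f t = 0"
      using integral_nonneg_eq_0_iff_AE[OF int nn] by simp
    hence "AE t in \<mu>. t \<notin> {0<..}"
      by eventually_elim (use pos in force)
    hence "emeasure \<mu> {0<..} = 0"
      by (subst (asm) AE_iff_measurable[of "{0<..}"]) (auto simp: sets_eq sets_eq_imp_space_eq[OF sets_eq])
    thus False using positive_part by simp
  qed
  thus ?thesis using integral_nonneg_AE[OF nn] by simp
qed

text \<open>The ratio of Im \<psi> to Im z. It is the integral against the first measure that has to
  stay bounded, because the density is Im w times \<open>weight\<close> divided by \<pi>.\<close>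

definition weight :: "complex \<Rightarrow> real" where
  "weight z = (LINT t|\<mu>. t / (cmod (1 - of_real t * z))\<^sup>2)"

lemma integrable_weight:
  assumes "z \<notin> \<real>\<^sub>\<ge>\<^sub>0"
  shows "integrable \<mu> (\<lambda>t. t / (cmod (1 - of_real t * z))\<^sup>2)"
proof -
  have c: "cnj z \<notin> \<real>\<^sub>\<ge>\<^sub>0" using assms by (simp add: complex_nonneg_Reals_iff)
  have "integrable \<mu> (\<lambda>t. Re (of_real t / ((1 - of_real t * z) * (1 - of_real t * cnj z))))"
    by (rule integrable_Re) (rule integrable_weight_resolvent[OF assms c])
  moreover have "Re (of_real t / ((1 - of_real t * z) * (1 - of_real t * cnj z))) = t / (cmod (1 - of_real t * z))\<^sup>2" for t
  proof -
    have "(1 - of_real t * z) * (1 - of_real t * cnj z) = of_real ((cmod (1 - of_real t * z))\<^sup>2)"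
      unfolding complex_norm_square by simp
    thus ?thesis by (simp only: of_real_divide[symmetric] Re_complex_of_real)
  qed
  ultimately show ?thesis by simp
qed

lemma weight_pos: "z \<notin> \<real>\<^sub>\<ge>\<^sub>0 \<Longrightarrow> weight z > 0"
proof -
  assume z: "z \<notin> \<real>\<^sub>\<ge>\<^sub>0"
  have "1 - of_real t * z \<noteq> 0" if "t > 0" for t
    using resolvent_nonzero[OF z less_imp_le[OF that]] .
  thus ?thesis unfolding weight_def
    by (intro integral_pos_weight integrable_weight z) auto
qed

lemma psi_cnj: "psi \<mu> (cnj z) = cnj (psi \<mu> z)"
proof -
  have "(\<lambda>t. of_real t * cnj z / (1 - of_real t * cnj z)) =
      (\<lambda>t. cnj (of_real t * z / (1 - of_real t * z)))" by simp
  thus ?thesis unfolding psi_eq by (simp only: Bochner_Integration.integral_cnj)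
qed

lemma Im_psi:
  assumes "z \<notin> \<real>\<^sub>\<ge>\<^sub>0"
  shows "Im (psi \<mu> z) = Im z * weight z"
proof -
  have c: "cnj z \<notin> \<real>\<^sub>\<ge>\<^sub>0" using assms by (simp add: complex_nonneg_Reals_iff)
  have "psi \<mu> z - psi \<mu> (cnj z) =
      (z - cnj z) * (LINT t|\<mu>. of_real t / ((1 - of_real t * z) * (1 - of_real t * cnj z)))"
    by (rule psi_diff[OF assms c])
  also have "(\<lambda>t. of_real t / ((1 - of_real t * z) * (1 - of_real t * cnj z))) =
      (\<lambda>t. complex_of_real (t / (cmod (1 - of_real t * z))\<^sup>2))"
  proof
    fix t
    have "(1 - of_real t * z) * (1 - of_real t * cnj z) = of_real ((cmod (1 - of_real t * z))\<^sup>2)"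
      unfolding complex_norm_square by simp
    thus "of_real t / ((1 - of_real t * z) * (1 - of_real t * cnj z)) =
      complex_of_real (t / (cmod (1 - of_real t * z))\<^sup>2)" by simp
  qed
  also have "(LINT t|\<mu>. complex_of_real (t / (cmod (1 - of_real t * z))\<^sup>2)) = of_real (weight z)"
    unfolding weight_def by (rule integral_complex_of_real)
  finally have "psi \<mu> z - cnj (psi \<mu> z) = (z - cnj z) * of_real (weight z)"
    by (simp add: psi_cnj)
  hence "Im (psi \<mu> z - cnj (psi \<mu> z)) = Im ((z - cnj z) * of_real (weight z))" by simp
  thus ?thesis by simp
qed

lemma psi_neg:
  assumes "x < 0"
  shows "Im (psi \<mu> (of_real x)) = 0" "Re (psi \<mu> (of_real x)) < 0" "Re (1 + psi \<mu> (of_real x)) > 0"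
proof -
  have n: "complex_of_real x \<notin> \<real>\<^sub>\<ge>\<^sub>0" using assms by (simp add: complex_nonneg_Reals_iff)
  show "Im (psi \<mu> (of_real x)) = 0" using Im_psi[OF n] by simp
  have r: "of_real t * complex_of_real x / (1 - of_real t * of_real x) = of_real (t * x / (1 - t * x))" for t
    by simp
  have i: "integrable \<mu> (\<lambda>t. t * x / (1 - t * x))"
    using integrable_Re[OF integrable_resolvent[OF n]] unfolding r by simp
  have p: "psi \<mu> (of_real x) = of_real (LINT t|\<mu>. t * x / (1 - t * x))"
    unfolding psi_eq r by (rule integral_complex_of_real)
  have "(LINT t|\<mu>. - (t * x / (1 - t * x))) > 0"
  proof (rule integral_pos_weight)
    show "integrable \<mu> (\<lambda>t. - (t * x / (1 - t * x)))" using i by simp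
    fix t :: real assume "t > 0"
    hence "t * x < 0" using assms by (simp add: mult_pos_neg)
    thus "- (t * x / (1 - t * x)) > 0" by (simp add: divide_less_0_iff)
  qed simp
  thus "Re (psi \<mu> (of_real x)) < 0" using i by (simp add: p)
  have "(LINT t|\<mu>. 1 + t * x / (1 - t * x)) = 1 + (LINT t|\<mu>. t * x / (1 - t * x))"
    using i by (simp add: prob_space)
  moreover have "(LINT t|\<mu>. 1 + t * x / (1 - t * x)) > 0"
  proof -
    have ae: "AE t in \<mu>. 1 + t * x / (1 - t * x) > 0"
      using AE_nonneg
    proof eventually_elim
      case (elim t)
      hence "t * x \<le> 0" using assms by (simp add: mult_nonneg_nonpos)
      hence "1 + t * x / (1 - t * x) = 1 / (1 - t * x)" "1 - t * x > 0" by (simp_all add: field_simps)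
      thus ?case by simp
    qed
    have "integrable \<mu> (\<lambda>t. 1 + t * x / (1 - t * x))" using i by simp
    from integral_less_AE_space[OF _ this, of "\<lambda>_. 0"] ae show ?thesis
      by (simp add: emeasure_space_1)
  qed
  ultimately show "Re (1 + psi \<mu> (of_real x)) > 0" by (simp add: p)
qed

lemma not_nonneg_Reals_cases:
  assumes "z \<notin> \<real>\<^sub>\<ge>\<^sub>0"
  obtains "Im z \<noteq> 0" | x where "z = of_real x" "x < 0"
proof (cases "Im z = 0")
  case True
  hence "z = of_real (Re z)" by (simp add: complex_eq_iff)
  moreover have "Re z < 0" using True assms by (auto simp: complex_nonneg_Reals_iff)
  ultimately show ?thesis using that(2) by blast
qed (rule that(1))

lemma one_plus_psi_nonzero:
  assumes "z \<notin> \<real>\<^sub>\<ge>\<^sub>0"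
  shows "1 + psi \<mu> z \<noteq> 0"
  using assms
proof (cases rule: not_nonneg_Reals_cases)
  case 1
  have "Im (1 + psi \<mu> z) = Im z * weight z" using Im_psi[OF assms] by simp
  moreover have "Im z * weight z \<noteq> 0" using 1 weight_pos[OF assms] by simp
  ultimately show ?thesis by (metis zero_complex.simps(2))
next
  case (2 x)
  thus ?thesis using psi_neg(3)[OF 2(2)] by (metis less_irrefl zero_complex.simps(1))
qed

lemma eta_eq: "z \<notin> \<real>\<^sub>\<ge>\<^sub>0 \<Longrightarrow> eta \<mu> z = 1 - 1 / (1 + psi \<mu> z)"
  using one_plus_psi_nonzero[of z] by (simp add: eta_def field_simps)

lemma eta_holomorphic: "eta \<mu> holomorphic_on - \<real>\<^sub>\<ge>\<^sub>0"
  unfolding eta_def[abs_def]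
  using one_plus_psi_nonzero by (intro holomorphic_intros psi_holomorphic) auto

lemma Im_eta:
  assumes "z \<notin> \<real>\<^sub>\<ge>\<^sub>0"
  shows "Im (eta \<mu> z) = Im z * weight z / (cmod (1 + psi \<mu> z))\<^sup>2"
proof -
  let ?p = "1 + psi \<mu> z"
  have "Im (1 / ?p) = - Im ?p / (cmod ?p)\<^sup>2"
    by (simp add: Im_divide cmod_power2)
  thus ?thesis using Im_psi[OF assms] by (simp add: eta_eq[OF assms])
qed

lemma eta_upper: "Im z > 0 \<Longrightarrow> Im (eta \<mu> z) > 0"
proof -
  assume z: "Im z > 0"
  hence n: "z \<notin> \<real>\<^sub>\<ge>\<^sub>0" by (auto simp: complex_nonneg_Reals_iff)
  show ?thesis
    unfolding Im_eta[OF n] using weight_pos[OF n] one_plus_psi_nonzero[OF n] z by simp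
qed

lemma eta_neg:
  assumes "x < 0"
  obtains y where "eta \<mu> (of_real x) = of_real y" "y < 0"
proof
  have n: "complex_of_real x \<notin> \<real>\<^sub>\<ge>\<^sub>0" using assms by (simp add: complex_nonneg_Reals_iff)
  define p where "p = Re (psi \<mu> (of_real x))"
  have p: "psi \<mu> (of_real x) = of_real p" "p < 0" "1 + p > 0"
    using psi_neg[OF assms] by (simp_all add: p_def complex_eq_iff)
  show "eta \<mu> (of_real x) = of_real (p / (1 + p))" by (simp add: eta_def p)
  show "p / (1 + p) < 0" using p by (simp add: divide_less_0_iff)
qed

lemma eta_notin:
  assumes "z \<notin> \<real>\<^sub>\<ge>\<^sub>0"
  shows "eta \<mu> z \<notin> \<real>\<^sub>\<ge>\<^sub>0"
  using assms
proof (cases rule: not_nonneg_Reals_cases)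
  case 1
  hence "Im (eta \<mu> z) \<noteq> 0"
    unfolding Im_eta[OF assms] using weight_pos[OF assms] one_plus_psi_nonzero[OF assms] by simp
  thus ?thesis by (auto simp: complex_nonneg_Reals_iff)
next
  case (2 x)
  obtain y where "eta \<mu> (of_real x) = of_real y" "y < 0" using eta_neg[OF 2(2)] .
  thus ?thesis by (simp add: 2 complex_nonneg_Reals_iff)
qed

text \<open>On the negative half-line the integrand in \<open>psi_diff\<close> is positive. The
  injectivity identifies the values of different local inverses of \<eta>, which are only known to
  be right inverses.\<close>

lemma eta_inj_neg:
  assumes "x < 0" "y < 0" "eta \<mu> (of_real x) = eta \<mu> (of_real y)"
  shows "x = y"
proof (rule ccontr)
  assume ne: "x \<noteq> y"
  have n: "complex_of_real x \<notin> \<real>\<^sub>\<ge>\<^sub>0" "complex_of_real y \<notin> \<real>\<^sub>\<ge>\<^sub>0"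
    using assms by (simp_all add: complex_nonneg_Reals_iff)
  have "psi \<mu> (of_real x) = psi \<mu> (of_real y)"
    using assms(3) unfolding eta_eq[OF n(1)] eta_eq[OF n(2)] by simp
  hence "(LINT t|\<mu>. of_real t / ((1 - of_real t * complex_of_real x) * (1 - of_real t * complex_of_real y))) = 0"
    using psi_diff[OF n] ne by simp
  also have "(\<lambda>t. of_real t / ((1 - of_real t * complex_of_real x) * (1 - of_real t * complex_of_real y))) =
      (\<lambda>t. complex_of_real (t / ((1 - t * x) * (1 - t * y))))" by simp
  finally have 0: "(LINT t|\<mu>. complex_of_real (t / ((1 - t * x) * (1 - t * y)))) = 0" .
  have "integrable \<mu> (\<lambda>t. Re (of_real t / ((1 - of_real t * complex_of_real x) * (1 - of_real t * complex_of_real y))))"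
    by (rule integrable_Re) (rule integrable_weight_resolvent[OF n])
  also have "(\<lambda>t. Re (of_real t / ((1 - of_real t * complex_of_real x) * (1 - of_real t * complex_of_real y)))) =
      (\<lambda>t. Re (complex_of_real (t / ((1 - t * x) * (1 - t * y)))))" by simp
  finally have "integrable \<mu> (\<lambda>t. t / ((1 - t * x) * (1 - t * y)))" by (simp only: Re_complex_of_real)
  hence "(LINT t|\<mu>. t / ((1 - t * x) * (1 - t * y))) > 0"
  proof (rule integral_pos_weight)
    fix t :: real assume "t > 0"
    hence "t * x < 0" "t * y < 0" using assms by (simp_all add: mult_pos_neg)
    thus "t / ((1 - t * x) * (1 - t * y)) > 0" using \<open>t > 0\<close> by simp
  qed simp
  thus False using 0 by (simp only: integral_complex_of_real) simp
qed

section \<open>Control of the weight near a point that is not an inverse atom\<close>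

lemma exists_ball_small_measure:
  assumes "measure \<mu> {a} = 0" "e > 0" "r > 0"
  obtains d where "d > 0" "d \<le> r" "measure \<mu> (ball a d) < e"
proof -
  have Int: "(\<Inter>n. ball a (1 / real (Suc n))) = {a}"
  proof (intro equalityI subsetI)
    fix s assume s: "s \<in> (\<Inter>n. ball a (1 / real (Suc n)))"
    have "dist a s \<le> 0"
    proof (rule LIMSEQ_le_const)
      show "(\<lambda>n. 1 / real (Suc n)) \<longlonglongrightarrow> 0" by (rule LIMSEQ_Suc) (rule lim_1_over_n)
      show "\<exists>N. \<forall>n\<ge>N. dist a s \<le> 1 / real (Suc n)"
        using s by (intro exI[of _ 0] allI impI) (auto intro: less_imp_le)
    qed
    thus "s \<in> {a}" by simp
  qed auto
  have "(\<lambda>n. measure \<mu> (ball a (1 / real (Suc n)))) \<longlonglongrightarrow> measure \<mu> (\<Inter>n. ball a (1 / real (Suc n)))"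
  proof (rule finite_Lim_measure_decseq)
    show "range (\<lambda>n. ball a (1 / real (Suc n))) \<subseteq> sets \<mu>" by (auto simp: sets_eq)
    show "decseq (\<lambda>n. ball a (1 / real (Suc n)))"
      by (intro decseq_SucI subset_ball) (simp add: frac_le)
  qed
  hence "(\<lambda>n. measure \<mu> (ball a (1 / real (Suc n)))) \<longlonglongrightarrow> 0" unfolding Int assms(1) .
  hence "eventually (\<lambda>n. measure \<mu> (ball a (1 / real (Suc n))) < e) sequentially"
    by (rule order_tendstoD(2)[OF _ assms(2)])
  moreover have "eventually (\<lambda>n. 1 / real (Suc n) < r) sequentially"
    by (rule order_tendstoD(2)[OF LIMSEQ_Suc[OF lim_1_over_n] assms(3)])
  ultimately have "eventually (\<lambda>n. measure \<mu> (ball a (1 / real (Suc n))) < e \<and> 1 / real (Suc n) < r) sequentially"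
    by (rule eventually_conj)
  then obtain n where "measure \<mu> (ball a (1 / real (Suc n))) < e" "1 / real (Suc n) < r"
    using eventually_happens by fastforce
  thus ?thesis by (intro that[of "1 / real (Suc n)"]) auto
qed

text \<open>Near \<open>1/a\<close> the integrand of \<open>\<psi>\<close> is estimated by the weighted arithmetic-geometric mean
  inequality with the parameter that is optimal for the given weight; elsewhere it is bounded.\<close>

lemma psi_sq_le_weight:
  assumes a: "a > 0" and atom: "measure \<mu> {1 / a} = 0" and e: "e > 0"
  obtains \<delta> B where "\<delta> > 0" "B \<ge> 0"
    "\<And>w. Im w > 0 \<Longrightarrow> cmod (w - of_real a) < \<delta> \<Longrightarrow> (cmod (psi \<mu> w))\<^sup>2 \<le> B + e * weight w"
proof -
  define D where "D = (a + 1) / 2 * (2 / a + 1)"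
  have D: "D > 0" using a by (simp add: D_def add_pos_pos)
  \<comment> \<open>Chosen backwards: the last estimate is twice the square of D sqrt (e' (W + 1)),
    which must equal e (W + 1).\<close>
  define e' where "e' = e / (2 * D\<^sup>2)"
  have e': "e' > 0" using e D by (simp add: e'_def)
  obtain d where d: "d > 0" "d \<le> 1 / a" "measure \<mu> (ball (1 / a) d) < e'"
    using exists_ball_small_measure[OF atom e', of "1 / a"] a by auto
  let ?b = "ball (1 / a) d"
  define A where "A = 1 + 1 / (a * d) + 1 / d"
  have A: "A > 0" using a d by (simp add: A_def add_pos_pos)
  define c where "c = a / (2 * A)"
  have c: "c > 0" using a A by (simp add: c_def)
  have off: "2 * c * (1 + s) \<le> cmod (1 - of_real s * of_real a)" if s: "s \<ge> 0" "s \<notin> ?b" for s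
  proof -
    let ?x = "\<bar>s - 1 / a\<bar>"
    have x: "?x \<ge> d" using s by (simp add: dist_real_def abs_minus_commute)
    have x1: "1 \<le> ?x / d" using x d by simp
    have "1 / a \<le> ?x / (a * d)" using mult_left_mono[OF x1, of "1 / a"] a by simp
    hence "1 + s \<le> ?x + ?x / (a * d) + ?x / d" using x1 by linarith
    also have "\<dots> = ?x * A" by (simp add: A_def distrib_left)
    finally have "(a / A) * (1 + s) \<le> (a / A) * (?x * A)" using a A by (intro mult_left_mono) auto
    also have "\<dots> = a * ?x" using A by simp
    also have "\<dots> = \<bar>a * (s - 1 / a)\<bar>" using a by (simp add: abs_mult)
    also have "a * (s - 1 / a) = - (1 - s * a)" using a by (simp add: algebra_simps)
    also have "\<bar>- (1 - s * a)\<bar> = cmod (of_real (1 - s * a))"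
      by (simp only: abs_minus_cancel norm_of_real)
    also have "complex_of_real (1 - s * a) = 1 - of_real s * of_real a" by simp
    finally show ?thesis by (simp add: c_def)
  qed
  define B where "B = (a + 1) / c"
  have B: "B \<ge> 0" using a c by (simp add: B_def)
  show ?thesis
  proof (rule that[of "min c 1" "2 * B\<^sup>2 + e"])
    show "min c 1 > 0" using c by simp
    show "2 * B\<^sup>2 + e \<ge> 0" using e by simp
    fix w :: complex assume w: "Im w > 0" "cmod (w - of_real a) < min c 1"
    have n: "w \<notin> \<real>\<^sub>\<ge>\<^sub>0" using w by (auto simp: complex_nonneg_Reals_iff)
    have wa: "cmod w \<le> a + 1"
      using norm_triangle_ineq[of "w - of_real a" "of_real a"] w(2) a by simp
    define W where "W = weight w"
    have W: "W > 0" unfolding W_def by (rule weight_pos[OF n])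
    define lam where "lam = sqrt ((W + 1) / e')"
    have lam: "lam > 0" using W e' by (simp add: lam_def)
    have off': "cmod (of_real s * w / (1 - of_real s * w)) \<le> B" if s: "s \<ge> 0" "s \<notin> ?b" for s
    proof -
      have "2 * c * (1 + s) \<le> cmod ((1 - of_real s * w) + of_real s * (w - of_real a))"
        using off[OF s] by (simp add: algebra_simps)
      also have "\<dots> \<le> cmod (1 - of_real s * w) + s * cmod (w - of_real a)"
        using norm_triangle_ineq[of "1 - of_real s * w" "of_real s * (w - of_real a)"] s by (simp add: norm_mult)
      also have "s * cmod (w - of_real a) \<le> (1 + s) * c"
        using s w(2) by (intro mult_mono) auto
      finally have lo: "c * (1 + s) \<le> cmod (1 - of_real s * w)" by (simp add: algebra_simps)
      have "cmod (of_real s * w / (1 - of_real s * w)) = s * cmod w / cmod (1 - of_real s * w)"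
        using s by (simp add: norm_divide norm_mult)
      also have "\<dots> \<le> ((1 + s) * (a + 1)) / (c * (1 + s))"
        using s wa lo c a by (intro frac_le mult_mono mult_pos_pos) auto
      also have "\<dots> = B" using s by (simp add: B_def)
      finally show ?thesis .
    qed
    let ?k = "\<lambda>s. s / (cmod (1 - of_real s * w))\<^sup>2"
    have on: "cmod (of_real s * w / (1 - of_real s * w)) \<le>
        (a + 1) / 2 * (lam * (2 / a) + (1 / lam) * ?k s)"
      if s: "s \<ge> 0" "s \<in> ?b" for s
    proof -
      have sa: "s \<le> 2 / a" using s d by (simp add: dist_real_def abs_less_iff)
      let ?x = "1 / cmod (1 - of_real s * w)"
      have "0 \<le> (lam - ?x)\<^sup>2" by simp
      hence "2 * (lam * ?x) \<le> lam\<^sup>2 + ?x\<^sup>2" by (simp add: power2_diff)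
      hence "2 * (lam * ?x) / lam \<le> (lam\<^sup>2 + ?x\<^sup>2) / lam" using lam by (intro divide_right_mono) auto
      hence "2 * ?x \<le> lam + (1 / lam) * ?x\<^sup>2"
        using lam by (simp add: add_divide_distrib power2_eq_square mult_ac)
      hence "s * (2 * ?x) \<le> s * (lam + (1 / lam) * ?x\<^sup>2)" using s by (intro mult_left_mono)
      also have "\<dots> = lam * s + (1 / lam) * ?k s"
        by (simp add: distrib_left power_divide)
      also have "lam * s \<le> lam * (2 / a)" using sa lam by (intro mult_left_mono) auto
      finally have 1: "s * (2 * ?x) \<le> lam * (2 / a) + (1 / lam) * ?k s" by simp
      have "cmod (of_real s * w / (1 - of_real s * w)) = cmod w / 2 * (s * (2 * ?x))"
        using s by (simp add: norm_divide norm_mult)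
      also have "\<dots> \<le> (a + 1) / 2 * (lam * (2 / a) + (1 / lam) * ?k s)"
        using wa s a by (intro mult_mono 1) auto
      finally show ?thesis .
    qed
    let ?G = "\<lambda>s. B + (a + 1) / 2 * (lam * (2 / a) * indicator ?b s + (1 / lam) * ?k s)"
    have intb: "integrable \<mu> (indicator ?b :: real \<Rightarrow> real)"
      by (simp add: integrable_indicator_iff sets_eq emeasure_eq_measure)
    have intG: "integrable \<mu> ?G"
      by (intro Bochner_Integration.integrable_add integrable_mult_right integrable_const intb integrable_weight[OF n])
    have "cmod (psi \<mu> w) \<le> (LINT s|\<mu>. cmod (of_real s * w / (1 - of_real s * w)))"
      unfolding psi_eq by (rule integral_norm_bound)
    also have "\<dots> \<le> (LINT s|\<mu>. ?G s)"
    proof (rule integral_mono_AE[OF integrable_norm[OF integrable_resolvent[OF n]] intG])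
      show "AE s in \<mu>. cmod (of_real s * w / (1 - of_real s * w)) \<le> ?G s"
        using AE_nonneg
      proof eventually_elim
        case (elim s)
        have p: "0 \<le> (1 / lam) * ?k s" using elim lam by simp
        show ?case
        proof (cases "s \<in> ?b")
          case True
          hence i: "indicator ?b s = (1 :: real)" by simp
          show ?thesis unfolding i mult_1_right using on[OF elim True] B by (rule order_trans[OF _ le_add_same_cancel2[THEN iffD2]])
        next
          case False
          have "0 \<le> (a + 1) / 2 * ((1 / lam) * ?k s)"
            using a by (intro mult_nonneg_nonneg[OF _ p]) simp
          thus ?thesis using off'[OF elim False] False by simp
        qed
      qed
    qed
    also have "\<dots> = B + (a + 1) / 2 * (lam * (2 / a) * measure \<mu> ?b + (1 / lam) * W)"
    proof -
      have "(LINT s|\<mu>. ?G s) = (LINT s|\<mu>. B) + (LINT s|\<mu>. (a + 1) / 2 * (lam * (2 / a) * indicator ?b s + (1 / lam) * ?k s))"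
        by (intro Bochner_Integration.integral_add Bochner_Integration.integrable_add integrable_mult_right integrable_const intb integrable_weight[OF n])
      also have "(LINT s|\<mu>. (a + 1) / 2 * (lam * (2 / a) * indicator ?b s + (1 / lam) * ?k s)) =
          (a + 1) / 2 * (LINT s|\<mu>. lam * (2 / a) * indicator ?b s + (1 / lam) * ?k s)"
        by (rule integral_mult_right_zero)
      also have "(LINT s|\<mu>. lam * (2 / a) * indicator ?b s + (1 / lam) * ?k s) =
          (LINT s|\<mu>. lam * (2 / a) * indicator ?b s) + (LINT s|\<mu>. (1 / lam) * ?k s)"
        by (intro Bochner_Integration.integral_add integrable_mult_right intb integrable_weight[OF n])
      also have "(LINT s|\<mu>. lam * (2 / a) * indicator ?b s) = lam * (2 / a) * measure \<mu> ?b"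
        using sets_eq by simp
      also have "(LINT s|\<mu>. (1 / lam) * ?k s) = (1 / lam) * W"
        unfolding W_def weight_def by (rule integral_mult_right_zero)
      finally show ?thesis by (simp add: prob_space)
    qed
    also have "\<dots> \<le> B + (a + 1) / 2 * ((2 / a) * sqrt (e' * (W + 1)) + sqrt (e' * (W + 1)))"
    proof (intro add_left_mono mult_left_mono add_mono)
      have le: "lam * e' = sqrt (e' * (W + 1))"
      proof -
        have "lam * e' = sqrt ((W + 1) / e') * sqrt (e' * e')" using e' by (simp add: lam_def)
        also have "\<dots> = sqrt ((W + 1) / e' * (e' * e'))" by (rule real_sqrt_mult[symmetric])
        also have "(W + 1) / e' * (e' * e') = e' * (W + 1)" using e' by simp
        finally show ?thesis .
      qed
      have "lam * (2 / a) * measure \<mu> ?b \<le> lam * (2 / a) * e'"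
        using lam a d by (intro mult_left_mono) auto
      also have "\<dots> = (2 / a) * (lam * e')" by simp
      finally show "lam * (2 / a) * measure \<mu> ?b \<le> (2 / a) * sqrt (e' * (W + 1))" unfolding le .
      have "(1 / lam) * W \<le> (1 / lam) * (W + 1)" using lam by (intro mult_left_mono) auto
      also have "W + 1 = lam * (lam * e')"
      proof -
        have "lam * lam = (W + 1) / e'" using W e' by (simp add: lam_def)
        hence "lam * lam * e' = W + 1" using e' by simp
        thus ?thesis by (simp only: mult.assoc)
      qed
      also have "(1 / lam) * (lam * (lam * e')) = lam * e'" using lam by simp
      finally show "(1 / lam) * W \<le> sqrt (e' * (W + 1))" unfolding le .
    qed (use a in simp)
    also have "\<dots> = B + D * sqrt (e' * (W + 1))"
      by (simp only: D_def distrib_right mult_1_left mult.assoc)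
    finally have psi: "cmod (psi \<mu> w) \<le> B + D * sqrt (e' * (W + 1))" .
    have "(cmod (psi \<mu> w))\<^sup>2 \<le> (B + D * sqrt (e' * (W + 1)))\<^sup>2"
      by (rule power_mono[OF psi]) simp
    also have "\<dots> \<le> 2 * B\<^sup>2 + 2 * (D * sqrt (e' * (W + 1)))\<^sup>2"
    proof -
      have "0 \<le> (B - D * sqrt (e' * (W + 1)))\<^sup>2" by simp
      thus ?thesis by (simp add: power2_sum power2_diff)
    qed
    also have "(D * sqrt (e' * (W + 1)))\<^sup>2 = D\<^sup>2 * (e' * (W + 1))"
      using e' W by (simp add: power_mult_distrib)
    also have "2 * (D\<^sup>2 * (e' * (W + 1))) = e * (W + 1)" using D by (simp add: e'_def)
    finally show "(cmod (psi \<mu> w))\<^sup>2 \<le> 2 * B\<^sup>2 + e + e * weight w"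
      by (simp add: W_def algebra_simps)
  qed
qed

text \<open>Absorption: |1 + \<psi>|^2 + |\<psi>|^2 \<le> 2 + 3 |\<psi>|^2, and without an atom
  |\<psi>|^2 costs only a small multiple e of the weight. With e = 1/(6 K) the weight returns with
  factor 3 K e = 1/2 and is moved to the left.\<close>

lemma weight_bounded_near:
  assumes a: "a > 0" and atom: "measure \<mu> {1 / a} = 0" and K: "K > 0"
  obtains \<delta> B where "\<delta> > 0" "B > 0"
    "\<And>w. Im w > 0 \<Longrightarrow> cmod (w - of_real a) < \<delta> \<Longrightarrow>
       weight w \<le> K * ((cmod (1 + psi \<mu> w))\<^sup>2 + (cmod (psi \<mu> w))\<^sup>2) \<Longrightarrow> weight w \<le> B"
proof -
  define e where "e = 1 / (6 * K)"
  have e: "e > 0" using K by (simp add: e_def)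
  obtain \<delta> B where d: "\<delta> > 0" "B \<ge> 0"
    "\<And>w. Im w > 0 \<Longrightarrow> cmod (w - of_real a) < \<delta> \<Longrightarrow> (cmod (psi \<mu> w))\<^sup>2 \<le> B + e * weight w"
    using psi_sq_le_weight[OF a atom e] by blast
  show ?thesis
  proof (rule that[OF d(1)])
    show "2 * K * (2 + 3 * B) > 0" using K d(2) by simp
    fix w assume w: "Im w > 0" "cmod (w - of_real a) < \<delta>"
      and le: "weight w \<le> K * ((cmod (1 + psi \<mu> w))\<^sup>2 + (cmod (psi \<mu> w))\<^sup>2)"
    let ?p = "cmod (psi \<mu> w)"
    have "(cmod (1 + psi \<mu> w))\<^sup>2 \<le> (1 + ?p)\<^sup>2"
      using norm_triangle_ineq[of 1 "psi \<mu> w"] by (intro power_mono) auto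
    also have "\<dots> \<le> 2 + 2 * ?p\<^sup>2"
    proof -
      have "0 \<le> (1 - ?p)\<^sup>2" by simp
      thus ?thesis by (simp add: power2_sum power2_diff)
    qed
    finally have "(cmod (1 + psi \<mu> w))\<^sup>2 + ?p\<^sup>2 \<le> 2 + 3 * ?p\<^sup>2" by simp
    also have "\<dots> \<le> 2 + 3 * (B + e * weight w)"
      using d(3)[OF w] by (intro add_left_mono mult_left_mono) auto
    finally have "(cmod (1 + psi \<mu> w))\<^sup>2 + ?p\<^sup>2 \<le> 2 + 3 * (B + e * weight w)" .
    hence "K * ((cmod (1 + psi \<mu> w))\<^sup>2 + ?p\<^sup>2) \<le> K * (2 + 3 * (B + e * weight w))"
      using K by (intro mult_left_mono) auto
    also have "\<dots> = K * (2 + 3 * B) + weight w / 2"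
      using K by (simp add: e_def field_simps)
    finally show "weight w \<le> 2 * K * (2 + 3 * B)" using le by linarith
  qed
qed

end

section \<open>The exponent of \<open>Phi\<close>\<close>

locale levy_measure = finite_measure \<sigma> for \<sigma> :: "ennreal measure" +
  assumes sets_sigma: "sets \<sigma> = sets borel"
begin

definition u :: "complex \<Rightarrow> complex" where
  "u z = (LINT t|\<sigma>. levy_kernel z t)"

lemma levy_kernel_measurable: "levy_kernel z \<in> borel_measurable \<sigma>"
  unfolding measurable_cong_sets[OF sets_sigma refl] levy_kernel_def[abs_def] by measurable

lemma levy_kernel_bound:
  assumes k: "k > 0" "\<And>t. t \<ge> 0 \<Longrightarrow> k * (1 + t) \<le> cmod (z - of_real t)"
  shows "cmod (levy_kernel z t) \<le> (1 + cmod z) / k + cmod z"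
proof (cases "t = \<infinity>")
  case True
  thus ?thesis using k(1) by (simp add: levy_kernel_def)
next
  case False
  define s where "s = enn2real t"
  have s: "s \<ge> 0" by (simp add: s_def)
  have ks: "k * (1 + s) > 0" using s k(1) by simp
  have "cmod (levy_kernel z t) = cmod (1 + of_real s * z) / cmod (z - of_real s)"
    using False by (simp add: levy_kernel_def s_def norm_divide)
  also have "\<dots> \<le> ((1 + s) * (1 + cmod z)) / (k * (1 + s))"
  proof (rule frac_le)
    have "cmod (1 + of_real s * z) \<le> 1 + s * cmod z"
      using norm_triangle_ineq[of 1 "of_real s * z"] s by (simp add: norm_mult)
    also have "\<dots> \<le> (1 + s) * (1 + cmod z)" using s by (simp add: distrib_left distrib_right)
    finally show "cmod (1 + of_real s * z) \<le> (1 + s) * (1 + cmod z)" .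
  qed (use ks k(2)[OF s] s in auto)
  also have "\<dots> = (1 + cmod z) / k" using s by simp
  also have "\<dots> \<le> (1 + cmod z) / k + cmod z" by simp
  finally show ?thesis .
qed

lemma integrable_levy_kernel:
  assumes "z \<notin> \<real>\<^sub>\<ge>\<^sub>0"
  shows "integrable \<sigma> (levy_kernel z)"
proof -
  obtain k where k: "k > 0" "\<And>t. t \<ge> 0 \<Longrightarrow> k * (1 + t) \<le> cmod (1 - of_real t * z)"
    "\<And>t. t \<ge> 0 \<Longrightarrow> k * (1 + t) \<le> cmod (z - of_real t)"
    using resolvent_lower_bound[OF assms] by blast
  show ?thesis
    by (rule integrable_const_bound[OF AE_I2 levy_kernel_measurable])
       (rule levy_kernel_bound[OF k(1,3)])
qed

lemma u_field_differentiable: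
  assumes "z0 \<notin> \<real>\<^sub>\<ge>\<^sub>0"
  shows "u field_differentiable (at z0)"
proof -
  obtain k where k: "k > 0"
    "\<And>z t. z \<in> ball z0 k \<Longrightarrow> t \<ge> 0 \<Longrightarrow> k * (1 + t) \<le> cmod (1 - of_real t * z)"
    "\<And>z t. z \<in> ball z0 k \<Longrightarrow> t \<ge> 0 \<Longrightarrow> k * (1 + t) \<le> cmod (z - of_real t)"
    using resolvent_lower_bound_near[OF assms] by blast
  have z0: "z0 \<in> ball z0 k" using k(1) by simp
  \<comment> \<open>The exact difference quotient of the kernel between z and z0, with its limit -1
    at t = \<infinity>. The factor 1 + t^2 is matched by the two denominators, so it is bounded
    uniformly in t.\<close>
  define g where "g z t = (if t = \<infinity> then - 1 else
      - (1 + of_real ((enn2real t)\<^sup>2)) / ((z - of_real (enn2real t)) * (z0 - of_real (enn2real t))))" for z t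
  have nz: "z - of_real t \<noteq> 0" if "z \<in> ball z0 k" "t \<ge> 0" for z t
  proof -
    have "k * (1 + t) > 0" using that k(1) by simp
    thus ?thesis using k(3)[OF that] by auto
  qed
  have "((\<lambda>z. LINT t|\<sigma>. levy_kernel z t) has_field_derivative (LINT t|\<sigma>. g z0 t)) (at z0)"
  proof (rule has_field_derivative_integral_kernel[OF finite_measure_axioms k(1), where g = g and B = "1 / (k * k) + 1"])
    fix z assume z: "z \<in> ball z0 k"
    show "integrable \<sigma> (levy_kernel z)"
      by (rule integrable_const_bound[OF AE_I2 levy_kernel_measurable])
         (rule levy_kernel_bound[OF k(1) k(3)[OF z]])
    show "AE t in \<sigma>. levy_kernel z t - levy_kernel z0 t = (z - z0) * g z t"
    proof (rule AE_I2)
      fix t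
      show "levy_kernel z t - levy_kernel z0 t = (z - z0) * g z t"
      proof (cases "t = \<infinity>")
        case False
        define s where "s = complex_of_real (enn2real t)"
        have n: "z - s \<noteq> 0" "z0 - s \<noteq> 0" using nz[OF z] nz[OF z0] by (auto simp: s_def)
        have "levy_kernel z t - levy_kernel z0 t = (1 + s * z) / (z - s) - (1 + s * z0) / (z0 - s)"
          using False by (simp add: levy_kernel_def s_def)
        also have "\<dots> = ((1 + s * z) * (z0 - s) - (1 + s * z0) * (z - s)) / ((z - s) * (z0 - s))"
          by (rule diff_frac_eq[OF n])
        also have "(1 + s * z) * (z0 - s) - (1 + s * z0) * (z - s) = (z - z0) * - (1 + s\<^sup>2)"
          by (simp add: algebra_simps power2_eq_square)
        finally show ?thesis using False by (simp add: g_def s_def)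
      qed (simp add: levy_kernel_def g_def)
    qed
    show "g z \<in> borel_measurable \<sigma>"
      unfolding measurable_cong_sets[OF sets_sigma refl] g_def[abs_def] by measurable
    show "AE t in \<sigma>. cmod (g z t) \<le> 1 / (k * k) + 1"
    proof (rule AE_I2)
      fix t
      show "cmod (g z t) \<le> 1 / (k * k) + 1"
      proof (cases "t = \<infinity>")
        case False
        define s where "s = enn2real t"
        have s: "s \<ge> 0" by (simp add: s_def)
        have ks: "k * (1 + s) > 0" using k(1) s by simp
        have "cmod (g z t) = cmod (1 + of_real (s\<^sup>2)) / (cmod (z - of_real s) * cmod (z0 - of_real s))"
          using False unfolding g_def s_def[symmetric] by (simp only: if_False norm_divide norm_mult norm_minus_cancel)
        also have "cmod (1 + of_real (s\<^sup>2)) = 1 + s\<^sup>2"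
          by (metis abs_of_nonneg add_nonneg_nonneg norm_of_real of_real_1 of_real_add zero_le_one zero_le_power2)
        also have "(1 + s\<^sup>2) / (cmod (z - of_real s) * cmod (z0 - of_real s)) \<le>
            ((1 + s) * (1 + s)) / ((k * (1 + s)) * (k * (1 + s)))"
        proof (rule frac_le)
          show "k * (1 + s) * (k * (1 + s)) \<le> cmod (z - of_real s) * cmod (z0 - of_real s)"
            using k(3)[OF z s] k(3)[OF z0 s] ks by (intro mult_mono) auto
          show "1 + s\<^sup>2 \<le> (1 + s) * (1 + s)" using s by (simp add: power2_eq_square distrib_left distrib_right)
          show "0 < k * (1 + s) * (k * (1 + s))" using ks by simp
        qed (use s in simp)
        also have "\<dots> = 1 / (k * k)" using s k(1) by simp
        also have "\<dots> \<le> 1 / (k * k) + 1" by simp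
        finally show ?thesis .
      qed (simp add: g_def)
    qed
  next
    show "AE t in \<sigma>. isCont (\<lambda>z. g z t) z0"
    proof (rule AE_I2)
      fix t
      show "isCont (\<lambda>z. g z t) z0"
      proof (cases "t = \<infinity>")
        case False
        thus ?thesis using nz[OF z0, of "enn2real t"] unfolding g_def
          by (simp only: if_False) (intro continuous_intros, auto)
      qed (simp add: g_def)
    qed
  qed
  thus ?thesis unfolding field_differentiable_def u_def[abs_def] by blast
qed

lemma u_holomorphic: "u holomorphic_on - \<real>\<^sub>\<ge>\<^sub>0"
  by (rule holomorphic_onI) (use u_field_differentiable field_differentiable_at_within in blast)

text \<open>For finite t the imaginary part is -Im z (1 + t^2) / |z - t|^2, and |z - t|^2 \<le> 2 (1
  + |z|^2) (1 + t^2). The bound is independent of t, so integrating it brings in only the total mass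
  of \<sigma>; it later bounds Im N from below.\<close>

lemma Im_levy_kernel:
  assumes "Im z > 0"
  shows "Im (levy_kernel z t) \<le> - (Im z / (2 * (1 + (cmod z)\<^sup>2)))"
proof (cases "t = \<infinity>")
  case True
  have "Im z / (2 * (1 + (cmod z)\<^sup>2)) \<le> Im z / 1"
    using assms by (intro divide_left_mono) (auto intro!: mult_pos_pos add_pos_nonneg)
  thus ?thesis using True by (simp add: levy_kernel_def)
next
  case False
  define s where "s = enn2real t"
  have s: "s \<ge> 0" by (simp add: s_def)
  have ns: "z - of_real s \<noteq> 0" using assms by (auto simp: complex_eq_iff)
  have "Im (levy_kernel z t) = Im ((1 + of_real s * z) * cnj (z - of_real s)) / (cmod (z - of_real s))\<^sup>2"
    using False unfolding levy_kernel_def s_def[symmetric]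
    by (simp only: if_False complex_div_cnj[of _ "z - of_real s"] Im_divide_of_real)
  also have "Im ((1 + of_real s * z) * cnj (z - of_real s)) = - (Im z * (1 + s\<^sup>2))"
    by (simp add: algebra_simps power2_eq_square)
  finally have 1: "Im (levy_kernel z t) = - (Im z * ((1 + s\<^sup>2) / (cmod (z - of_real s))\<^sup>2))" by simp
  have "(cmod (z - of_real s))\<^sup>2 \<le> (cmod z + s)\<^sup>2"
    using norm_triangle_ineq4[of z "of_real s"] s by (intro power_mono) auto
  also have "\<dots> \<le> 2 * ((cmod z)\<^sup>2 + s\<^sup>2)"
  proof -
    have "0 \<le> (cmod z - s)\<^sup>2" by simp
    thus ?thesis by (simp add: power2_sum power2_diff)
  qed
  also have "\<dots> \<le> (2 * (1 + (cmod z)\<^sup>2)) * (1 + s\<^sup>2)"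
    by (simp add: distrib_left distrib_right)
  finally have "1 / (2 * (1 + (cmod z)\<^sup>2)) \<le> (1 + s\<^sup>2) / (cmod (z - of_real s))\<^sup>2"
    using ns by (simp add: divide_le_eq le_divide_eq add_pos_nonneg mult.commute)
  hence "Im z * (1 / (2 * (1 + (cmod z)\<^sup>2))) \<le> Im z * ((1 + s\<^sup>2) / (cmod (z - of_real s))\<^sup>2)"
    using assms by (intro mult_left_mono) auto
  thus ?thesis unfolding 1 by simp
qed

lemma Im_u:
  assumes "Im z > 0"
  shows "Im (u z) \<le> - (measure \<sigma> (space \<sigma>) * (Im z / (2 * (1 + (cmod z)\<^sup>2))))"
proof -
  have n: "z \<notin> \<real>\<^sub>\<ge>\<^sub>0" using assms by (auto simp: complex_nonneg_Reals_iff)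
  have "Im (u z) = (LINT t|\<sigma>. Im (levy_kernel z t))"
    unfolding u_def by (rule integral_Im[symmetric]) (rule integrable_levy_kernel[OF n])
  also have "\<dots> \<le> (LINT t|\<sigma>. - (Im z / (2 * (1 + (cmod z)\<^sup>2))))"
    by (intro integral_mono integrable_Im integrable_levy_kernel n Im_levy_kernel assms) simp
  finally show ?thesis by simp
qed

lemma Im_u_neg:
  assumes "x < 0"
  shows "Im (u (of_real x)) = 0"
proof -
  have n: "complex_of_real x \<notin> \<real>\<^sub>\<ge>\<^sub>0" using assms by (simp add: complex_nonneg_Reals_iff)
  have "Im (levy_kernel (of_real x) t) = 0" for t
    by (cases "t = \<infinity>") (simp_all add: levy_kernel_def Im_divide)
  moreover have "Im (u (of_real x)) = (LINT t|\<sigma>. Im (levy_kernel (of_real x) t))"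
    unfolding u_def by (rule integral_Im[symmetric]) (rule integrable_levy_kernel[OF n])
  ultimately show ?thesis by simp
qed

end

section \<open>Boundary behaviour of the subordination function\<close>

text \<open>The branch of the logarithm with imaginary part in \<open>(-\<pi>/2, 3\<pi>/2)\<close>, continuous on the closed upper
  half-plane without the origin.\<close>

definition lg :: "complex \<Rightarrow> complex" where
  "lg w = Ln (- \<i> * w) + \<i> * of_real (pi / 2)"

lemma exp_lg: "w \<noteq> 0 \<Longrightarrow> exp (lg w) = w"
proof -
  assume "w \<noteq> 0"
  hence "exp (lg w) = - \<i> * w * exp (\<i> * of_real (pi / 2))"
    unfolding lg_def exp_add by (subst exp_Ln) auto
  also have "exp (\<i> * of_real (pi / 2)) = \<i>" unfolding cis_conv_exp[symmetric] by simp
  also have "- \<i> * w * \<i> = w" by (simp add: complex_eq_iff)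
  finally show ?thesis .
qed

lemma Im_lg: "Im w > 0 \<Longrightarrow> 0 < Im (lg w) \<and> Im (lg w) < pi"
proof -
  assume w: "Im w > 0"
  have "\<bar>Im (Ln (- \<i> * w))\<bar> < pi / 2"
    using Re_Ln_pos_lt[of "- \<i> * w"] w by fastforce
  hence "- (pi / 2) < Im (Ln (- \<i> * w))" "Im (Ln (- \<i> * w)) < pi / 2" by linarith+
  moreover have "Im (lg w) = Im (Ln (- \<i> * w)) + pi / 2" by (simp add: lg_def)
  ultimately show ?thesis by linarith
qed

lemma isCont_lg: "w \<noteq> 0 \<Longrightarrow> Im w \<ge> 0 \<Longrightarrow> isCont lg w"
  unfolding lg_def[abs_def]
  by (intro continuous_intros) (auto simp: complex_nonpos_Reals_iff complex_eq_iff)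

lemma lg_neg:
  assumes "a > 0"
  shows "Im (lg (- of_real a)) = pi"
proof -
  have "Ln (\<i> * of_real a) = Complex (ln a) (pi / 2)"
    by (rule Ln_unique) (use assms in \<open>auto simp: complex_eq_iff Re_exp Im_exp\<close>)
  thus ?thesis by (simp add: lg_def)
qed

text \<open>The analytic content separated from the measures: a Pick function N, a map \<omega> and
  the functional equation \<gamma> \<omega> exp (-N \<circ> \<omega>) = id. Boundary values of
  \<omega> are derived from these data alone.\<close>

locale subordination = herglotz_kernel \<nu> C S for \<nu> C S +
  fixes N \<omega> :: "complex \<Rightarrow> complex" and \<gamma> c :: real
  assumes gamma_pos: "\<gamma> > 0"
    and N_hol: "N holomorphic_on - \<real>\<^sub>\<ge>\<^sub>0"
    and N_real: "x < 0 \<Longrightarrow> Im (N (of_real x)) = 0"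
    and N_upper: "Im w > 0 \<Longrightarrow> Im (N w) > 0"
    and N_rep: "Im w > 0 \<Longrightarrow> N w = of_real c + V w"
    and omega_cont: "continuous_on (- \<real>\<^sub>\<ge>\<^sub>0) \<omega>"
    and omega_upper: "Im z > 0 \<Longrightarrow> Im (\<omega> z) > 0"
    and omega_neg: "x < 0 \<Longrightarrow> \<exists>a>0. \<omega> (of_real x) = - of_real a"
    and omega_eq: "z \<notin> \<real>\<^sub>\<ge>\<^sub>0 \<Longrightarrow> of_real \<gamma> * \<omega> z * exp (- N (\<omega> z)) = z"
begin

definition v :: "complex \<Rightarrow> complex" where
  "v z = lg (\<omega> z)"

lemma upper_notin: "Im z > 0 \<Longrightarrow> z \<notin> \<real>\<^sub>\<ge>\<^sub>0"
  by (auto simp: complex_nonneg_Reals_iff)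

lemma open_slit: "open (- \<real>\<^sub>\<ge>\<^sub>0 :: complex set)"
  using closed_nonneg_Reals_complex by (simp add: open_Compl)

lemma isCont_omega: "z \<notin> \<real>\<^sub>\<ge>\<^sub>0 \<Longrightarrow> isCont \<omega> z"
  using omega_cont open_slit by (simp add: continuous_on_eq_continuous_at)

lemma isCont_N: "z \<notin> \<real>\<^sub>\<ge>\<^sub>0 \<Longrightarrow> isCont N z"
  using holomorphic_on_imp_continuous_on[OF N_hol] open_slit by (simp add: continuous_on_eq_continuous_at)

lemma v_strip: "Im z > 0 \<Longrightarrow> 0 < Im (v z)" "Im z > 0 \<Longrightarrow> Im (v z) < pi"
  using Im_lg[OF omega_upper] by (auto simp: v_def)

lemma exp_v: "Im z > 0 \<Longrightarrow> exp (v z) = \<omega> z"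
  unfolding v_def using omega_upper[of z] by (intro exp_lg) auto

lemma isCont_v: "Im z > 0 \<Longrightarrow> isCont v z"
  unfolding v_def[abs_def]
  by (rule isCont_o2[OF isCont_omega isCont_lg])
     (use omega_upper[of z] in \<open>auto simp: complex_nonneg_Reals_iff\<close>)

text \<open>Both sides have the exponential z, so only the branch is at issue. The imaginary part of
  the right side never vanishes on the connected upper half-plane, is positive near -1, and is below
  \<pi> because Im N is positive; hence it is the principal one.\<close>

lemma Ln_eq:
  assumes z: "Im z > 0"
  shows "Ln z = of_real (ln \<gamma>) + v z - N (\<omega> z)"
proof -
  define E where "E z = of_real (ln \<gamma>) + lg (\<omega> z) - N (\<omega> z)" for z
  have expE: "exp (E z) = z" if "Im z > 0" for z
  proof -
    have "exp (E z) = of_real \<gamma> * exp (v z) * exp (- N (\<omega> z))"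
      unfolding E_def v_def diff_conv_add_uminus exp_add using gamma_pos by (simp add: exp_of_real)
    thus ?thesis using omega_eq[OF upper_notin[OF that]] exp_v[OF that] by simp
  qed
  have ImE_nz: "Im (E z) \<noteq> 0" if "Im z > 0" for z
  proof
    assume "Im (E z) = 0"
    hence "Im (exp (E z)) = 0" by (simp add: Im_exp)
    thus False using expE[OF that] that by simp
  qed
  have Econt: "isCont E z" if "\<omega> z \<noteq> 0" "Im (\<omega> z) \<ge> 0" "z \<notin> \<real>\<^sub>\<ge>\<^sub>0" "\<omega> z \<notin> \<real>\<^sub>\<ge>\<^sub>0" for z
    unfolding E_def[abs_def]
    by (intro continuous_intros isCont_o2[OF isCont_omega isCont_lg] isCont_o2[OF isCont_omega isCont_N] that)
  have cH: "continuous_on {z. Im z > 0} (\<lambda>z. Im (E z))"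
  proof (intro continuous_on_Im continuous_at_imp_continuous_on ballI)
    fix z assume "z \<in> {z. Im z > 0}"
    thus "isCont E z"
      using omega_upper[of z] by (intro Econt) (auto simp: complex_nonneg_Reals_iff)
  qed
  have conn: "connected ((\<lambda>z. Im (E z)) ` {z. Im z > 0})"
    by (intro connected_continuous_image cH convex_connected convex_halfspace_Im_gt)
  obtain a where a: "a > 0" "\<omega> (of_real (- 1)) = - of_real a" using omega_neg[of "- 1"] by auto
  have m1: "complex_of_real (- 1) \<notin> \<real>\<^sub>\<ge>\<^sub>0" "- complex_of_real a \<notin> \<real>\<^sub>\<ge>\<^sub>0"
    using a by (auto simp: complex_nonneg_Reals_iff)
  have "isCont E (of_real (- 1))"
    by (rule Econt) (use a m1 in auto)
  moreover have "(\<lambda>n. Complex (- 1) (1 / real (Suc n))) \<longlonglongrightarrow> Complex (- 1) 0"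
    by (intro tendsto_Complex tendsto_const LIMSEQ_Suc lim_1_over_n)
  moreover have "Complex (- 1) 0 = of_real (- 1)" by (simp add: complex_eq_iff)
  ultimately have "(\<lambda>n. E (Complex (- 1) (1 / real (Suc n)))) \<longlonglongrightarrow> E (of_real (- 1))"
    by (auto intro: isCont_tendsto_compose)
  hence "(\<lambda>n. Im (E (Complex (- 1) (1 / real (Suc n))))) \<longlonglongrightarrow> Im (E (of_real (- 1)))"
    by (rule tendsto_Im)
  \<comment> \<open>At a negative point N is real and \<open>lg\<close> contributes the argument
    \<pi>, which fixes the sign on the whole half-plane.\<close>
  moreover have "Im (E (of_real (- 1))) = pi"
    using lg_neg[OF a(1)] N_real[of "- a"] a by (simp add: E_def)
  ultimately have "eventually (\<lambda>n. 0 < Im (E (Complex (- 1) (1 / real (Suc n))))) sequentially"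
    using order_tendstoD(1)[of _ pi sequentially 0] by simp
  then obtain n where n: "0 < Im (E (Complex (- 1) (1 / real (Suc n))))"
    using eventually_happens by fastforce
  have pos: "Im (E z) > 0" if z: "Im z > 0" for z
  proof (rule ccontr)
    assume "\<not> Im (E z) > 0"
    hence neg: "Im (E z) \<le> 0" by simp
    have "{Im (E z)..Im (E (Complex (- 1) (1 / real (Suc n))))} \<subseteq> (\<lambda>z. Im (E z)) ` {z. Im z > 0}"
      by (rule connected_contains_Icc[OF conn]) (use z in auto)
    hence "0 \<in> (\<lambda>z. Im (E z)) ` {z. Im z > 0}" using neg n by auto
    thus False using ImE_nz by auto
  qed
  have "Im (E z) < pi"
    using Im_lg[OF omega_upper[OF z]] N_upper[OF omega_upper[OF z]] by (simp add: E_def)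
  hence "Ln z = E z"
    using pos[OF z] by (intro Ln_unique expE z) auto
  thus ?thesis by (simp add: E_def v_def)
qed

lemma Ln_eq_V:
  assumes "Im z > 0"
  shows "Ln z = of_real (ln \<gamma> - c) + (v z - V (exp (v z)))"
  using Ln_eq[OF assms] N_rep[OF omega_upper[OF assms]] exp_v[OF assms] by simp

text \<open>The imaginary part of \<open>Ln_eq_V\<close>, where Im (Ln z) is positive: this places
  the values of \<open>v\<close> in the region required by \<open>two_point_estimate\<close> and
  \<open>Re_V_bounds\<close>.\<close>

lemma Im_V_le:
  assumes "Im z > 0"
  shows "Im (V (exp (v z))) \<le> Im (v z)"
proof -
  have "0 < Im (Ln z)" using Im_Ln_pos_lt[of z] assms by (cases "z = 0") auto
  thus ?thesis using arg_cong[OF Ln_eq_V[OF assms], of Im] by simp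
qed

lemma two_point:
  assumes "Im z > 0" "Im w > 0" "cmod (v z - cnj (v w)) \<le> 1 / 1000"
  shows "cmod (Ln z - Ln w) \<ge> cmod (v z - v w) ^ 3 / 100"
proof -
  have "Ln z - Ln w = (v z - V (exp (v z))) - (v w - V (exp (v w)))"
    unfolding Ln_eq_V[OF assms(1)] Ln_eq_V[OF assms(2)] by simp
  thus ?thesis
    using two_point_estimate[OF v_strip[OF assms(1)] Im_V_le[OF assms(1)] v_strip[OF assms(2)] Im_V_le[OF assms(2)] assms(3)]
    by simp
qed

lemma Re_v_bound:
  assumes z: "Im z > 0"
  shows "\<bar>Re (v z)\<bar> \<le> \<bar>ln (cmod z)\<bar> + \<bar>ln \<gamma> - c\<bar> + measure \<nu> (space \<nu>) + 8"
proof -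
  have nz: "z \<noteq> 0" using z by auto
  have "ln (cmod z) = ln \<gamma> - c + Re (v z) - Re (V (exp (v z)))"
    using arg_cong[OF Ln_eq_V[OF z], of Re] nz by simp
  moreover note Re_V_bounds[OF v_strip[OF z] Im_V_le[OF z]]
  ultimately show ?thesis
    using measure_nonneg[of \<nu> "space \<nu>"] by (cases "Re (v z) \<le> 0") linarith+
qed

definition approach :: "real \<Rightarrow> nat \<Rightarrow> complex" where
  "approach x n = Complex x (1 / real (Suc n))"

lemma Im_approach: "Im (approach x n) > 0"
  by (simp add: approach_def)

lemma approach_tendsto: "approach x \<longlonglongrightarrow> of_real x"
proof -
  have "(\<lambda>n. Complex x (1 / real (Suc n))) \<longlonglongrightarrow> Complex x 0"
    by (intro tendsto_Complex tendsto_const LIMSEQ_Suc lim_1_over_n)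
  thus ?thesis by (simp add: approach_def[abs_def] complex_of_real_def)
qed

lemma approach_filterlim: "filterlim (approach x) (at (of_real x) within {z. Im z > 0}) sequentially"
  unfolding filterlim_at
  by (auto intro!: approach_tendsto always_eventually simp: Im_approach) (auto simp: approach_def complex_eq_iff)

lemma Ln_cont_pos: "x > 0 \<Longrightarrow> isCont Ln (of_real x)"
  by (intro continuous_intros) (auto simp: complex_nonpos_Reals_iff)

text \<open>Boundedness of \<open>v\<close> along the vertical approach comes from
  \<open>Re_v_bound\<close> and the strip, so a limit point exists by compactness; what needs an
  argument is that it avoids the upper edge Im = \<pi>.\<close>

lemma cluster_point:
  assumes x: "x > 0"
  obtains \<zeta> s where "strict_mono s" "(\<lambda>n. v (approach x (s n))) \<longlonglongrightarrow> \<zeta>" "0 \<le> Im \<zeta>" "Im \<zeta> < pi"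
proof -
  let ?z = "approach x"
  have "(\<lambda>n. \<bar>ln (cmod (?z n))\<bar>) \<longlonglongrightarrow> \<bar>ln (cmod (of_real x))\<bar>"
    using x by (intro tendsto_intros approach_tendsto) auto
  hence "Bseq (\<lambda>n. \<bar>ln (cmod (?z n))\<bar>)" by (intro convergent_imp_Bseq convergentI)
  then obtain K where K: "\<And>n. \<bar>ln (cmod (?z n))\<bar> \<le> K" unfolding Bseq_def by auto
  define R where "R = K + \<bar>ln \<gamma> - c\<bar> + measure \<nu> (space \<nu>) + 8 + pi"
  have mem: "v (?z n) \<in> cball 0 R" for n
  proof -
    have "cmod (v (?z n)) \<le> \<bar>Re (v (?z n))\<bar> + \<bar>Im (v (?z n))\<bar>" by (rule cmod_le)
    thus ?thesis using Re_v_bound[OF Im_approach[of x n]] K[of n] v_strip[OF Im_approach[of x n]]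
      by (simp add: R_def)
  qed
  have "\<exists>\<zeta>\<in>cball 0 R. \<exists>s. strict_mono s \<and> ((\<lambda>n. v (?z n)) \<circ> s) \<longlonglongrightarrow> \<zeta>"
    by (rule compact_cball[of 0 R, unfolded compact_def, rule_format]) (rule mem)
  then obtain \<zeta> s where s: "strict_mono s" "((\<lambda>n. v (?z n)) \<circ> s) \<longlonglongrightarrow> \<zeta>"
    by auto
  have lim: "(\<lambda>n. v (?z (s n))) \<longlonglongrightarrow> \<zeta>" using s(2) by (simp add: o_def)
  have Im_lim: "(\<lambda>n. Im (v (?z (s n)))) \<longlonglongrightarrow> Im \<zeta>" by (rule tendsto_Im[OF lim])
  have ge: "0 \<le> Im \<zeta>"
    by (rule LIMSEQ_le_const[OF Im_lim]) (use v_strip(1)[OF Im_approach] less_imp_le in blast)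
  have le: "Im \<zeta> \<le> pi"
    by (rule LIMSEQ_le_const2[OF Im_lim]) (use v_strip(2)[OF Im_approach] less_imp_le in blast)
  \<comment> \<open>On the upper edge the limit of \<omega> is a negative number a, where N is
    continuous and real. The functional equation in the limit reads x = \<gamma> a exp (-N a), which
    is negative.\<close>
  have "Im \<zeta> \<noteq> pi"
  proof
    assume pi: "Im \<zeta> = pi"
    define a where "a = - exp (Re \<zeta>)"
    have a: "a < 0" "exp \<zeta> = of_real a" using pi by (simp_all add: a_def complex_eq_iff Re_exp Im_exp)
    have na: "complex_of_real a \<notin> \<real>\<^sub>\<ge>\<^sub>0" using a by (simp add: complex_nonneg_Reals_iff)
    have wl: "(\<lambda>n. \<omega> (?z (s n))) \<longlonglongrightarrow> of_real a"
      using tendsto_exp[OF lim] by (simp add: exp_v[OF Im_approach] a)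
    have "(\<lambda>n. of_real \<gamma> * \<omega> (?z (s n)) * exp (- N (\<omega> (?z (s n))))) \<longlonglongrightarrow>
        of_real \<gamma> * of_real a * exp (- N (of_real a))"
      by (intro tendsto_intros wl isCont_tendsto_compose[OF isCont_N[OF na]])
    hence "(\<lambda>n. ?z (s n)) \<longlonglongrightarrow> of_real \<gamma> * of_real a * exp (- N (of_real a))"
      by (simp add: omega_eq[OF upper_notin[OF Im_approach]])
    moreover have "(\<lambda>n. ?z (s n)) \<longlonglongrightarrow> of_real x"
      using LIMSEQ_subseq_LIMSEQ[OF approach_tendsto s(1)] by (simp add: o_def)
    ultimately have "of_real x = of_real \<gamma> * of_real a * exp (- N (of_real a))"
      using LIMSEQ_unique by blast
    also have "N (of_real a) = of_real (Re (N (of_real a)))"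
      using N_real[OF a(1)] by (simp add: complex_eq_iff)
    also have "exp (- complex_of_real (Re (N (of_real a)))) = of_real (exp (- Re (N (of_real a))))"
      by (simp only: exp_of_real flip: of_real_minus)
    finally have "x = \<gamma> * a * exp (- Re (N (of_real a)))"
      unfolding of_real_mult[symmetric] of_real_eq_iff .
    moreover have "\<gamma> * a * exp (- Re (N (of_real a))) < 0"
      using gamma_pos a by (intro mult_neg_pos mult_pos_neg) auto
    ultimately show False using x by simp
  qed
  thus ?thesis using that[OF s(1) lim ge] le by simp
qed

text \<open>F (v z) = Ln z - Ln x, and F is holomorphic in the strip with a zero at \<zeta>. That
  zero is isolated, so |F| has a positive minimum on a small circle, which \<open>v\<close> cannot
  meet once z is close to x.\<close>

lemma sphere_avoidance_interior:
  assumes x: "x > 0" and s: "strict_mono s" and lim: "(\<lambda>n. v (approach x (s n))) \<longlonglongrightarrow> \<zeta>"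
    and im: "0 < Im \<zeta>" "Im \<zeta> < pi" and \<epsilon>: "\<epsilon> > 0"
  obtains r \<mu> where "0 < r" "r < \<epsilon>" "\<mu> > 0"
    "\<And>z. Im z > 0 \<Longrightarrow> cmod (Ln z - Ln (of_real x)) < \<mu> \<Longrightarrow> cmod (v z - \<zeta>) \<noteq> r"
proof -
  define F where "F \<xi> = of_real (ln \<gamma>) + \<xi> - N (exp \<xi>) - Ln (of_real x)" for \<xi>
  define St where "St = {\<xi>. 0 < Im \<xi>} \<inter> {\<xi>. Im \<xi> < pi}"
  have exp_up: "Im (exp \<xi>) > 0" if "\<xi> \<in> St" for \<xi>
    using that by (auto simp: St_def Im_exp intro!: mult_pos_pos sin_gt_zero)
  have Fv: "F (v z) = Ln z - Ln (of_real x)" if "Im z > 0" for z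
    unfolding F_def Ln_eq[OF that] exp_v[OF that] by simp
  have hol: "F holomorphic_on St"
  proof -
    have "N \<circ> exp holomorphic_on St"
      by (rule holomorphic_on_compose_gen[OF _ N_hol])
         (use exp_up in \<open>force intro: holomorphic_intros simp: complex_nonneg_Reals_iff\<close>)+
    thus ?thesis unfolding F_def[abs_def] o_def by (intro holomorphic_intros)
  qed
  have op: "open St" unfolding St_def by (intro open_Int open_halfspace_Im_gt open_halfspace_Im_lt)
  have cn: "connected St"
    unfolding St_def by (intro convex_connected convex_Int convex_halfspace_Im_gt convex_halfspace_Im_lt)
  have \<zeta>: "\<zeta> \<in> St" using im by (simp add: St_def)
  have Fcont: "isCont F \<xi>" if "\<xi> \<in> St" for \<xi>
    using holomorphic_on_imp_continuous_on[OF hol] op that by (simp add: continuous_on_eq_continuous_at)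
  have "(\<lambda>n. F (v (approach x (s n)))) \<longlonglongrightarrow> F \<zeta>"
    by (rule isCont_tendsto_compose[OF Fcont[OF \<zeta>] lim])
  moreover have "(\<lambda>n. Ln (approach x (s n)) - Ln (of_real x)) \<longlonglongrightarrow> Ln (of_real x) - Ln (of_real x)"
  proof (intro tendsto_diff tendsto_const isCont_tendsto_compose[OF Ln_cont_pos[OF x]])
    show "(\<lambda>n. approach x (s n)) \<longlonglongrightarrow> of_real x"
      using LIMSEQ_subseq_LIMSEQ[OF approach_tendsto s] by (simp add: o_def)
  qed
  ultimately have F0: "F \<zeta> = 0"
    unfolding Fv[OF Im_approach] using LIMSEQ_unique by fastforce
  have vs: "v \<i> \<in> St" using v_strip[of \<i>] by (simp add: St_def)
  \<comment> \<open>One point with F nonzero excludes the zero function; at i the imaginary part of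
    F is that of Ln i, namely \<pi>/2.\<close>
  have "F (v \<i>) \<noteq> 0"
  proof -
    have "Im (F (v \<i>)) = pi / 2" using x by (simp add: Fv Ln_of_real)
    thus ?thesis by auto
  qed
  then obtain r where r: "0 < r" "ball \<zeta> r \<subseteq> St" "\<And>\<xi>. \<xi> \<in> ball \<zeta> r - {\<zeta>} \<Longrightarrow> F \<xi> \<noteq> 0"
    using isolated_zeros[OF hol op cn \<zeta> F0 vs] by blast
  define r' where "r' = min r \<epsilon> / 2"
  have r': "0 < r'" "r' < r" "r' < \<epsilon>" using r \<epsilon> by (auto simp: r'_def)
  have sub: "sphere \<zeta> r' \<subseteq> ball \<zeta> r - {\<zeta>}" using r' by auto
  have "compact (F ` sphere \<zeta> r')"
    using sub r(2) by (intro compact_continuous_image continuous_on_subset[OF holomorphic_on_imp_continuous_on[OF hol]]) auto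
  moreover have "0 \<notin> F ` sphere \<zeta> r'"
  proof
    assume "0 \<in> F ` sphere \<zeta> r'"
    then obtain \<xi> where "\<xi> \<in> sphere \<zeta> r'" "F \<xi> = 0" by (metis imageE)
    thus False using r(3) sub by blast
  qed
  ultimately obtain \<mu> where \<mu>: "\<mu> > 0" "\<And>y. y \<in> F ` sphere \<zeta> r' \<Longrightarrow> \<mu> \<le> dist 0 y"
    using separate_point_closed[of "F ` sphere \<zeta> r'" 0] compact_imp_closed by blast
  show ?thesis
  proof (rule that[OF r'(1,3) \<mu>(1)])
    fix z assume z: "Im z > 0" "cmod (Ln z - Ln (of_real x)) < \<mu>"
    show "cmod (v z - \<zeta>) \<noteq> r'"
    proof
      assume "cmod (v z - \<zeta>) = r'"
      hence "v z \<in> sphere \<zeta> r'" by (simp add: dist_norm norm_minus_commute)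
      from \<mu>(2)[OF imageI[OF this]] show False using z by (simp add: Fv dist_norm norm_minus_commute)
    qed
  qed
qed

text \<open>At a real \<zeta> the function F of the interior case need not be holomorphic; the cubic
  two-point estimate against the approaching sequence serves as the lower bound on the
  circle.\<close>

lemma sphere_avoidance_boundary:
  assumes x: "x > 0" and s: "strict_mono s" and lim: "(\<lambda>n. v (approach x (s n))) \<longlonglongrightarrow> \<zeta>"
    and im: "Im \<zeta> = 0" and \<epsilon>: "\<epsilon> > 0"
  obtains r \<mu> where "0 < r" "r < \<epsilon>" "\<mu> > 0"
    "\<And>z. Im z > 0 \<Longrightarrow> cmod (Ln z - Ln (of_real x)) < \<mu> \<Longrightarrow> cmod (v z - \<zeta>) \<noteq> r"
proof -
  \<comment> \<open>The radius stays below 1/1000 so that, \<zeta> being its own conjugate, points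
    of the circle satisfy the closeness condition of \<open>two_point\<close> with late members of
    the sequence.\<close>
  define r where "r = min (1 / 2000) (\<epsilon> / 2)"
  have r: "0 < r" "r < \<epsilon>" "r < 1 / 1000" using \<epsilon> by (auto simp: r_def)
  show ?thesis
  proof (rule that[OF r(1,2)])
    show "r ^ 3 / 100 > 0" using r by simp
    fix z assume z: "Im z > 0" "cmod (Ln z - Ln (of_real x)) < r ^ 3 / 100"
    show "cmod (v z - \<zeta>) \<noteq> r"
    proof
      assume eq: "cmod (v z - \<zeta>) = r"
      have cz: "cnj \<zeta> = \<zeta>" using im by (simp add: complex_eq_iff)
      have "(\<lambda>n. cmod (v z - cnj (v (approach x (s n))))) \<longlonglongrightarrow> cmod (v z - cnj \<zeta>)"
        by (intro tendsto_intros lim)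
      hence ev: "eventually (\<lambda>n. cmod (v z - cnj (v (approach x (s n)))) < 1 / 1000) sequentially"
        using order_tendstoD(2)[of _ r sequentially "1 / 1000"] r eq cz by simp
      have l1: "(\<lambda>n. cmod (Ln z - Ln (approach x (s n)))) \<longlonglongrightarrow> cmod (Ln z - Ln (of_real x))"
      proof (intro tendsto_norm tendsto_diff tendsto_const isCont_tendsto_compose[OF Ln_cont_pos[OF x]])
        show "(\<lambda>n. approach x (s n)) \<longlonglongrightarrow> of_real x"
          using LIMSEQ_subseq_LIMSEQ[OF approach_tendsto s] by (simp add: o_def)
      qed
      have l2: "(\<lambda>n. cmod (v z - v (approach x (s n))) ^ 3 / 100) \<longlonglongrightarrow> cmod (v z - \<zeta>) ^ 3 / 100"
        by (intro tendsto_intros lim) simp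
      have "cmod (v z - \<zeta>) ^ 3 / 100 \<le> cmod (Ln z - Ln (of_real x))"
      proof (rule tendsto_le[OF sequentially_bot l1 l2])
        show "eventually (\<lambda>n. cmod (v z - v (approach x (s n))) ^ 3 / 100 \<le> cmod (Ln z - Ln (approach x (s n)))) sequentially"
          using ev by eventually_elim (rule two_point[OF z(1) Im_approach], simp)
      qed
      thus False using z(2) eq by simp
    qed
  qed
qed

text \<open>A cluster point is upgraded to a limit: near x the continuous function |v - \<zeta>|
  takes a value below r on a connected half-disc and never the value r.\<close>

lemma boundary_limit:
  assumes x: "x > 0"
  obtains \<zeta> where "(v \<longlongrightarrow> \<zeta>) (at (of_real x) within {z. Im z > 0})" "0 \<le> Im \<zeta>" "Im \<zeta> < pi"
proof -
  obtain \<zeta> s where s: "strict_mono s" and lim: "(\<lambda>n. v (approach x (s n))) \<longlonglongrightarrow> \<zeta>"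
    and im: "0 \<le> Im \<zeta>" "Im \<zeta> < pi"
    using cluster_point[OF x] .
  have "(v \<longlongrightarrow> \<zeta>) (at (of_real x) within {z. Im z > 0})"
  proof (rule tendstoI)
    fix \<epsilon> :: real assume \<epsilon>: "\<epsilon> > 0"
    obtain r \<mu> where r: "0 < r" "r < \<epsilon>" "\<mu> > 0"
      "\<And>z. Im z > 0 \<Longrightarrow> cmod (Ln z - Ln (of_real x)) < \<mu> \<Longrightarrow> cmod (v z - \<zeta>) \<noteq> r"
    proof (cases "Im \<zeta> = 0")
      case True
      show ?thesis using sphere_avoidance_boundary[OF x s lim True \<epsilon>] that by metis
    next
      case False
      hence "0 < Im \<zeta>" using im by simp
      thus ?thesis using sphere_avoidance_interior[OF x s lim _ im(2) \<epsilon>] that by metis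
    qed
    have "eventually (\<lambda>z. cmod (Ln z - Ln (of_real x)) < \<mu>) (nhds (of_real x))"
    proof -
      have "((\<lambda>z. cmod (Ln z - Ln (of_real x))) \<longlongrightarrow> cmod (Ln (of_real x) - Ln (of_real x))) (nhds (of_real x))"
      proof (intro tendsto_norm tendsto_diff tendsto_const)
        show "(Ln \<longlongrightarrow> Ln (of_real x)) (nhds (of_real x))"
          using Ln_cont_pos[OF x] unfolding isCont_def tendsto_at_iff_tendsto_nhds .
      qed
      thus ?thesis using order_tendstoD(2)[of _ 0 "nhds (of_real x)" \<mu>] r(3) by simp
    qed
    then obtain \<delta> where \<delta>: "\<delta> > 0" "\<And>z. dist z (of_real x) < \<delta> \<Longrightarrow> cmod (Ln z - Ln (of_real x)) < \<mu>"
      unfolding eventually_nhds_metric by blast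
    define A where "A = {z. Im z > 0} \<inter> ball (of_real x) \<delta>"
    \<comment> \<open>The half-disc is convex, so the image is an interval and the intermediate
      value r would be attained if |v - \<zeta>| reached r or more.\<close>
    have conn: "connected ((\<lambda>z. cmod (v z - \<zeta>)) ` A)"
    proof (intro connected_continuous_image continuous_at_imp_continuous_on ballI)
      show "connected A" unfolding A_def
        by (intro convex_connected convex_Int convex_halfspace_Im_gt convex_ball)
      show "isCont (\<lambda>z. cmod (v z - \<zeta>)) z" if "z \<in> A" for z
        using that by (intro continuous_intros isCont_v) (simp add: A_def)
    qed
    have "eventually (\<lambda>n. dist (v (approach x (s n))) \<zeta> < r) sequentially"
      using tendstoD[OF lim r(1)] .
    moreover have "eventually (\<lambda>n. dist (approach x (s n)) (of_real x) < \<delta>) sequentially"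
      using tendstoD[OF LIMSEQ_subseq_LIMSEQ[OF approach_tendsto s] \<delta>(1)] by (simp add: o_def)
    ultimately have "eventually (\<lambda>n. dist (v (approach x (s n))) \<zeta> < r \<and> dist (approach x (s n)) (of_real x) < \<delta>) sequentially"
      by (rule eventually_conj)
    then obtain n where n: "dist (v (approach x (s n))) \<zeta> < r" "dist (approach x (s n)) (of_real x) < \<delta>"
      using eventually_happens by fastforce
    have nA: "approach x (s n) \<in> A" using n Im_approach by (simp add: A_def dist_commute)
    have "cmod (v z - \<zeta>) < r" if z: "z \<in> A" for z
    proof (rule ccontr)
      assume "\<not> cmod (v z - \<zeta>) < r"
      moreover have "{cmod (v (approach x (s n)) - \<zeta>)..cmod (v z - \<zeta>)} \<subseteq> (\<lambda>z. cmod (v z - \<zeta>)) ` A"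
        by (rule connected_contains_Icc[OF conn imageI[OF nA] imageI[OF z]])
      ultimately have "r \<in> (\<lambda>z. cmod (v z - \<zeta>)) ` A" using n(1) by (auto simp: dist_norm)
      then obtain z' where "z' \<in> A" "cmod (v z' - \<zeta>) = r" by auto
      thus False using r(4)[of z'] \<delta>(2)[of z'] by (simp add: A_def dist_commute)
    qed
    hence "\<And>z. Im z > 0 \<Longrightarrow> dist z (of_real x) < \<delta> \<Longrightarrow> dist (v z) \<zeta> < \<epsilon>"
      using r(2) by (force simp: A_def dist_norm norm_minus_commute)
    thus "eventually (\<lambda>z. dist (v z) \<zeta> < \<epsilon>) (at (of_real x) within {z. Im z > 0})"
      unfolding eventually_at using \<delta>(1) by blast
  qed
  thus ?thesis using that im by blast
qed

text \<open>The limit of \<open>two_point\<close> along vertical sequences. Strict closeness of the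
  limits is assumed so that it is inherited by late terms.\<close>

lemma two_point_boundary:
  assumes x: "x > 0" and y: "y > 0"
    and lx: "(v \<longlongrightarrow> \<xi>) (at (of_real x) within {z. Im z > 0})"
    and ly: "(v \<longlongrightarrow> \<zeta>) (at (of_real y) within {z. Im z > 0})"
    and close: "cmod (\<xi> - cnj \<zeta>) < 1 / 1000"
  shows "cmod (\<xi> - \<zeta>) ^ 3 / 100 \<le> \<bar>ln x - ln y\<bar>"
proof -
  have vx: "(\<lambda>n. v (approach x n)) \<longlonglongrightarrow> \<xi>" and vy: "(\<lambda>n. v (approach y n)) \<longlonglongrightarrow> \<zeta>"
    using filterlim_compose[OF lx approach_filterlim] filterlim_compose[OF ly approach_filterlim] by simp_all
  have l1: "(\<lambda>n. cmod (Ln (approach x n) - Ln (approach y n))) \<longlonglongrightarrow> cmod (Ln (of_real x) - Ln (of_real y))"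
    by (intro tendsto_norm tendsto_diff isCont_tendsto_compose[OF Ln_cont_pos] x y approach_tendsto)
  have l2: "(\<lambda>n. cmod (v (approach x n) - v (approach y n)) ^ 3 / 100) \<longlonglongrightarrow> cmod (\<xi> - \<zeta>) ^ 3 / 100"
    by (intro tendsto_intros vx vy) simp
  have "(\<lambda>n. cmod (v (approach x n) - cnj (v (approach y n)))) \<longlonglongrightarrow> cmod (\<xi> - cnj \<zeta>)"
    by (intro tendsto_intros vx vy)
  hence ev: "eventually (\<lambda>n. cmod (v (approach x n) - cnj (v (approach y n))) < 1 / 1000) sequentially"
    by (rule order_tendstoD(2)[OF _ close])
  have "cmod (\<xi> - \<zeta>) ^ 3 / 100 \<le> cmod (Ln (of_real x) - Ln (of_real y))"
  proof (rule tendsto_le[OF sequentially_bot l1 l2])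
    show "eventually (\<lambda>n. cmod (v (approach x n) - v (approach y n)) ^ 3 / 100 \<le>
        cmod (Ln (approach x n) - Ln (approach y n))) sequentially"
      using ev by eventually_elim (rule two_point[OF Im_approach Im_approach], simp)
  qed
  also have "Ln (of_real x) - Ln (of_real y) = complex_of_real (ln x - ln y)"
    using x y by (simp add: Ln_of_real)
  finally show ?thesis by (simp only: norm_of_real)
qed

text \<open>The logarithmic equation extends to a boundary value inside the strip, where N is
  continuous, and Ln x is real.\<close>

lemma Im_N_boundary:
  assumes x: "x > 0" and lx: "(v \<longlongrightarrow> \<xi>) (at (of_real x) within {z. Im z > 0})"
    and im: "0 < Im \<xi>" "Im \<xi> < pi"
  shows "Im (N (exp \<xi>)) = Im \<xi>"
proof -
  have vx: "(\<lambda>n. v (approach x n)) \<longlonglongrightarrow> \<xi>"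
    using filterlim_compose[OF lx approach_filterlim] by simp
  have up: "Im (exp \<xi>) > 0" using im by (simp add: Im_exp sin_gt_zero)
  have "(\<lambda>n. of_real (ln \<gamma>) + v (approach x n) - N (exp (v (approach x n)))) \<longlonglongrightarrow>
      of_real (ln \<gamma>) + \<xi> - N (exp \<xi>)"
    by (intro tendsto_intros vx isCont_tendsto_compose[OF isCont_N[OF upper_notin[OF up]]])
  moreover have "(\<lambda>n. Ln (approach x n)) \<longlonglongrightarrow> Ln (of_real x)"
    by (intro isCont_tendsto_compose[OF Ln_cont_pos] x approach_tendsto)
  ultimately have "Ln (of_real x) = of_real (ln \<gamma>) + \<xi> - N (exp \<xi>)"
    unfolding Ln_eq[OF Im_approach] exp_v[OF Im_approach] using LIMSEQ_unique by blast
  from arg_cong[OF this, of Im] show ?thesis using x by (simp add: Ln_of_real)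
qed

end

section \<open>The cube root bound\<close>

lemma connected_slit_plane: "connected (- \<real>\<^sub>\<ge>\<^sub>0 :: complex set)"
proof -
  have "(\<real>\<^sub>\<ge>\<^sub>0 :: complex set) = complex_of_real ` {0..}"
    by (auto elim!: nonneg_Reals_cases)
  thus ?thesis
    using starlike_imp_connected[OF starlike_slotted_complex_plane_right[of 0]] by simp
qed

lemma ln_diff_bound:
  fixes x y :: real
  assumes "y > 0" "\<bar>x - y\<bar> < y / 2"
  shows "\<bar>ln x - ln y\<bar> \<le> 2 / y * \<bar>x - y\<bar>"
proof -
  have x: "x > y / 2" using assms(2) unfolding abs_less_iff by linarith
  have "(x - y) / y \<le> 2 / y * \<bar>x - y\<bar>"
  proof -
    have "x - y \<le> 2 * \<bar>x - y\<bar>"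
      by (rule order_trans[OF abs_ge_self]) simp
    hence "(x - y) / y \<le> (2 * \<bar>x - y\<bar>) / y" using assms by (intro divide_right_mono) auto
    thus ?thesis by simp
  qed
  moreover have "(y - x) / x \<le> 2 / y * \<bar>x - y\<bar>"
  proof -
    have "(y - x) / x \<le> \<bar>x - y\<bar> / (y / 2)" using assms x by (intro frac_le) auto
    thus ?thesis by (simp add: mult.commute)
  qed
  ultimately show ?thesis
    using ln_diff_le[of x y] ln_diff_le[of y x] assms x by (simp add: abs_le_iff)
qed

section \<open>The functional equation and the density\<close>

lemma eta_no_positive_part:
  assumes "prob_Rplus \<mu>" "emeasure \<mu> {0<..} = 0"
  shows "eta \<mu> z = 0"
  by (simp add: eta_def psi_no_positive_part[OF assms])

lemma eta_inverse_nearD: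
  assumes "eta_inverse_near \<mu> \<alpha> U f" "\<alpha> < x" "x < 0"
  obtains a where "f (of_real x) = of_real a" "a < 0" "eta \<mu> (of_real a) = of_real x"
    "complex_of_real x \<in> U"
proof -
  have x: "x \<in> {\<alpha><..<0}" using assms by simp
  hence U: "complex_of_real x \<in> U" using assms(1) unfolding eta_inverse_near_def by blast
  have "f (of_real x) \<in> complex_of_real ` {..<0}"
    using assms(1) x unfolding eta_inverse_near_def by blast
  then obtain a where a: "f (of_real x) = of_real a" "a < 0" by auto
  have "eta \<mu> (f (of_real x)) = of_real x"
    using assms(1) U unfolding eta_inverse_near_def by blast
  thus ?thesis using that[OF a _ U] a by simp
qed

text \<open>For small negative x put a = f x. Then \<eta> of \<rho> at a is the first inverse at x,
  and the convolution identity with the second inverse \<gamma> x exp (u x) becomes, after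
  cancelling x, the claim at z = a. These points accumulate in the slit plane, so the identity
  theorem extends it.\<close>

lemma subordination_equation:
  assumes m1: "eta_measure \<mu>\<^sub>1" and m2: "eta_measure \<mu>\<^sub>2" and r: "eta_measure \<rho>" and l: "levy_measure \<sigma>"
    and F: "continues_eta_inverse \<mu>\<^sub>2 (Phi \<gamma> \<sigma>)"
    and conv: "free_mult_conv \<mu>\<^sub>1 \<mu>\<^sub>2 \<mu>"
    and sub: "\<forall>z\<in>- \<real>\<^sub>\<ge>\<^sub>0. eta \<mu> z = eta \<mu>\<^sub>1 (eta \<rho> z)"
    and z: "z \<notin> \<real>\<^sub>\<ge>\<^sub>0"
  shows "of_real \<gamma> * eta \<rho> z * exp (levy_measure.u \<sigma> (eta \<mu>\<^sub>1 (eta \<rho> z))) = z"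
proof -
  interpret M1: eta_measure \<mu>\<^sub>1 by (rule m1)
  interpret M2: eta_measure \<mu>\<^sub>2 by (rule m2)
  interpret R: eta_measure \<rho> by (rule r)
  interpret L: levy_measure \<sigma> by (rule l)
  obtain \<alpha> U f f\<^sub>1 f\<^sub>2 where e: "eta_inverse_near \<mu> \<alpha> U f" "eta_inverse_near \<mu>\<^sub>1 \<alpha> U f\<^sub>1" "eta_inverse_near \<mu>\<^sub>2 \<alpha> U f\<^sub>2"
    and prod: "\<forall>z\<in>U. z * f z = f\<^sub>1 z * f\<^sub>2 z"
    using conv unfolding free_mult_conv_def by blast
  obtain \<alpha>' U' f' where e': "eta_inverse_near \<mu>\<^sub>2 \<alpha>' U' f'" and Phi: "\<forall>z\<in>U'. Phi \<gamma> \<sigma> z = f' z"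
    using F unfolding continues_eta_inverse_def by blast
  \<comment> \<open>The convolution and the continuation \<open>Phi\<close> each come with their own
    inverse for the second measure; this is the interval on which both are available.\<close>
  define \<beta> where "\<beta> = max \<alpha> \<alpha>'"
  have \<beta>: "\<beta> < 0" using e(1) e' by (simp add: \<beta>_def eta_inverse_near_def)
  define G where "G z = of_real \<gamma> * eta \<rho> z * exp (L.u (eta \<mu>\<^sub>1 (eta \<rho> z))) - z" for z
  have G0: "G (f (of_real x)) = 0" "f (of_real x) \<notin> \<real>\<^sub>\<ge>\<^sub>0" if x: "\<beta> < x" "x < 0" for x
  proof -
    have al: "\<alpha> < x" "\<alpha>' < x" using x by (auto simp: \<beta>_def)
    obtain a where a: "f (of_real x) = of_real a" "a < 0" "eta \<mu> (of_real a) = of_real x" "complex_of_real x \<in> U"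
      by (rule eta_inverse_nearD[OF e(1) al(1) x(2)])
    obtain b1 where b1: "f\<^sub>1 (of_real x) = of_real b1" "b1 < 0" "eta \<mu>\<^sub>1 (of_real b1) = of_real x" "complex_of_real x \<in> U"
      by (rule eta_inverse_nearD[OF e(2) al(1) x(2)])
    obtain b2 where b2: "f\<^sub>2 (of_real x) = of_real b2" "b2 < 0" "eta \<mu>\<^sub>2 (of_real b2) = of_real x" "complex_of_real x \<in> U"
      by (rule eta_inverse_nearD[OF e(3) al(1) x(2)])
    obtain b3 where b3: "f' (of_real x) = of_real b3" "b3 < 0" "eta \<mu>\<^sub>2 (of_real b3) = of_real x" "complex_of_real x \<in> U'"
      by (rule eta_inverse_nearD[OF e' al(2) x(2)])
    have an: "complex_of_real a \<notin> \<real>\<^sub>\<ge>\<^sub>0" using a by (simp add: complex_nonneg_Reals_iff)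
    thus "f (of_real x) \<notin> \<real>\<^sub>\<ge>\<^sub>0" by (simp add: a)
    obtain b where b: "eta \<rho> (of_real a) = of_real b" "b < 0" by (rule R.eta_neg[OF a(2)])
    have xb: "eta \<mu>\<^sub>1 (of_real b) = of_real x"
      using sub an a(3) b(1) by auto
    have bb1: "b = b1" by (rule M1.eta_inj_neg) (use xb b1 b in auto)
    have b23: "b2 = b3" by (rule M2.eta_inj_neg) (use b2 b3 in auto)
    have "of_real x * complex_of_real a = of_real b * of_real b2"
      using prod a b1 b2 bb1 by auto
    also have "complex_of_real b2 = of_real \<gamma> * of_real x * exp (L.u (of_real x))"
      using Phi b3 b23 unfolding Phi_def L.u_def by auto
    finally have "of_real x * complex_of_real a = of_real x * (of_real \<gamma> * complex_of_real b * exp (L.u (of_real x)))"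
      by (simp only: mult_ac)
    moreover have "complex_of_real x \<noteq> 0" using x by simp
    ultimately have eqa: "complex_of_real a = of_real \<gamma> * complex_of_real b * exp (L.u (of_real x))"
      by (simp only: mult_cancel_left) simp
    show "G (f (of_real x)) = 0" unfolding G_def a(1) b(1) xb by (simp add: eqa)
  qed
  have Ghol: "G holomorphic_on - \<real>\<^sub>\<ge>\<^sub>0"
  proof -
    have "eta \<mu>\<^sub>1 \<circ> eta \<rho> holomorphic_on - \<real>\<^sub>\<ge>\<^sub>0"
      by (rule holomorphic_on_compose_gen[OF R.eta_holomorphic M1.eta_holomorphic])
         (use R.eta_notin in auto)
    hence "L.u \<circ> (eta \<mu>\<^sub>1 \<circ> eta \<rho>) holomorphic_on - \<real>\<^sub>\<ge>\<^sub>0"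
      by (rule holomorphic_on_compose_gen[OF _ L.u_holomorphic])
         (use R.eta_notin M1.eta_notin in auto)
    thus ?thesis unfolding G_def[abs_def] o_def
      by (intro holomorphic_intros R.eta_holomorphic)
  qed
  define x0 where "x0 = \<beta> / 2"
  have x0: "\<beta> < x0" "x0 < 0" using \<beta> by (auto simp: x0_def)
  \<comment> \<open>Equal to x0 (1 - 1/(n + 2)). The offset 2 keeps even the first term strictly
    negative; it would be 0 with offset 1.\<close>
  define X where "X n = x0 + (- x0) / (real n + 2)" for n
  have X: "\<beta> < X n" "X n < 0" "X n \<noteq> x0" for n
  proof -
    have "0 < (- x0) / (real n + 2)" using x0 by (intro divide_pos_pos) auto
    moreover have "(- x0) / (real n + 2) < - x0"
    proof -
      have "(- x0) / (real n + 2) < (- x0) / 1"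
        using x0 by (intro divide_strict_left_mono) auto
      thus ?thesis by simp
    qed
    ultimately show "\<beta> < X n" "X n < 0" "X n \<noteq> x0" using x0 unfolding X_def by linarith+
  qed
  have Xlim: "X \<longlonglongrightarrow> x0" unfolding X_def by real_asymp
  have fcont: "isCont f (of_real x0)"
  proof -
    have U: "complex_of_real x0 \<in> U" "open U" "f holomorphic_on U"
      using e(1) x0 unfolding eta_inverse_near_def \<beta>_def by auto
    thus ?thesis
      using holomorphic_on_imp_continuous_on[OF U(3)] by (simp add: continuous_on_eq_continuous_at)
  qed
  have lp: "f (of_real x0) islimpt (\<lambda>x. f (of_real x)) ` {\<beta><..<0}"
    unfolding islimpt_sequential
  proof (intro exI[of _ "\<lambda>n. f (of_real (X n))"] conjI allI)
    fix n
    have "f (of_real (X n)) \<noteq> f (of_real x0)"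
    proof
      assume "f (of_real (X n)) = f (of_real x0)"
      moreover have "eta \<mu> (f (of_real x)) = of_real x" if "\<beta> < x" "x < 0" for x
      proof -
        have "\<alpha> < x" using that by (simp add: \<beta>_def)
        from eta_inverse_nearD[OF e(1) this that(2)] show ?thesis by metis
      qed
      ultimately have "complex_of_real (X n) = of_real x0" using X x0 by metis
      thus False using X(3) by simp
    qed
    thus "f (of_real (X n)) \<in> (\<lambda>x. f (of_real x)) ` {\<beta><..<0} - {f (of_real x0)}"
      using X by auto
  next
    show "(\<lambda>n. f (of_real (X n))) \<longlonglongrightarrow> f (of_real x0)"
      by (rule isCont_tendsto_compose[OF fcont]) (rule tendsto_of_real[OF Xlim])
  qed
  have "G z = 0"
  proof (rule analytic_continuation[OF Ghol _ connected_slit_plane _ _ lp])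
    show "open (- \<real>\<^sub>\<ge>\<^sub>0 :: complex set)"
      using closed_nonneg_Reals_complex by (simp add: open_Compl)
    show "(\<lambda>x. f (of_real x)) ` {\<beta><..<0} \<subseteq> - \<real>\<^sub>\<ge>\<^sub>0" using G0 by auto
    show "f (of_real x0) \<in> - \<real>\<^sub>\<ge>\<^sub>0" using G0(2)[OF x0] by simp
    show "G y = 0" if "y \<in> (\<lambda>x. f (of_real x)) ` {\<beta><..<0}" for y using that G0 by auto
    show "z \<in> - \<real>\<^sub>\<ge>\<^sub>0" using z by simp
  qed
  thus ?thesis by (simp add: G_def)
qed

text \<open>Because 1 / (1 - \<eta>) = 1 + \<psi>, the density is Im \<psi> divided by
  \<pi>.\<close>

lemma haar_density_upper:
  assumes "eta_measure \<mu>" "eta_boundary \<rho> (1 / x) = w" "Im w > 0"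
  shows "haar_density \<mu> \<rho> x = Im w * eta_measure.weight \<mu> w / pi"
proof -
  interpret eta_measure \<mu> by (rule assms(1))
  have n: "w \<notin> \<real>\<^sub>\<ge>\<^sub>0" using assms(3) by (auto simp: complex_nonneg_Reals_iff)
  have "1 / (1 - eta \<mu> w) = 1 + psi \<mu> w" by (simp add: eta_eq[OF n])
  thus ?thesis using assms(3) Im_psi[OF n]
    by (simp add: haar_density_def assms(2) upper_half_plane_def)
qed

theorem theorem4p5:
  fixes \<mu>\<^sub>1 \<mu>\<^sub>2 \<mu> \<rho>\<^sub>1 :: "real measure"
    and \<gamma> :: real and \<sigma> :: "ennreal measure"
    and I :: "real set" and x\<^sub>0 :: real
  assumes "prob_Rplus \<mu>\<^sub>1" and "nondegenerate \<mu>\<^sub>1"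
    and "prob_Rplus \<mu>\<^sub>2" and "nondegenerate \<mu>\<^sub>2"
    and "free_mult_infdiv \<mu>\<^sub>2"
    and "\<gamma> > 0" and "finite_measure \<sigma>" and "sets \<sigma> = sets borel"
    and "continues_eta_inverse \<mu>\<^sub>2 (Phi \<gamma> \<sigma>)"
    and "free_mult_conv \<mu>\<^sub>1 \<mu>\<^sub>2 \<mu>"
    and "prob_Rplus \<rho>\<^sub>1"
    and "\<forall>z\<in>- \<real>\<^sub>\<ge>\<^sub>0. eta \<mu> z = eta \<mu>\<^sub>1 (eta \<rho>\<^sub>1 z)"
    and "emeasure \<sigma> {0<..<\<infinity>} > 0"
    and "open I" and "is_interval I" and "I \<subseteq> {0<..}"
    and "x\<^sub>0 \<in> frontier I" and "x\<^sub>0 > 0"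
    and "\<forall>t. complex_of_real t = 1 / eta_boundary \<rho>\<^sub>1 (1 / x\<^sub>0) \<longrightarrow> measure \<mu>\<^sub>1 {t} = 0"
    and "haar_density \<mu>\<^sub>1 \<rho>\<^sub>1 x\<^sub>0 = 0"
    and "\<forall>x\<in>I. haar_density \<mu>\<^sub>1 \<rho>\<^sub>1 x > 0"
  shows "\<exists>\<delta>>0. bounded ((\<lambda>x. haar_density \<mu>\<^sub>1 \<rho>\<^sub>1 x / \<bar>x - x\<^sub>0\<bar> powr (1/3)) ` (I \<inter> ball x\<^sub>0 \<delta>))"
proof -
  have m1: "eta_measure \<mu>\<^sub>1" by (intro eta_measureI nondegenerate_positive_part assms(1,2))
  have m2: "eta_measure \<mu>\<^sub>2" by (intro eta_measureI nondegenerate_positive_part assms(3,4))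
  \<comment> \<open>Otherwise \<eta> of \<rho> is 0 on the slit plane, hence \<eta> of the
    convolution is 0 there too, contradicting its local inverse at \<alpha>/2.\<close>
  have rho_pos: "emeasure \<rho>\<^sub>1 {0<..} \<noteq> 0"
  proof
    assume z: "emeasure \<rho>\<^sub>1 {0<..} = 0"
    obtain \<alpha> U f where e: "eta_inverse_near \<mu> \<alpha> U f"
      using assms(10) unfolding free_mult_conv_def by blast
    hence al: "\<alpha> < \<alpha> / 2" "\<alpha> / 2 < 0" by (auto simp: eta_inverse_near_def)
    obtain a where a: "a < 0" "eta \<mu> (of_real a) = of_real (\<alpha> / 2)"
      using eta_inverse_nearD[OF e al] by metis
    have "complex_of_real a \<in> - \<real>\<^sub>\<ge>\<^sub>0" using a by (simp add: complex_nonneg_Reals_iff)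
    hence "eta \<mu> (of_real a) = eta \<mu>\<^sub>1 0"
      using assms(12) eta_no_positive_part[OF assms(11) z] by simp
    also have "\<dots> = 0" by (simp add: eta_def psi_def)
    finally show False using a al by simp
  qed
  have r1: "eta_measure \<rho>\<^sub>1" by (rule eta_measureI[OF assms(11) rho_pos])
  have lv: "levy_measure \<sigma>"
    using assms(7,8) by (intro levy_measure.intro levy_measure_axioms.intro)
  interpret M1: eta_measure \<mu>\<^sub>1 by (rule m1)
  interpret R: eta_measure \<rho>\<^sub>1 by (rule r1)
  interpret L: levy_measure \<sigma> by (rule lv)
  define \<Sigma> where "\<Sigma> = measure \<sigma> (space \<sigma>)"
  \<comment> \<open>The positive mass makes N map the upper half-plane strictly into itself and
    provides the quantitative bound \<open>N_lower\<close>.\<close>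
  have \<Sigma>: "\<Sigma> > 0"
  proof -
    have "emeasure \<sigma> {0<..<\<infinity>} \<le> emeasure \<sigma> (space \<sigma>)"
      by (rule emeasure_space)
    hence "emeasure \<sigma> (space \<sigma>) > 0" using assms(13) by (rule less_le_trans[rotated])
    thus ?thesis unfolding \<Sigma>_def by (simp add: L.emeasure_eq_measure)
  qed
  define N where "N w = - L.u (eta \<mu>\<^sub>1 w)" for w
  have Nhol: "N holomorphic_on - \<real>\<^sub>\<ge>\<^sub>0"
  proof -
    have "L.u \<circ> eta \<mu>\<^sub>1 holomorphic_on - \<real>\<^sub>\<ge>\<^sub>0"
      by (rule holomorphic_on_compose_gen[OF M1.eta_holomorphic L.u_holomorphic]) (use M1.eta_notin in auto)
    thus ?thesis unfolding N_def[abs_def] o_def by (intro holomorphic_intros)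
  qed
  have N_lower: "\<Sigma> * (Im (eta \<mu>\<^sub>1 w) / (2 * (1 + (cmod (eta \<mu>\<^sub>1 w))\<^sup>2))) \<le> Im (N w)" if "Im w > 0" for w
    using L.Im_u[OF M1.eta_upper[OF that]] by (simp add: N_def \<Sigma>_def)
  have N_upper: "Im (N w) > 0" if "Im w > 0" for w
  proof -
    have "0 < \<Sigma> * (Im (eta \<mu>\<^sub>1 w) / (2 * (1 + (cmod (eta \<mu>\<^sub>1 w))\<^sup>2)))"
      using \<Sigma> M1.eta_upper[OF that] by (intro mult_pos_pos divide_pos_pos) (auto intro: add_pos_nonneg)
    thus ?thesis using N_lower[OF that] by linarith
  qed
  have N_real: "Im (N (of_real x)) = 0" if x: "x < 0" for x
  proof -
    obtain y where "eta \<mu>\<^sub>1 (of_real x) = of_real y" "y < 0" by (rule M1.eta_neg[OF x])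
    thus ?thesis using L.Im_u_neg by (simp add: N_def)
  qed
  obtain \<nu> C S where hk: "herglotz_kernel \<nu> C S"
    and rep: "\<And>w. Im w > 0 \<Longrightarrow> N w = of_real (Re (N \<i>)) + herglotz_kernel.V \<nu> C S w"
    using herglotz_half_plane[OF Nhol N_upper N_real] by blast
  have "subordination \<nu> C S N (eta \<rho>\<^sub>1) \<gamma> (Re (N \<i>))"
  proof (intro subordination.intro hk subordination_axioms.intro)
    show "continuous_on (- \<real>\<^sub>\<ge>\<^sub>0) (eta \<rho>\<^sub>1)"
      by (rule holomorphic_on_imp_continuous_on[OF R.eta_holomorphic])
    show "\<exists>a>0. eta \<rho>\<^sub>1 (of_real x) = - of_real a" if x: "x < 0" for x
    proof -
      obtain y where "eta \<rho>\<^sub>1 (of_real x) = of_real y" "y < 0" by (rule R.eta_neg[OF x])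
      thus ?thesis by (intro exI[of _ "- y"]) auto
    qed
    show "of_real \<gamma> * eta \<rho>\<^sub>1 z * exp (- N (eta \<rho>\<^sub>1 z)) = z" if "z \<notin> \<real>\<^sub>\<ge>\<^sub>0" for z
      using subordination_equation[OF m1 m2 r1 lv assms(9,10,12) that] by (simp add: N_def)
    show "\<gamma> > 0" by (rule assms(6))
    show "N holomorphic_on - \<real>\<^sub>\<ge>\<^sub>0" by (rule Nhol)
    show "Im (N (of_real x)) = 0" if "x < 0" for x by (rule N_real[OF that])
    show "Im (N w) > 0" if "Im w > 0" for w by (rule N_upper[OF that])
    show "N w = of_real (Re (N \<i>)) + herglotz_kernel.V \<nu> C S w" if "Im w > 0" for w by (rule rep[OF that])
    show "Im (eta \<rho>\<^sub>1 z) > 0" if "Im z > 0" for z by (rule R.eta_upper[OF that])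
  qed
  then interpret T: subordination \<nu> C S N "eta \<rho>\<^sub>1" \<gamma> "Re (N \<i>)" .
  have uhp: "upper_half_plane = {z. Im z > 0}" by (simp add: upper_half_plane_def)
  have boundary: "eta_boundary \<rho>\<^sub>1 x = exp \<xi>"
    if lim: "(T.v \<longlongrightarrow> \<xi>) (at (of_real x) within {z. Im z > 0})" for x \<xi>
  proof -
    \<comment> \<open>\<open>Lim\<close> determines the limit only for a nontrivial filter; the
      vertical sequence witnesses that.\<close>
    have nt: "at (complex_of_real x) within {z. Im z > 0} \<noteq> bot"
    proof
      assume "at (complex_of_real x) within {z. Im z > 0} = bot"
      hence "filterlim (T.approach x) bot sequentially" using T.approach_filterlim[of x] by simp
      hence "filtermap (T.approach x) sequentially = bot"
        unfolding filterlim_def by (rule bot.extremum_uniqueI)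
      thus False by (simp add: filtermap_bot_iff)
    qed
    have "((\<lambda>z. exp (T.v z)) \<longlongrightarrow> exp \<xi>) (at (of_real x) within {z. Im z > 0})"
      by (rule tendsto_exp[OF lim])
    moreover have "eventually (\<lambda>z. exp (T.v z) = eta \<rho>\<^sub>1 z) (at (of_real x) within {z. Im z > 0})"
      unfolding eventually_at_filter by (rule always_eventually) (use T.exp_v in auto)
    ultimately have "(eta \<rho>\<^sub>1 \<longlongrightarrow> exp \<xi>) (at (of_real x) within {z. Im z > 0})"
      by (rule Lim_transform_eventually)
    thus ?thesis unfolding eta_boundary_def uhp by (rule tendsto_Lim[OF nt])
  qed
  define X0 where "X0 = 1 / x\<^sub>0"
  have X0: "X0 > 0" using assms(18) by (simp add: X0_def)
  obtain \<zeta> where \<zeta>: "(T.v \<longlongrightarrow> \<zeta>) (at (of_real X0) within {z. Im z > 0})" "0 \<le> Im \<zeta>" "Im \<zeta> < pi"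
    by (rule T.boundary_limit[OF X0])
  have bd0: "eta_boundary \<rho>\<^sub>1 (1 / x\<^sub>0) = exp \<zeta>" using boundary[OF \<zeta>(1)] by (simp add: X0_def)
  \<comment> \<open>A boundary value in the open half-plane would give a positive density at the
    endpoint, since the weight is positive there.\<close>
  have Im\<zeta>: "Im \<zeta> = 0"
  proof (rule ccontr)
    assume "Im \<zeta> \<noteq> 0"
    hence up: "Im (exp \<zeta>) > 0" using \<zeta> by (simp add: Im_exp sin_gt_zero)
    hence "exp \<zeta> \<notin> \<real>\<^sub>\<ge>\<^sub>0" by (auto simp: complex_nonneg_Reals_iff)
    hence "haar_density \<mu>\<^sub>1 \<rho>\<^sub>1 x\<^sub>0 > 0"
      using haar_density_upper[OF m1 bd0 up] M1.weight_pos up by simp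
    thus False using assms(20) by simp
  qed
  define W where "W = exp (Re \<zeta>)"
  have W: "W > 0" by (simp add: W_def)
  have expz: "exp \<zeta> = of_real W" using Im\<zeta> by (simp add: W_def complex_eq_iff Re_exp Im_exp)
  have atom: "measure \<mu>\<^sub>1 {1 / W} = 0"
    using assms(19) unfolding bd0 expz by simp
  \<comment> \<open>Collects the constants of the later chain: Im w0 \<ge> (W/2) sin \<theta>,
    \<theta> \<le> 4 sin \<theta>, and the 2 in the denominator of \<open>N_lower\<close>, so 16 = 2
    times 4 times 2.\<close>
  define K where "K = 16 / (\<Sigma> * W)"
  have K: "K > 0" using \<Sigma> W by (simp add: K_def)
  obtain \<delta>w B where w: "\<delta>w > 0" "B > 0"
    "\<And>w. Im w > 0 \<Longrightarrow> cmod (w - of_real W) < \<delta>w \<Longrightarrow>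
       M1.weight w \<le> K * ((cmod (1 + psi \<mu>\<^sub>1 w))\<^sup>2 + (cmod (psi \<mu>\<^sub>1 w))\<^sup>2) \<Longrightarrow> M1.weight w \<le> B"
    using M1.weight_bounded_near[OF W atom K] by blast
  have "isCont exp \<zeta>" by simp
  moreover have "min \<delta>w (W / 2) > 0" using w W by simp
  ultimately obtain \<epsilon>1 where \<epsilon>1: "\<epsilon>1 > 0" "\<And>\<xi>. dist \<xi> \<zeta> < \<epsilon>1 \<Longrightarrow> dist (exp \<xi>) (exp \<zeta>) < min \<delta>w (W / 2)"
    unfolding continuous_at_eps_delta by blast
  \<comment> \<open>The first bound keeps exp \<xi> in the disc where the weight is controlled and
    its modulus between W/2 and 2 W; the second gives the closeness demanded by
    \<open>two_point_boundary\<close>.\<close>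
  define \<epsilon> where "\<epsilon> = min (\<epsilon>1 / 2) (1 / 2000)"
  have \<epsilon>: "\<epsilon> > 0" "\<epsilon> < \<epsilon>1" "\<epsilon> < 1 / 1000" using \<epsilon>1 by (auto simp: \<epsilon>_def)
  obtain \<delta>1 where \<delta>1: "\<delta>1 > 0" "\<And>z. Im z > 0 \<Longrightarrow> dist z (of_real X0) < \<delta>1 \<Longrightarrow> dist (T.v z) \<zeta> < \<epsilon>"
  proof -
    have "eventually (\<lambda>z. dist (T.v z) \<zeta> < \<epsilon>) (at (of_real X0) within {z. Im z > 0})"
      by (rule tendstoD[OF \<zeta>(1) \<epsilon>(1)])
    then obtain d where "d > 0" "\<forall>z\<in>{z. Im z > 0}. z \<noteq> of_real X0 \<and> dist z (of_real X0) < d \<longrightarrow> dist (T.v z) \<zeta> < \<epsilon>"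
      unfolding eventually_at by blast
    thus ?thesis by (intro that[of d]) auto
  qed
  have "isCont (\<lambda>x. 1 / x) x\<^sub>0" using assms(18) by (intro continuous_intros) auto
  then obtain \<delta>2 where \<delta>2: "\<delta>2 > 0" "\<And>x. dist x x\<^sub>0 < \<delta>2 \<Longrightarrow> dist (1 / x) X0 < \<delta>1"
    unfolding continuous_at_eps_delta X0_def using \<delta>1(1) by blast
  define \<delta> where "\<delta> = min \<delta>2 (x\<^sub>0 / 2)"
  have \<delta>: "\<delta> > 0" "\<delta> \<le> \<delta>2" "\<delta> \<le> x\<^sub>0 / 2" using \<delta>2 assms(18) by (auto simp: \<delta>_def)
  \<comment> \<open>From \<theta>^3/100 \<le> (2/x0) |x - x0|, together with Im w0 \<le> 2 W
    \<theta> and weight \<le> B.\<close>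
  define Q where "Q = (200 / x\<^sub>0) powr (1/3) * (2 * W * B / pi)"
  have est: "\<bar>haar_density \<mu>\<^sub>1 \<rho>\<^sub>1 x / \<bar>x - x\<^sub>0\<bar> powr (1/3)\<bar> \<le> Q" if x: "x \<in> I" "dist x x\<^sub>0 < \<delta>" for x
  proof -
    define X where "X = 1 / x"
    have xp: "x > 0" using x assms(16) by auto
    have X: "X > 0" using xp by (simp add: X_def)
    have Xd: "dist X X0 < \<delta>1" unfolding X_def using \<delta>2(2) x(2) \<delta>(2) by simp
    obtain \<xi> where \<xi>: "(T.v \<longlongrightarrow> \<xi>) (at (of_real X) within {z. Im z > 0})" "0 \<le> Im \<xi>" "Im \<xi> < pi"
      by (rule T.boundary_limit[OF X])
    have bd: "eta_boundary \<rho>\<^sub>1 (1 / x) = exp \<xi>" using boundary[OF \<xi>(1)] by (simp add: X_def)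
    have hp: "haar_density \<mu>\<^sub>1 \<rho>\<^sub>1 x > 0" using assms(21) x by simp
    hence up: "Im (exp \<xi>) > 0"
      by (simp add: haar_density_def bd upper_half_plane_def Let_def split: if_splits)
    define \<theta> where "\<theta> = Im \<xi>"
    have \<theta>: "0 < \<theta>" "\<theta> < pi"
    proof -
      show "\<theta> < pi" using \<xi> by (simp add: \<theta>_def)
      have "\<theta> \<noteq> 0" using up by (auto simp: Im_exp \<theta>_def)
      thus "0 < \<theta>" using \<xi>(2) by (simp add: \<theta>_def)
    qed
    \<comment> \<open>The choice of \<open>\<delta>1\<close> concerns points of the open half-plane
      only; the boundary value at X inherits it, with a weak inequality, along the vertical
      sequence.\<close>
    have near: "dist \<xi> \<zeta> \<le> \<epsilon>"
    proof -
      have vX: "(\<lambda>n. T.v (T.approach X n)) \<longlonglongrightarrow> \<xi>"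
        using filterlim_compose[OF \<xi>(1) T.approach_filterlim] by simp
      hence "(\<lambda>n. dist (T.v (T.approach X n)) \<zeta>) \<longlonglongrightarrow> dist \<xi> \<zeta>"
        by (intro tendsto_intros)
      moreover have "eventually (\<lambda>n. dist (T.v (T.approach X n)) \<zeta> \<le> \<epsilon>) sequentially"
      proof -
        have "(\<lambda>n. dist (T.approach X n) (of_real X0)) \<longlonglongrightarrow> dist (complex_of_real X) (of_real X0)"
          by (intro tendsto_intros T.approach_tendsto)
        moreover have "dist (complex_of_real X) (of_real X0) < \<delta>1" using Xd by simp
        ultimately have "eventually (\<lambda>n. dist (T.approach X n) (of_real X0) < \<delta>1) sequentially"
          by (rule order_tendstoD(2))
        thus ?thesis
          by eventually_elim (use \<delta>1(2)[OF T.Im_approach] in \<open>auto intro: less_imp_le\<close>)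
      qed
      ultimately show ?thesis
        by (intro tendsto_upperbound[OF _ _ sequentially_bot]) auto
    qed
    have cz: "cnj \<zeta> = \<zeta>" using Im\<zeta> by (simp add: complex_eq_iff)
    have th_le: "\<theta> \<le> cmod (\<xi> - \<zeta>)"
      using abs_Im_le_cmod[of "\<xi> - \<zeta>"] Im\<zeta> by (simp add: \<theta>_def)
    hence th1: "\<theta> \<le> 1" using near \<epsilon> by (simp add: dist_norm)
    have "\<theta> ^ 3 / 100 \<le> cmod (\<xi> - \<zeta>) ^ 3 / 100"
      using th_le \<theta> by (intro divide_right_mono power_mono) auto
    also have "\<dots> \<le> \<bar>ln X - ln X0\<bar>"
      by (rule T.two_point_boundary[OF X X0 \<xi>(1) \<zeta>(1)]) (use near \<epsilon> cz in \<open>simp add: dist_norm\<close>)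
    also have "\<dots> = \<bar>ln x - ln x\<^sub>0\<bar>"
      using xp assms(18) by (simp add: X_def X0_def ln_div abs_minus_commute)
    also have "\<dots> \<le> 2 / x\<^sub>0 * \<bar>x - x\<^sub>0\<bar>"
      using ln_diff_bound[OF assms(18), of x] x(2) \<delta>(3) by (simp add: dist_real_def)
    finally have th3: "\<theta> ^ 3 \<le> 200 / x\<^sub>0 * \<bar>x - x\<^sub>0\<bar>" by simp
    have th: "\<theta> \<le> (200 / x\<^sub>0) powr (1/3) * \<bar>x - x\<^sub>0\<bar> powr (1/3)"
    proof -
      have "\<theta> = (\<theta> ^ 3) powr (1/3)" using \<theta> by (simp add: powr_powr flip: powr_numeral)
      also have "\<dots> \<le> (200 / x\<^sub>0 * \<bar>x - x\<^sub>0\<bar>) powr (1/3)"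
        using th3 \<theta> by (intro powr_mono2) auto
      also have "\<dots> = (200 / x\<^sub>0) powr (1/3) * \<bar>x - x\<^sub>0\<bar> powr (1/3)"
        by (rule powr_mult)
      finally show ?thesis .
    qed
    define w0 where "w0 = exp \<xi>"
    have w0d: "cmod (w0 - of_real W) < \<delta>w" "cmod (w0 - of_real W) < W / 2"
      using \<epsilon>1(2)[of \<xi>] near \<epsilon> by (auto simp: w0_def expz dist_norm)
    have w0n: "W / 2 \<le> cmod w0" "cmod w0 \<le> 2 * W"
    proof -
      have c: "cmod (complex_of_real W) = W" using W by simp
      show "W / 2 \<le> cmod w0"
        using norm_triangle_ineq2[of "of_real W" w0] w0d(2) norm_minus_commute[of "of_real W" w0] unfolding c by linarith
      show "cmod w0 \<le> 2 * W"
        using norm_triangle_ineq2[of w0 "of_real W"] w0d(2) W unfolding c by linarith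
    qed
    have up0: "Im w0 > 0" using up by (simp add: w0_def)
    have n0: "w0 \<notin> \<real>\<^sub>\<ge>\<^sub>0" using up0 by (auto simp: complex_nonneg_Reals_iff)
    have Im0: "Im w0 = cmod w0 * sin \<theta>" by (simp add: w0_def \<theta>_def Im_exp)
    have ImN: "Im (N w0) = \<theta>"
      unfolding w0_def \<theta>_def using T.Im_N_boundary[OF X \<xi>(1)] \<theta> by (simp add: \<theta>_def)
    let ?P = "(cmod (1 + psi \<mu>\<^sub>1 w0))\<^sup>2 + (cmod (psi \<mu>\<^sub>1 w0))\<^sup>2"
    have Ppos: "?P > 0" using M1.one_plus_psi_nonzero[OF n0] by (simp add: add_pos_nonneg)
    \<comment> \<open>Clearing |1 + \<psi>|^2 replaces \<eta>, which may become infinite in the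
      limit, by the expression in \<psi> that \<open>weight_bounded_near\<close> accepts.\<close>
    have quot: "Im (eta \<mu>\<^sub>1 w0) / (2 * (1 + (cmod (eta \<mu>\<^sub>1 w0))\<^sup>2)) = Im w0 * M1.weight w0 / (2 * ?P)"
    proof -
      let ?q = "(cmod (1 + psi \<mu>\<^sub>1 w0))\<^sup>2"
      have q: "?q > 0" using M1.one_plus_psi_nonzero[OF n0] by simp
      have "(cmod (eta \<mu>\<^sub>1 w0))\<^sup>2 = (cmod (psi \<mu>\<^sub>1 w0))\<^sup>2 / ?q"
        by (simp add: eta_def norm_divide power_divide)
      hence "1 + (cmod (eta \<mu>\<^sub>1 w0))\<^sup>2 = ?P / ?q" using q by (simp add: add_divide_distrib)
      thus ?thesis unfolding M1.Im_eta[OF n0] using q by simp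
    qed
    have "M1.weight w0 \<le> K * ?P"
    proof -
      have "\<Sigma> * (Im w0 * M1.weight w0 / (2 * ?P)) \<le> \<theta>"
        using N_lower[OF up0] unfolding quot ImN .
      hence "\<Sigma> * (Im w0 * M1.weight w0) \<le> \<theta> * (2 * ?P)"
        using Ppos by (simp add: pos_divide_le_eq)
      also have "\<theta> \<le> 4 * sin \<theta>"
      proof -
        have "\<theta> / sin \<theta> \<le> 4" using div_sin_le_4[of \<theta>] \<theta> th1 pi_gt3 by simp
        thus ?thesis using sin_gt_zero[OF \<theta>] by (simp add: pos_divide_le_eq)
      qed
      hence "\<theta> * (2 * ?P) \<le> 4 * sin \<theta> * (2 * ?P)"
        using Ppos by (intro mult_right_mono) auto
      finally have 1: "\<Sigma> * (Im w0 * M1.weight w0) \<le> 4 * sin \<theta> * (2 * ?P)" .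
      have s: "sin \<theta> > 0" by (rule sin_gt_zero[OF \<theta>])
      have "sin \<theta> * (\<Sigma> * (W / 2) * M1.weight w0) \<le> sin \<theta> * (\<Sigma> * cmod w0 * M1.weight w0)"
        using s \<Sigma> w0n(1) M1.weight_pos[OF n0] by (intro mult_left_mono mult_right_mono) auto
      also have "\<dots> \<le> sin \<theta> * (8 * ?P)" using 1 unfolding Im0 by (simp add: mult_ac)
      finally have "\<Sigma> * (W / 2) * M1.weight w0 \<le> 8 * ?P" using s by simp
      hence "M1.weight w0 \<le> 8 * ?P / (\<Sigma> * (W / 2))"
        using \<Sigma> W by (simp add: pos_le_divide_eq mult.commute)
      also have "\<dots> = K * ?P" by (simp add: K_def)
      finally show ?thesis .
    qed
    hence wB: "M1.weight w0 \<le> B" by (rule w(3)[OF up0 w0d(1)])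
    have "haar_density \<mu>\<^sub>1 \<rho>\<^sub>1 x = Im w0 * M1.weight w0 / pi"
      by (rule haar_density_upper[OF m1 bd[folded w0_def] up0])
    also have "\<dots> \<le> (2 * W * \<theta>) * B / pi"
    proof (intro divide_right_mono mult_mono wB)
      have "cmod w0 * sin \<theta> \<le> (2 * W) * \<theta>"
        using w0n(2) sin_x_le_x[of \<theta>] \<theta> sin_gt_zero[OF \<theta>] W by (intro mult_mono) auto
      thus "Im w0 \<le> 2 * W * \<theta>" unfolding Im0 .
    qed (use W \<theta> M1.weight_pos[OF n0] in auto)
    also have "\<dots> = \<theta> * (2 * W * B / pi)" by simp
    also have "\<dots> \<le> ((200 / x\<^sub>0) powr (1/3) * \<bar>x - x\<^sub>0\<bar> powr (1/3)) * (2 * W * B / pi)"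
      using th W w(2) by (intro mult_right_mono) auto
    also have "\<dots> = Q * \<bar>x - x\<^sub>0\<bar> powr (1/3)" by (simp add: Q_def)
    finally have le: "haar_density \<mu>\<^sub>1 \<rho>\<^sub>1 x \<le> Q * \<bar>x - x\<^sub>0\<bar> powr (1/3)" .
    \<comment> \<open>The densities at the two points differ; this excludes the default value of
      division by zero in the quotient.\<close>
    have "x \<noteq> x\<^sub>0" using hp assms(20) by auto
    hence "\<bar>x - x\<^sub>0\<bar> powr (1/3) > 0" by simp
    thus ?thesis using le hp by (simp add: pos_divide_le_eq)
  qed
  have "bounded ((\<lambda>x. haar_density \<mu>\<^sub>1 \<rho>\<^sub>1 x / \<bar>x - x\<^sub>0\<bar> powr (1/3)) ` (I \<inter> ball x\<^sub>0 \<delta>))"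
    unfolding bounded_iff
  proof (intro exI[of _ Q] ballI)
    fix y assume "y \<in> (\<lambda>x. haar_density \<mu>\<^sub>1 \<rho>\<^sub>1 x / \<bar>x - x\<^sub>0\<bar> powr (1/3)) ` (I \<inter> ball x\<^sub>0 \<delta>)"
    then obtain x where "x \<in> I" "dist x x\<^sub>0 < \<delta>" "y = haar_density \<mu>\<^sub>1 \<rho>\<^sub>1 x / \<bar>x - x\<^sub>0\<bar> powr (1/3)"
      by (auto simp: dist_commute)
    thus "norm y \<le> Q" using est by simp
  qed
  thus ?thesis using \<delta>(1) by blast
qed

end
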